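(* Fix $t\ge1$, a matrix $\Sigma_{x,t-1}\in\mathbb S^{n_x}_+$ (the posterior covariance carried from stage $t-1$), and $\theta_t\ge0$, and consider the stage-wise local linear-Gaussian surrogate minimax estimation problem described in the context, with value $$J_t=\inf_{\phi}\ \sup_{\mathbb P\in\mathbb D_{\epsilon,t}(\theta_t)}\ \mathbb E_{\mathbb P}\bigl[\|e_t^--\phi(\hat\nu_t)\|^2\bigr].$$ This problem is equivalent (its value $J_t$ equals the optimal value) to the finite-dimensional semidefinite program $$\begin{aligned} \max\quad&\operatorname{Tr}(\Sigma_{x,t})\\ \text{s.t.}\quad&\Sigma_{x,t}^-=A_{t-1}\Sigma_{x,t-1}A_{t-1}^\top+\Sigma_{w,t-1},\\ &\begin{bmatrix} \Sigma_{x,t}^- - \Sigma_{x,t} & T_t \\ T_t^\top & S_t \end{bmatrix}\succeq0,\quad \begin{bmatrix} \hat\Sigma_{\epsilon,t} & Z_t \\ Z_t^\top & \Sigma_{\epsilon,t} \end{bmatrix}\succeq0,\\ &\operatorname{Tr}(\Sigma_{\epsilon,t}+\hat\Sigma_{\epsilon,t}-2Z_t)\le\theta_t^2,\quad \Sigma_{\epsilon,t}\succeq\lambda_{\min}(\hat\Sigma_{\epsilon,t})I_{n_x+n_y},\\ &\Sigma_{\epsilon,t}=\begin{bmatrix} \Sigma_{w,t-1} & \Sigma_{wv,t-1} \\ \Sigma_{wv,t-1}^\top & \Sigma_{v,t} \end{bmatrix}\in\mathbb S^{n_x+n_y}_+, \end{aligned}$$ over $\Sigma_{x,t}^-,\Sigma_{x,t},\Sigma_{w,t-1}\in\mathbb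 S^{n_x}_+$, $\Sigma_{v,t}\in\mathbb S^{n_y}_+$, $\Sigma_{wv,t-1}\in\mathbb R^{n_x\times n_y}$, $Z_t\in\mathbb R^{(n_x+n_y)\times(n_x+n_y)}$, where $$T_t:=\Sigma_{x,t}^-C_t^\top+\Sigma_{wv,t-1},\qquad S_t:=C_t\Sigma_{x,t}^-C_t^\top+\Sigma_{v,t}+C_t\Sigma_{wv,t-1}+\Sigma_{wv,t-1}^\top C_t^\top .$$ Moreover, the semidefinite program attains its optimum. If $\Sigma_{x,t}^*$ and $\Sigma_{\epsilon,t}^*$ are (components of a solution) optimal for it, with associated blocks $(T_t^*,S_t^* )$, then the law $\mathcal N(\hat\epsilon_t,\Sigma_{\epsilon,t}^* )$ is a least-favorable stacked noise law for the surrogate, and $\phi^*(\hat\nu_t)=K_t^*\hat\nu_t$ with $K_t^*=T_t^*(S_t^* )^{-1}$ is minimax optimal; i.e. the minimax-optimal state estimate has the innovation form $\bar x_t^-+K_t^*\nu_t$.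
   Context: $\mathbb S^n_+$ denotes symmetric PSD $n\times n$ matrices, $\lambda_{\min}$ the smallest eigenvalue, and $W_2$ the type-2 Wasserstein distance (Euclidean cost) on $\mathcal P_2(\mathbb R^d)$, the probability measures on $\mathbb R^d$ with finite second moments. Ambiguity set. $\hat\epsilon_t=[\hat w_{t-1}^\top,\hat v_t^\top]^\top\in\mathbb R^{n_x+n_y}$, $\hat\Sigma_{\epsilon,t}=\operatorname{diag}(\hat\Sigma_{w,t-1},\hat\Sigma_{v,t})$ with $\hat\Sigma_{w,t-1},\hat\Sigma_{v,t}$ positive definite, $\hat{\mathbb Q}_{\epsilon,t}=\mathcal N(\hat\epsilon_t,\hat\Sigma_{\epsilon,t})$, and $\mathbb D_{\epsilon,t}(\theta_t)=\{\mathbb P\in\mathcal P_2(\mathbb R^{n_x+n_y}):W_2(\mathbb P,\hat{\mathbb Q}_{\epsilon,t})\le\theta_t\}$. Surrogate. The original task is to estimate the state $x_t$ of $x_t=f(x_{t-1},u_{t-1})+w_{t-1}$, $y_t=h(x_t)+v_t$ from $y_0,\dots,y_t$, with $f,h$ twice continuously differentiable. Conditionally on $y_0,\dots,y_{t-1}$, the following are fixed: the previous estimate $\bar x_{t-1}$, the prior mean $\bar x_t^-=f(\bar x_{t-1},u_{t-1})+\hat w_{t-1}$, and the Jacobians $A_{t-1}=\frac{\partial f}{\partial x}(\bar x_{t-1},u_{t-1})\in\mathbb R^{n_x\times n_x}$, $C_t=\frac{\partial h}{\partial x}(\bar x_t^-)\in\mathbb R^{n_y\times n_x}$. In the local linear-Gaussian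 surrogate (everything conditional on $y_0,\dots,y_{t-1}$), the previous error is $e_{t-1}\sim\mathcal N(0,\Sigma_{x,t-1})$, independent of the stacked noise $\epsilon_t=[w_{t-1}^\top,v_t^\top]^\top\sim\mathbb P$; the prior error $e_t^-=x_t-\bar x_t^-$ is modeled as $e_t^-=A_{t-1}e_{t-1}+(w_{t-1}-\hat w_{t-1})$; and the innovation $\nu_t=y_t-h(\bar x_t^-)-\hat v_t$ is modeled as $\hat\nu_t=C_te_t^-+(v_t-\hat v_t)$. Since $y_t\mapsto\nu_t$ is a bijection given the past, an estimator of $x_t$ is written $\bar x_t^-+\phi(\nu_t)$ with $\phi:\mathbb R^{n_y}\to\mathbb R^{n_x}$ measurable; $\phi$ ranges over all such maps in the definition of $J_t$. $\mathbb E_{\mathbb P}$ is expectation under the product of $\mathcal N(0,\Sigma_{x,t-1})$ for $e_{t-1}$ and $\mathbb P$ for $\epsilon_t$. A law $\mathbb P^*\in\mathbb D_{\epsilon,t}(\theta_t)$ is least favorable if it maximizes $\mathbb P\mapsto\inf_\phi\mathbb E_{\mathbb P}[\|e_t^--\phi(\hat\nu_t)\|^2]$ over $\mathbb D_{\epsilon,t}(\theta_t)$; $\phi^*$ is minimax optimal if $\sup_{\mathbb P\in\mathbb D_{\epsilon,t}(\theta_t)}\mathbb E_{\mathbb P}[\|e_t^--\phi^*(\hat\nu_t)\|^2]=J_t$. *)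

theory Defs
  imports "HOL-Probability.Probability"
begin

section \<open>Matrices and block structure\<close>

definition psd :: "real^'n^'n \<Rightarrow> bool" where
  "psd M \<longleftrightarrow> transpose M = M \<and> (\<forall>x. 0 \<le> x \<bullet> (M *v x))"

definition posdef :: "real^'n^'n \<Rightarrow> bool" where
  "posdef M \<longleftrightarrow> transpose M = M \<and> (\<forall>x. x \<noteq> 0 \<longrightarrow> 0 < x \<bullet> (M *v x))"

definition loewner_ge :: "real^'n^'n \<Rightarrow> real^'n^'n \<Rightarrow> bool" where
  "loewner_ge M N \<longleftrightarrow> psd (M - N)"

definition eigenvalue_of :: "real^'n^'n \<Rightarrow> real \<Rightarrow> bool" where
  "eigenvalue_of M l \<longleftrightarrow> (\<exists>x. x \<noteq> 0 \<and> M *v x = l *\<^sub>R x)"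

text \<open>Only used for symmetric matrices, where a smallest real eigenvalue exists.\<close>

definition lambda_min :: "real^'n^'n \<Rightarrow> real" where
  "lambda_min M = (LEAST l. eigenvalue_of M l)"

text \<open>Stacked vectors and block matrices are indexed by the disjoint sum of the index types,
  \<open>Inl\<close> for the upper (left) part and \<open>Inr\<close> for the lower (right) part.\<close>

definition stack :: "real^'n \<Rightarrow> real^'m \<Rightarrow> real^('n + 'm)" where
  "stack a b = (\<chi> i. case i of Inl k \<Rightarrow> a $ k | Inr k \<Rightarrow> b $ k)"

definition upper :: "real^('n::finite + 'm::finite) \<Rightarrow> real^'n" where
  "upper z = (\<chi> k. z $ Inl k)"

definition lower :: "real^('n::finite + 'm::finite) \<Rightarrow> real^'m" where
  "lower z = (\<chi> k. z $ Inr k)"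

definition block ::
  "real^'p^'n \<Rightarrow> real^'q^'n \<Rightarrow> real^'p^'m \<Rightarrow> real^'q^'m \<Rightarrow> real^('p + 'q)^('n + 'm)" where
  "block M11 M12 M21 M22 = (\<chi> i j. case i of
      Inl k \<Rightarrow> (case j of Inl l \<Rightarrow> M11 $ k $ l | Inr l \<Rightarrow> M12 $ k $ l)
    | Inr k \<Rightarrow> (case j of Inl l \<Rightarrow> M21 $ k $ l | Inr l \<Rightarrow> M22 $ k $ l))"


section \<open>Twice continuously differentiable maps\<close>

definition twice_cont_diff :: "('a::real_normed_vector \<Rightarrow> 'b::real_normed_vector) \<Rightarrow> bool" where
  "twice_cont_diff g \<longleftrightarrow>
    (\<exists>(g' :: 'a \<Rightarrow> 'a \<Rightarrow>\<^sub>L 'b) (g'' :: 'a \<Rightarrow> 'a \<Rightarrow>\<^sub>L 'a \<Rightarrow>\<^sub>L 'b).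
      (\<forall>x. (g has_derivative blinfun_apply (g' x)) (at x)) \<and>
      (\<forall>x. (g' has_derivative blinfun_apply (g'' x)) (at x)) \<and>
      continuous_on UNIV g'')"


section \<open>Gaussian laws, second moments and the Wasserstein distance\<close>

definition std_gaussian :: "(real^'n) measure" where
  "std_gaussian = density lborel (\<lambda>x. ennreal (\<Prod>i\<in>UNIV. std_normal_density (x $ i)))"

text \<open>The positive semidefinite square root of a positive semidefinite matrix is unique, so
  the choice operator below has only one candidate.\<close>

definition psd_sqrt :: "real^'n^'n \<Rightarrow> real^'n^'n" where
  "psd_sqrt M = (SOME R. psd R \<and> R ** R = M)"

text \<open>The covariance may be singular, hence an affine image of the standard law rather than
  a density.\<close>

definition gaussian :: "real^'n \<Rightarrow> real^'n^'n \<Rightarrow> (real^'n) measure" where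
  "gaussian m S = distr std_gaussian borel (\<lambda>z. m + psd_sqrt S *v z)"

definition P2 :: "('a::euclidean_space) measure set" where
  "P2 = {P. prob_space P \<and> sets P = sets borel \<and> (\<integral>\<^sup>+ x. ennreal ((norm x)\<^sup>2) \<partial>P) < \<infinity>}"

definition couplings :: "('a::euclidean_space) measure \<Rightarrow> 'a measure \<Rightarrow> ('a \<times> 'a) measure set" where
  "couplings P Q = {M. prob_space M \<and> sets M = sets (borel \<Otimes>\<^sub>M borel)
      \<and> distr M borel fst = P \<and> distr M borel snd = Q}"

text \<open>On \<open>P2\<close> the infimum is finite, so \<open>enn2real\<close> loses nothing there.\<close>

definition W2 :: "('a::euclidean_space) measure \<Rightarrow> 'a measure \<Rightarrow> real" where
  "W2 P Q = sqrt (enn2real (INF M\<in>couplings P Q. \<integral>\<^sup>+ z. ennreal ((dist (fst z) (snd z))\<^sup>2) \<partial>M))"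

definition W2_ball :: "('a::euclidean_space) measure \<Rightarrow> real \<Rightarrow> 'a measure set" where
  "W2_ball Q r = {P \<in> P2. W2 P Q \<le> r}"


section \<open>Minimax estimation\<close>

text \<open>Risks take values in \<open>[0,\<infinity>]\<close>, because an arbitrary measurable estimator may have infinite
  mean square error.\<close>

type_synonym ('p, 'y, 'x) risk = "'p \<Rightarrow> ('y \<Rightarrow> 'x) \<Rightarrow> ennreal"

definition worst_risk :: "('p, 'y, 'x) risk \<Rightarrow> 'p set \<Rightarrow> ('y \<Rightarrow> 'x) \<Rightarrow> ennreal" where
  "worst_risk R D \<phi> = (SUP P\<in>D. R P \<phi>)"

definition bayes_risk ::
  "('p, 'y::euclidean_space, 'x::euclidean_space) risk \<Rightarrow> 'p \<Rightarrow> ennreal" where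
  "bayes_risk R P = (INF \<phi>\<in>borel_measurable borel. R P \<phi>)"

definition minimax_value ::
  "('p, 'y::euclidean_space, 'x::euclidean_space) risk \<Rightarrow> 'p set \<Rightarrow> ennreal" where
  "minimax_value R D = (INF \<phi>\<in>borel_measurable borel. worst_risk R D \<phi>)"

definition minimax_optimal ::
  "('p, 'y::euclidean_space, 'x::euclidean_space) risk \<Rightarrow> 'p set \<Rightarrow> ('y \<Rightarrow> 'x) \<Rightarrow> bool" where
  "minimax_optimal R D \<phi> \<longleftrightarrow>
    \<phi> \<in> borel_measurable borel \<and> worst_risk R D \<phi> = minimax_value R D"

definition least_favorable ::
  "('p, 'y::euclidean_space, 'x::euclidean_space) risk \<Rightarrow> 'p set \<Rightarrow> 'p \<Rightarrow> bool" where
  "least_favorable R D P \<longleftrightarrow> P \<in> D \<and> (\<forall>Q\<in>D. bayes_risk R Q \<le> bayes_risk R P)"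


section \<open>The local linear-Gaussian surrogate\<close>

text \<open>In this section \<open>e\<close> is the previous error and \<open>\<epsilon>\<close> the stacked noise, whose upper part is the
  process noise and whose lower part is the measurement noise; \<open>wh\<close> and \<open>vh\<close> are the nominal
  noise means.\<close>

definition prior_error ::
  "real^'nx^'nx \<Rightarrow> real^'nx \<Rightarrow> real^'nx \<Rightarrow> real^('nx::finite + 'ny::finite) \<Rightarrow> real^'nx" where
  "prior_error A wh e \<epsilon> = A *v e + (upper \<epsilon> - wh)"

definition surrogate_innovation ::
  "real^'nx^'nx \<Rightarrow> real^'nx^'ny \<Rightarrow> real^'nx \<Rightarrow> real^'ny \<Rightarrow> real^'nx \<Rightarrow> real^('nx::finite + 'ny::finite) \<Rightarrow> real^'ny"
  where
  "surrogate_innovation A C wh vh e \<epsilon> = C *v prior_error A wh e \<epsilon> + (lower \<epsilon> - vh)"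

definition surrogate_risk ::
  "real^'nx^'nx \<Rightarrow> real^'nx^'ny \<Rightarrow> real^'nx^'nx \<Rightarrow> real^'nx \<Rightarrow> real^'ny
    \<Rightarrow> ((real^('nx::finite + 'ny::finite)) measure, real^'ny, real^'nx) risk" where
  "surrogate_risk A C Sx wh vh P \<phi> =
    (\<integral>\<^sup>+ (e, \<epsilon>). ennreal ((norm (prior_error A wh e \<epsilon>
        - \<phi> (surrogate_innovation A C wh vh e \<epsilon>)))\<^sup>2) \<partial>(gaussian 0 Sx \<Otimes>\<^sub>M P))"

text \<open>The same risk for an estimator \<open>\<psi>\<close> of the state as a function of the measurement. Here
  \<open>xm\<close> is the prior mean and \<open>ym\<close> the predicted measurement, so that the surrogate state and
  measurement are \<open>xm\<close> plus the prior error and \<open>ym\<close> plus the innovation.\<close>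

definition state_risk ::
  "real^'nx^'nx \<Rightarrow> real^'nx^'ny \<Rightarrow> real^'nx^'nx \<Rightarrow> real^'nx \<Rightarrow> real^'ny \<Rightarrow> real^'nx \<Rightarrow> real^'ny
    \<Rightarrow> ((real^('nx::finite + 'ny::finite)) measure, real^'ny, real^'nx) risk" where
  "state_risk A C Sx wh vh xm ym P \<psi> =
    (\<integral>\<^sup>+ (e, \<epsilon>). ennreal ((norm ((xm + prior_error A wh e \<epsilon>)
        - \<psi> (ym + surrogate_innovation A C wh vh e \<epsilon>)))\<^sup>2) \<partial>(gaussian 0 Sx \<Otimes>\<^sub>M P))"


section \<open>The semidefinite program\<close>

record ('nx::finite, 'ny::finite) sdp_point =
  prior_cov :: "real^'nx^'nx"
  post_cov :: "real^'nx^'nx"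
  w_cov :: "real^'nx^'nx"
  v_cov :: "real^'ny^'ny"
  wv_cov :: "real^'ny^'nx"
  cross_cov :: "real^('nx + 'ny)^('nx + 'ny)"

definition noise_cov ::
  "('nx, 'ny) sdp_point \<Rightarrow> real^('nx::finite + 'ny::finite)^('nx + 'ny)" where
  "noise_cov s = block (w_cov s) (wv_cov s) (transpose (wv_cov s)) (v_cov s)"

definition T_block ::
  "real^'nx^'ny \<Rightarrow> ('nx::finite, 'ny::finite) sdp_point \<Rightarrow> real^'ny^'nx" where
  "T_block C s = prior_cov s ** transpose C + wv_cov s"

definition S_block ::
  "real^'nx^'ny \<Rightarrow> ('nx::finite, 'ny::finite) sdp_point \<Rightarrow> real^'ny^'ny" where
  "S_block C s = C ** prior_cov s ** transpose C + v_cov s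
      + C ** wv_cov s + transpose (wv_cov s) ** transpose C"

definition sdp_feasible ::
  "real^'nx^'nx \<Rightarrow> real^'nx^'ny \<Rightarrow> real^'nx^'nx \<Rightarrow> real^('nx::finite + 'ny::finite)^('nx + 'ny) \<Rightarrow> real
    \<Rightarrow> ('nx, 'ny) sdp_point \<Rightarrow> bool" where
  "sdp_feasible A C Sx Sh \<theta> s \<longleftrightarrow>
      psd (prior_cov s) \<and> psd (post_cov s) \<and> psd (w_cov s) \<and> psd (v_cov s)
    \<and> prior_cov s = A ** Sx ** transpose A + w_cov s
    \<and> psd (block (prior_cov s - post_cov s) (T_block C s)
                 (transpose (T_block C s)) (S_block C s))
    \<and> psd (block Sh (cross_cov s) (transpose (cross_cov s)) (noise_cov s))
    \<and> trace (noise_cov s + Sh - 2 *\<^sub>R cross_cov s) \<le> \<theta>\<^sup>2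
    \<and> loewner_ge (noise_cov s) (lambda_min Sh *\<^sub>R mat 1)
    \<and> psd (noise_cov s)"

definition sdp_optimal ::
  "real^'nx^'nx \<Rightarrow> real^'nx^'ny \<Rightarrow> real^'nx^'nx \<Rightarrow> real^('nx::finite + 'ny::finite)^('nx + 'ny) \<Rightarrow> real
    \<Rightarrow> ('nx, 'ny) sdp_point \<Rightarrow> bool" where
  "sdp_optimal A C Sx Sh \<theta> s \<longleftrightarrow> sdp_feasible A C Sx Sh \<theta> s \<and>
    (\<forall>s'. sdp_feasible A C Sx Sh \<theta> s' \<longrightarrow> trace (post_cov s') \<le> trace (post_cov s))"

text \<open>Feasible objective values are nonnegative (\<open>post_cov\<close> is positive semidefinite), so
  \<open>ennreal\<close> does not truncate them.\<close>

definition sdp_value ::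
  "real^'nx^'nx \<Rightarrow> real^'nx^'ny \<Rightarrow> real^'nx^'nx \<Rightarrow> real^('nx::finite + 'ny::finite)^('nx + 'ny)
    \<Rightarrow> real \<Rightarrow> ennreal" where
  "sdp_value A C Sx Sh \<theta> =
    (SUP s \<in> {s :: ('nx, 'ny) sdp_point. sdp_feasible A C Sx Sh \<theta> s}. ennreal (trace (post_cov s)))"

end

theory Submission
  imports Defs "HOL-Real_Asymp.Real_Asymp"
begin

text \<open>For a gain \<open>K\<close>, the risk of \<open>\<nu> \<mapsto> K \<nu>\<close> under a noise law with mean \<open>m\<close> depends only on the
  covariance \<open>S\<close>: it is \<open>mse S K\<close>, affine in \<open>S\<close> and quadratic in \<open>K\<close>. Under the Gaussian law with
  covariance \<open>S\<close> the best gain is best among all estimators, because the symmetry of the Gaussian law that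
  flips the residual and fixes the innovation makes any correction by a function of the innovation
  useless. The semidefinite program maximises \<open>S \<mapsto> min\<^sub>K mse S K\<close> over a compact convex set of
  covariances, and a first-order argument along segments shows that a maximiser together with its gain is
  a saddle point of \<open>mse\<close> on that set. Finally, for fixed \<open>K\<close> the worst law in the
  Wasserstein ball, non-Gaussian laws included, is no worse than some covariance of the set: by duality
  it is dominated by the nominal law stretched by \<open>\<gamma> (\<gamma> I - G\<^sup>T G)\<^sup>-\<^sup>1\<close>, where \<open>G\<close> maps the noise to the error.
  This stretching is at least the identity, whence the eigenvalue constraint of the program.\<close>

section \<open>Symmetric matrices\<close>

text \<open>The two bounds that meet at the value are of different kinds: one gain is tested against
  all laws of the ball, and one Gaussian law against all measurable estimators. Laws of the ball may
  have a mean other than the nominal one. The dual bound controls second moments about the nominal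
  mean, so a shift of the mean is charged to a covariance like any other transport. Couplings are
  taken nearly optimal, at an arbitrarily small error. The eigenvalue constraint has a second role
  besides describing the stretched law: it bounds every innovation covariance from below, uniformly
  over the feasible set. This makes the gain well defined and keeps its change along a segment of
  order \<open>s\<close>, which the first-order argument needs. The block inequalities of the
  program enter as scalar quadratic inequalities at chosen vectors; this yields a bound by the error
  of every gain, with equality for the optimal one.\<close>

lemma matrix_diff_ldistrib: "A ** (B - C) = A ** B - A ** C" for A :: "real^'m^'n"
  by (simp add: matrix_matrix_mult_def vec_eq_iff right_diff_distrib sum_subtractf)

lemma matrix_diff_rdistrib: "(B - C) ** A = B ** A - C ** A" for A :: "real^'m^'n"
  by (simp add: matrix_matrix_mult_def vec_eq_iff left_diff_distrib sum_subtractf)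

lemma matrix_add_rdistrib: "(B + C) ** A = B ** A + C ** A" for A :: "real^'m^'n"
  by (simp add: matrix_matrix_mult_def vec_eq_iff distrib_right sum.distrib)

lemma matrix_vector_mult_minus: "M *v (- y) = - (M *v y)" for M :: "real^'m^'n"
  using matrix_vector_mult_scaleR[of M "-1" y] by simp

lemma transpose_add: "transpose (A + B) = transpose A + transpose B"
  by (simp add: transpose_def vec_eq_iff)

lemma transpose_diff: "transpose (A - B) = transpose A - transpose (B :: real^'m^'n)"
  by (simp add: transpose_def vec_eq_iff)

lemma trace_scaleR: "trace (c *\<^sub>R A) = c * trace A" for A :: "real^'n^'n"
  by (simp add: trace_def sum_distrib_left)

lemma trace_transpose: "trace (transpose A) = trace A"
  by (simp add: trace_def transpose_def)

lemma inner_matrix_vector: "x \<bullet> (M *v y) = (transpose M *v x) \<bullet> y" for M :: "real^'m^'n"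
  by (simp add: dot_lmul_matrix transpose_matrix_vector)

lemma matrix_vector_inner: "(M *v x) \<bullet> y = x \<bullet> (transpose M *v y)" for M :: "real^'m^'n"
  using inner_matrix_vector[of x "transpose M" y] by simp

lemma trace_quadratic: "trace M = (\<Sum>i\<in>UNIV. axis i 1 \<bullet> (M *v axis i 1))" for M :: "real^'n^'n"
  by (simp add: trace_def inner_axis' matrix_vector_mul_component inner_axis)

lemma psd_sym: "psd M \<Longrightarrow> transpose M = M"
  by (simp add: psd_def)

lemma psd_nonneg: "psd M \<Longrightarrow> 0 \<le> x \<bullet> (M *v x)"
  by (simp add: psd_def)

lemma posdef_psd: "posdef M \<Longrightarrow> psd M"
  unfolding posdef_def psd_def by (metis inner_zero_left order_less_imp_le order_refl)

lemma psd_add: "psd M \<Longrightarrow> psd N \<Longrightarrow> psd (M + N)"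
  by (simp add: psd_def transpose_add matrix_vector_mult_add_rdistrib inner_add_right)

lemma psd_scaleR: "psd M \<Longrightarrow> 0 \<le> c \<Longrightarrow> psd (c *\<^sub>R M)"
  by (simp add: psd_def transpose_scalar scaleR_matrix_vector_assoc[symmetric])

lemma psd_congruence:
  assumes "psd M" shows "psd (B ** M ** transpose B)"
proof -
  have "x \<bullet> (B ** M ** transpose B *v x) = (transpose B *v x) \<bullet> (M *v (transpose B *v x))" for x
    by (simp add: inner_matrix_vector[of x B] matrix_vector_mul_assoc[symmetric])
  then show ?thesis
    using assms by (simp add: psd_def matrix_transpose_mul matrix_mul_assoc)
qed

lemma trace_nonneg: "psd M \<Longrightarrow> 0 \<le> trace M"
  unfolding trace_quadratic by (intro sum_nonneg psd_nonneg)

lemma posdef_invertible: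
  assumes "posdef M" shows "invertible M"
proof -
  have "x = 0" if "M *v x = 0" for x
    using assms that unfolding posdef_def by (metis inner_zero_right less_irrefl)
  then show ?thesis
    by (metis invertible_left_inverse matrix_left_invertible_ker)
qed

lemma matrix_inv_inverse:
  assumes "invertible M"
  shows "M ** matrix_inv M = mat 1" "matrix_inv M ** M = mat 1"
  using someI_ex[OF assms[unfolded invertible_def]] by (simp_all add: matrix_inv_def)

section \<open>Spectral decomposition of symmetric matrices\<close>

definition orthonormal_family :: "('n::finite \<Rightarrow> real^'n) \<Rightarrow> bool" where
  "orthonormal_family v \<longleftrightarrow> (\<forall>i j. v i \<bullet> v j = (if i = j then 1 else 0))"

text \<open>The spectral sum of \<open>c i\<close> times the projection onto \<open>v i\<close>.
  With \<open>v\<close> fixed, square roots, resolvents and stretchings become pointwise operations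
  on \<open>c\<close>.\<close>

definition eig_mat :: "('n::finite \<Rightarrow> real^'n) \<Rightarrow> ('n \<Rightarrow> real) \<Rightarrow> real^'n^'n" where
  "eig_mat v c = (\<chi> a b. \<Sum>i\<in>UNIV. c i * (v i $ a * v i $ b))"

lemma eig_mat_vec: "eig_mat v c *v x = (\<Sum>i\<in>UNIV. (c i * (v i \<bullet> x)) *\<^sub>R v i)"
proof -
  have "(\<Sum>j\<in>UNIV. (\<Sum>i\<in>UNIV. c i * (v i $ k * v i $ j)) * x $ j)
    = (\<Sum>i\<in>UNIV. c i * (\<Sum>j\<in>UNIV. v i $ j * x $ j) * v i $ k)" for k
    by (simp add: sum_distrib_left sum_distrib_right mult_ac) (rule sum.swap)
  then show ?thesis
    by (simp add: eig_mat_def matrix_vector_mult_def vec_eq_iff inner_vec_def)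
qed

lemma transpose_eig_mat: "transpose (eig_mat v c) = eig_mat v c"
  by (simp add: eig_mat_def transpose_def vec_eq_iff mult_ac)

lemma eig_mat_quadratic: "x \<bullet> (eig_mat v c *v x) = (\<Sum>i\<in>UNIV. c i * (v i \<bullet> x)\<^sup>2)"
  by (simp add: eig_mat_vec inner_sum_right power2_eq_square inner_commute mult_ac)

lemma psd_eig_mat: "(\<And>i. 0 \<le> c i) \<Longrightarrow> psd (eig_mat v c)"
  by (simp add: psd_def transpose_eig_mat eig_mat_quadratic sum_nonneg)

lemma trace_eig_mat_mul: "trace (eig_mat v c ** B) = (\<Sum>i\<in>UNIV. c i * (v i \<bullet> (B *v v i)))"
proof -
  have "trace (eig_mat v c ** B)
      = (\<Sum>a\<in>UNIV. \<Sum>b\<in>UNIV. \<Sum>i\<in>UNIV. c i * (v i $ a * v i $ b) * B $ b $ a)"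
    by (simp add: trace_def matrix_matrix_mult_def eig_mat_def sum_distrib_right)
  also have "\<dots> = (\<Sum>b\<in>UNIV. \<Sum>i\<in>UNIV. \<Sum>a\<in>UNIV. c i * (v i $ a * v i $ b) * B $ b $ a)"
    by (subst sum.swap) (rule sum.cong[OF refl], rule sum.swap)
  also have "\<dots> = (\<Sum>i\<in>UNIV. \<Sum>b\<in>UNIV. \<Sum>a\<in>UNIV. c i * (v i $ a * v i $ b) * B $ b $ a)"
    by (rule sum.swap)
  also have "\<dots> = (\<Sum>i\<in>UNIV. c i * (v i \<bullet> (B *v v i)))"
    unfolding inner_vec_def matrix_vector_mult_def sum_distrib_left
    by (intro sum.cong refl) (simp add: sum_distrib_left mult.assoc mult.commute mult.left_commute)
  finally show ?thesis .
qed

context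
  fixes v :: "'n::finite \<Rightarrow> real^'n"
  assumes on: "orthonormal_family v"
begin

lemma orthonormal_inner: "v i \<bullet> v j = (if i = j then 1 else 0)"
  using on unfolding orthonormal_family_def by blast

text \<open>Orthonormal rows make \<open>transpose V\<close> a right inverse of \<open>V\<close>;
  for a square matrix it is also a left inverse, which is the completeness relation.\<close>

lemma eig_mat_one: "eig_mat v (\<lambda>i. 1) = mat 1"
proof -
  define V :: "real^'n^'n" where "V = (\<chi> i. v i)"
  have "V ** transpose V = mat 1"
    using orthonormal_inner by (simp add: V_def vec_eq_iff matrix_matrix_mult_def transpose_def
        mat_def inner_vec_def)
  then have "transpose V ** V = mat 1"
    by (simp add: matrix_left_right_inverse)
  moreover have "eig_mat v (\<lambda>i. 1) = transpose V ** V"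
    by (simp add: V_def vec_eq_iff matrix_matrix_mult_def transpose_def eig_mat_def)
  ultimately show ?thesis by simp
qed

lemma orthonormal_expand: "(\<Sum>i\<in>UNIV. (v i \<bullet> x) *\<^sub>R v i) = x"
  using eig_mat_vec[of v "\<lambda>i. 1" x] by (simp add: eig_mat_one)

lemma orthonormal_norm: "x \<bullet> x = (\<Sum>i\<in>UNIV. (v i \<bullet> x)\<^sup>2)"
  using eig_mat_quadratic[of x v "\<lambda>i. 1"] by (simp add: eig_mat_one)

lemma eig_mat_coord: "v i \<bullet> (eig_mat v c *v x) = c i * (v i \<bullet> x)"
  by (simp add: eig_mat_vec inner_sum_right orthonormal_inner if_distrib cong: if_cong)

lemma eig_mat_mult: "eig_mat v c ** eig_mat v d = eig_mat v (\<lambda>i. c i * d i)"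
proof -
  have "eig_mat v c *v (eig_mat v d *v x) = eig_mat v (\<lambda>i. c i * d i) *v x" for x
    by (subst eig_mat_vec) (simp add: eig_mat_coord, simp add: eig_mat_vec mult_ac)
  then show ?thesis
    by (simp add: matrix_eq matrix_vector_mul_assoc)
qed

end

text \<open>The form at \<open>u + t *\<^sub>R y\<close> with \<open>y = N *v u\<close> has no
  constant term and the linear coefficient \<open>2 * (y \<bullet> y)\<close>, so a small negative
  \<open>t\<close> would make it negative unless \<open>y = 0\<close>. The restriction to an
  invariant subspace lets eigenvectors be split off one at a time.\<close>

lemma psd_null_vector:
  assumes sym: "transpose N = (N :: real^'n^'n)" and S: "subspace S" and inv: "\<And>x. x \<in> S \<Longrightarrow> N *v x \<in> S"
    and nn: "\<And>x. x \<in> S \<Longrightarrow> 0 \<le> x \<bullet> (N *v x)" and u: "u \<in> S" and z: "u \<bullet> (N *v u) = 0"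
  shows "N *v u = 0"
proof -
  define y where "y = N *v u"
  have y: "y \<in> S" using inv u by (simp add: y_def)
  have uy: "u \<bullet> (N *v y) = y \<bullet> y"
    using inner_matrix_vector[of u N y] sym by (simp add: y_def)
  have main: "0 \<le> t * (2 * (y \<bullet> y) + t * (y \<bullet> (N *v y)))" for t
  proof -
    have "u + t *\<^sub>R y \<in> S"
      using S u y by (simp add: subspace_add subspace_scale)
    then have "0 \<le> (u + t *\<^sub>R y) \<bullet> (N *v (u + t *\<^sub>R y))"
      by (rule nn)
    also have "\<dots> = t * (2 * (y \<bullet> y) + t * (y \<bullet> (N *v y)))"
      using z uy by (simp add: algebra_simps matrix_vector_mult_scaleR inner_add_right inner_add_left
          y_def[symmetric])
    finally show ?thesis .
  qed
  have "y \<bullet> y \<le> 0"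
  proof (rule ccontr)
    assume "\<not> y \<bullet> y \<le> 0"
    then have pos: "0 < y \<bullet> y" by linarith
    define q where "q = y \<bullet> (N *v y)"
    have q: "0 \<le> q" using nn[OF y] by (simp add: q_def)
    \<comment> \<open>Negative, and with \<open>\<bar>t\<bar> * q < y \<bullet> y\<close>, so that
      the linear term dominates; the summand 1 covers \<open>q = 0\<close>.\<close>
    define t where "t = - (y \<bullet> y) / (1 + q)"
    have t: "t < 0" using pos q by (simp add: t_def field_simps)
    have "2 * (y \<bullet> y) + t * q > 0"
    proof -
      have "2 * (y \<bullet> y) + t * q = (y \<bullet> y) * (2 + q) / (1 + q)"
        using q by (simp add: t_def field_simps)
      then show ?thesis using pos q by simp
    qed
    with t have "t * (2 * (y \<bullet> y) + t * q) < 0"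
      by (rule mult_neg_pos)
    with main[of t] show False by (simp add: q_def)
  qed
  then have "y \<bullet> y = 0" using inner_ge_zero[of y] by (rule antisym)
  then show ?thesis by (simp add: y_def)
qed

text \<open>A maximiser \<open>u\<close> of the quadratic form on the unit sphere of
  \<open>S\<close> works: with \<open>l\<close> the maximum, the form of \<open>l I - M\<close> is
  nonnegative on \<open>S\<close> and zero at \<open>u\<close>, hence \<open>l I - M\<close>
  annihilates \<open>u\<close>.\<close>

lemma symmetric_eigenvector:
  assumes sym: "transpose M = (M :: real^'n^'n)" and S: "subspace S" and ne: "S \<noteq> {0}"
    and inv: "\<And>x. x \<in> S \<Longrightarrow> M *v x \<in> S"
  obtains u l where "u \<in> S" "norm u = 1" "M *v u = l *\<^sub>R u"
proof -
  let ?K = "S \<inter> sphere 0 1"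
  have K1: "compact ?K"
    by (metis S closed_subspace compact_sphere closed_Int_compact)
  have K2: "?K \<noteq> {}"
  proof -
    obtain w where w: "w \<in> S" "w \<noteq> 0" using ne subspace_0[OF S] by blast
    then have "w /\<^sub>R norm w \<in> S" using S by (intro subspace_scale)
    with w have "w /\<^sub>R norm w \<in> ?K" by simp
    then show ?thesis by blast
  qed
  have K3: "continuous_on ?K (\<lambda>x. x \<bullet> (M *v x))"
    by (intro continuous_intros matrix_vector_mult_linear_continuous_on)
  obtain u where u: "u \<in> ?K" and max: "\<And>x. x \<in> ?K \<Longrightarrow> x \<bullet> (M *v x) \<le> u \<bullet> (M *v u)"
    using continuous_attains_sup[OF K1 K2 K3] by blast
  define l where "l = u \<bullet> (M *v u)"
  define N where "N = l *\<^sub>R mat 1 - M"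
  have Nv: "N *v x = l *\<^sub>R x - M *v x" for x
    by (simp add: N_def matrix_vector_mult_diff_rdistrib scaleR_matrix_vector_assoc[symmetric])
  have "N *v u = 0"
  proof (rule psd_null_vector[of N S])
    show "transpose N = N"
      using sym by (simp add: N_def transpose_diff transpose_scalar transpose_mat)
    show "N *v x \<in> S" if "x \<in> S" for x
      using S that inv by (simp add: Nv subspace_diff subspace_scale)
    show "0 \<le> x \<bullet> (N *v x)" if x: "x \<in> S" for x
    proof (cases "x = 0")
      case False
      have "x /\<^sub>R norm x \<in> S" using x S by (intro subspace_scale)
      with False have "x /\<^sub>R norm x \<in> ?K" by simp
      from max[OF this] have "(x \<bullet> (M *v x)) / (norm x)\<^sup>2 \<le> l"
        by (simp add: l_def matrix_vector_mult_scaleR power2_eq_square divide_inverse mult_ac)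
      then have "x \<bullet> (M *v x) \<le> l * (x \<bullet> x)"
        using False by (simp add: field_simps power2_norm_eq_inner)
      then show ?thesis by (simp add: Nv inner_diff_right)
    qed simp
    show "u \<bullet> (N *v u) = 0"
      using u by (simp add: Nv inner_diff_right l_def[symmetric] flip: power2_norm_eq_inner)
  qed (use S u in auto)
  then have "M *v u = l *\<^sub>R u" by (simp add: Nv)
  with u show ?thesis by (intro that[of u l]) auto
qed

text \<open>An orthonormal set of eigenvectors of greatest cardinality is a basis: otherwise its
  orthogonal complement is a nonzero invariant subspace and contributes another eigenvector.\<close>

theorem symmetric_diagonalizable:
  assumes sym: "transpose M = (M :: real^'n^'n)"
  obtains v d where "orthonormal_family v" "M = eig_mat v d"
proof -
  define E where "E B \<longleftrightarrow> finite B \<and> pairwise orthogonal B \<and> (\<forall>b\<in>B. norm b = 1 \<and> (\<exists>l. M *v b = l *\<^sub>R b))"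
    for B :: "(real^'n) set"
  have ind: "independent B" if "E B" for B
    using that unfolding E_def by (intro pairwise_orthogonal_independent) auto
  have le: "card B \<le> CARD('n)" if "E B" for B
    using independent_bound[OF ind[OF that]] by simp
  have "\<exists>B. E B \<and> (\<forall>B'. E B' \<longrightarrow> card B' \<le> card B)"
    by (rule ex_has_greatest_nat[of E "{}" _ "Suc CARD('n)"])
      (auto simp: le_imp_less_Suc le simp flip: E_def, simp add: E_def)
  then obtain B where B: "E B" and mx: "\<And>B'. E B' \<Longrightarrow> card B' \<le> card B" by blast
  have card: "card B = CARD('n)"
  proof (rule ccontr)
    assume "card B \<noteq> CARD('n)"
    with le[OF B] have lt: "card B < CARD('n)" by simp
    define S where "S = {x. \<forall>b\<in>B. orthogonal b x}"
    have S: "subspace S" unfolding S_def by (rule subspace_orthogonal_to_vectors)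
    have "dim (span B) < DIM(real^'n)"
      using lt ind[OF B] by (simp add: dim_eq_card_independent)
    then obtain x where "x \<noteq> 0" "\<And>y. y \<in> span B \<Longrightarrow> orthogonal x y"
      using orthogonal_to_subspace_exists[of B] by (metis dim_span)
    then have "x \<in> S" unfolding S_def by (auto simp: span_base orthogonal_commute)
    with \<open>x \<noteq> 0\<close> have ne: "S \<noteq> {0}" by auto
    have inv: "M *v x \<in> S" if x: "x \<in> S" for x
      unfolding S_def orthogonal_def
    proof safe
      fix b assume b: "b \<in> B"
      then obtain l where l: "M *v b = l *\<^sub>R b" using B by (auto simp: E_def)
      have "b \<bullet> (M *v x) = (M *v b) \<bullet> x" using inner_matrix_vector[of b M x] sym by simp
      then show "b \<bullet> (M *v x) = 0" using x b l by (simp add: S_def orthogonal_def)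
    qed
    obtain u l where u: "u \<in> S" "norm u = 1" "M *v u = l *\<^sub>R u"
      using symmetric_eigenvector[OF sym S ne inv] by metis
    have "u \<notin> B" using u by (auto simp: S_def orthogonal_def)
    moreover have "E (insert u B)"
      using B u unfolding E_def by (auto simp: pairwise_insert S_def orthogonal_commute)
    ultimately show False using mx[of "insert u B"] B by (simp add: E_def)
  qed
  obtain v where v: "bij_betw v (UNIV :: 'n set) B"
    using card B by (metis E_def finite_class.finite_UNIV bij_betw_iff_card)
  have vB: "v i \<in> B" for i using v by (auto simp: bij_betw_def)
  have inj: "v i = v j \<longleftrightarrow> i = j" for i j using v by (auto simp: bij_betw_def inj_on_def)
  have "v i \<bullet> v j = (if i = j then 1 else 0)" for i j
    using B vB[of i] vB[of j] inj[of i j] unfolding E_def pairwise_def orthogonal_def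
    by (metis norm_eq_1)
  then have on: "orthonormal_family v" by (simp add: orthonormal_family_def)
  have "\<forall>i. \<exists>l. M *v v i = l *\<^sub>R v i" using B vB unfolding E_def by blast
  then obtain d where d: "\<And>i. M *v v i = d i *\<^sub>R v i" by metis
  have "M *v x = eig_mat v d *v x" for x
  proof -
    have "M *v x = M *v (\<Sum>i\<in>UNIV. (v i \<bullet> x) *\<^sub>R v i)" by (simp add: orthonormal_expand[OF on])
    also have "\<dots> = (\<Sum>i\<in>UNIV. (v i \<bullet> x) *\<^sub>R (d i *\<^sub>R v i))"
      by (simp add: linear_sum[OF matrix_vector_mul_linear] matrix_vector_mult_scaleR d)
    finally show ?thesis by (simp add: eig_mat_vec mult_ac)
  qed
  then have "M = eig_mat v d" by (simp add: matrix_eq)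
  with on show ?thesis by (rule that)
qed

lemma eig_mat_eigenvalue:
  assumes "orthonormal_family v" shows "eig_mat v d *v v i = d i *\<^sub>R v i"
  by (simp add: eig_mat_vec orthonormal_inner[OF assms] if_distrib[of "\<lambda>c. d _ * c"]
      if_distrib[of "\<lambda>c. c *\<^sub>R _"] cong: if_cong)

lemma psd_diagonalizable:
  assumes "psd (M :: real^'n^'n)"
  obtains v d where "orthonormal_family v" "M = eig_mat v d" "\<And>i. 0 \<le> d i"
proof -
  obtain v d where vd: "orthonormal_family v" "M = eig_mat v d"
    using symmetric_diagonalizable psd_sym[OF assms] by metis
  have "0 \<le> d i" for i
    using psd_nonneg[OF assms, of "v i"] vd(1)
    by (simp add: vd(2) eig_mat_eigenvalue[OF vd(1)] orthonormal_family_def)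
  with vd that show ?thesis by blast
qed

lemma psd_sqrt:
  assumes "psd M" shows "psd (psd_sqrt M)" "psd_sqrt M ** psd_sqrt M = M"
proof -
  obtain v d where vd: "orthonormal_family v" "M = eig_mat v d" "\<And>i. 0 \<le> d i"
    using psd_diagonalizable[OF assms] by metis
  let ?R = "eig_mat v (\<lambda>i. sqrt (d i))"
  have "psd ?R \<and> ?R ** ?R = M"
    using vd by (simp add: psd_eig_mat eig_mat_mult)
  then show "psd (psd_sqrt M)" "psd_sqrt M ** psd_sqrt M = M"
    unfolding psd_sqrt_def by (metis (mono_tags, lifting) someI_ex)+
qed

text \<open>\<open>LEAST\<close> over the reals needs an attained minimum. The smallest
  \<open>d i\<close> is an eigenvalue, and its Rayleigh bound puts it below every other one.\<close>

lemma lambda_min_rayleigh: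
  assumes "transpose M = (M :: real^'n^'n)"
  shows "eigenvalue_of M (lambda_min M)" "lambda_min M * (x \<bullet> x) \<le> x \<bullet> (M *v x)"
proof -
  obtain v d where vd: "orthonormal_family v" "M = eig_mat v d"
    using symmetric_diagonalizable assms by metis
  define m where "m = Min (range d)"
  have m: "m \<le> d i" for i by (simp add: m_def)
  have ray: "m * (x \<bullet> x) \<le> x \<bullet> (M *v x)" for x
    unfolding vd(2) eig_mat_quadratic orthonormal_norm[OF vd(1)] sum_distrib_left
    by (intro sum_mono mult_right_mono m) simp
  have "m \<in> range d" unfolding m_def by (intro Min_in) auto
  then obtain i where "m = d i" by blast
  then have ev: "eigenvalue_of M m"
    unfolding eigenvalue_of_def vd(2) using eig_mat_eigenvalue[OF vd(1), of d i]
      orthonormal_inner[OF vd(1), of i i] \<open>m = d i\<close> by (intro exI[of _ "v i"]) auto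
  have "m \<le> l" if ev_l: "eigenvalue_of M l" for l
  proof -
    obtain y where y: "y \<noteq> 0" "M *v y = l *\<^sub>R y" using ev_l unfolding eigenvalue_of_def by blast
    then show ?thesis using ray[of y] by simp
  qed
  with ev have "lambda_min M = m"
    unfolding lambda_min_def by (intro Least_equality) auto
  with ev ray show "eigenvalue_of M (lambda_min M)" "lambda_min M * (x \<bullet> x) \<le> x \<bullet> (M *v x)"
    by simp_all
qed

lemma lambda_min_pos:
  assumes "posdef M" shows "0 < lambda_min M"
proof -
  have "eigenvalue_of M (lambda_min M)"
    using assms by (intro lambda_min_rayleigh(1)) (simp add: posdef_def)
  then obtain x where x: "x \<noteq> 0" "M *v x = lambda_min M *\<^sub>R x"
    unfolding eigenvalue_of_def by blast
  have "0 < x \<bullet> (M *v x)" using assms x(1) unfolding posdef_def by blast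
  then have "0 < lambda_min M * (x \<bullet> x)" by (simp add: x(2))
  then show ?thesis using inner_ge_zero[of x] by (metis not_less zero_less_mult_iff)
qed


section \<open>The standard Gaussian law\<close>

text \<open>Evaluate \<open>\<integral>\<integral> 1\<^sub>A(x) 1\<^sub>B(x + y)\<close> in both orders.\<close>

lemma translation_invariant_lborel:
  fixes N :: "'a::euclidean_space measure"
  assumes "sigma_finite_measure N" and sets[measurable_cong]: "sets N = sets borel"
    and inv: "\<And>c. distr N borel ((+) c) = N"
    and A[measurable]: "A \<in> sets borel" and B[measurable]: "B \<in> sets borel"
  shows "emeasure N A * emeasure lborel B = emeasure lborel A * emeasure N B"
proof -
  interpret N: sigma_finite_measure N by fact
  interpret P: pair_sigma_finite N "lborel :: 'a measure" ..
  have shift: "(\<integral>\<^sup>+x. f (c + x) \<partial>N) = (\<integral>\<^sup>+x. f x \<partial>N)" if [measurable]: "f \<in> borel_measurable borel" for f c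
    by (subst (2) inv[of c, symmetric]) (simp add: nn_integral_distr)
  have shiftl: "(\<integral>\<^sup>+x. f (c + x) \<partial>lborel) = (\<integral>\<^sup>+x. f x \<partial>lborel)"
    if [measurable]: "f \<in> borel_measurable borel" for f and c :: 'a
    by (subst (2) lborel_distr_plus[of c, symmetric]) (simp add: nn_integral_distr)
  have neg: "(\<integral>\<^sup>+x. f (- x) \<partial>lborel) = (\<integral>\<^sup>+x. f x \<partial>lborel)"
    if [measurable]: "f \<in> borel_measurable borel" for f :: "'a \<Rightarrow> ennreal"
    by (subst (2) lborel_affine[of "-1" 0]) (simp_all add: nn_integral_density nn_integral_distr)
  have "emeasure N A * emeasure lborel B = (\<integral>\<^sup>+x. \<integral>\<^sup>+y. indicator A x * indicator B y \<partial>lborel \<partial>N)"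
    by (simp add: nn_integral_cmult nn_integral_multc)
  \<comment> \<open>Invariance of \<open>lborel\<close> inserts the shift by \<open>x\<close>; after
    Fubini, invariance of \<open>N\<close> moves the shift from \<open>B\<close> to
    \<open>A\<close>.\<close>
  also have "\<dots> = (\<integral>\<^sup>+x. \<integral>\<^sup>+y. indicator A x * indicator B (x + y) \<partial>lborel \<partial>N)"
    by (rule nn_integral_cong) (simp add: nn_integral_cmult shiftl[of "indicator B"])
  also have "\<dots> = (\<integral>\<^sup>+y. \<integral>\<^sup>+x. indicator A x * indicator B (x + y) \<partial>N \<partial>lborel)"
    by (rule P.Fubini'[symmetric]) measurable
  also have "\<dots> = (\<integral>\<^sup>+y. \<integral>\<^sup>+x. indicator A (x - y) * indicator B x \<partial>N \<partial>lborel)"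
    proof (rule nn_integral_cong)
    fix y
    show "(\<integral>\<^sup>+x. indicator A x * indicator B (x + y) \<partial>N) = (\<integral>\<^sup>+x. indicator A (x - y) * indicator B x \<partial>N)"
      using shift[of "\<lambda>x. indicator A x * indicator B (x + y)" "- y"] by simp
  qed
  also have "\<dots> = (\<integral>\<^sup>+x. \<integral>\<^sup>+y. indicator A (x - y) * indicator B x \<partial>lborel \<partial>N)"
    by (rule P.Fubini') measurable
  also have "\<dots> = (\<integral>\<^sup>+x. emeasure lborel A * indicator B x \<partial>N)"
  proof (intro nn_integral_cong)
    fix x
    have "(\<integral>\<^sup>+y. indicator A (x - y) * indicator B x \<partial>lborel)
        = (\<integral>\<^sup>+y. indicator A (x + - y) \<partial>lborel) * indicator B x"
      by (simp add: nn_integral_multc)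
    also have "(\<integral>\<^sup>+y. indicator A (x + - y) \<partial>lborel) = (\<integral>\<^sup>+y. indicator A (x + y) \<partial>lborel)"
      by (rule neg) measurable
    also have "\<dots> = emeasure lborel A"
      by (simp add: shiftl[of "indicator A"])
    finally show "(\<integral>\<^sup>+y. indicator A (x - y) * indicator B x \<partial>lborel) = emeasure lborel A * indicator B x" .
  qed
  also have "\<dots> = emeasure lborel A * emeasure N B"
    by (simp add: nn_integral_cmult)
  finally show ?thesis .
qed

lemma borel_measurable_orthogonal:
  "orthogonal_transformation f \<Longrightarrow> f \<in> borel_measurable borel" for f :: "'a::euclidean_space \<Rightarrow> 'a"
  by (intro borel_measurable_continuous_onI linear_continuous_on linear_conv_bounded_linear[THEN iffD1]
      orthogonal_transformation_linear)

text \<open>The image measure is translation invariant because \<open>f\<close> turns translations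
  into translations, so it is proportional to \<open>lborel\<close>. Balls about the origin are
  their own preimages: they give sigma-finiteness, and the unit ball fixes the factor as 1.\<close>

lemma lborel_distr_orthogonal:
  fixes f :: "'a::euclidean_space \<Rightarrow> 'a"
  assumes f: "orthogonal_transformation f"
  shows "distr lborel borel f = lborel"
proof -
  let ?N = "distr lborel borel f"
  note [measurable] = borel_measurable_orthogonal[OF f]
  have ball: "emeasure ?N (ball 0 r) = emeasure lborel (ball 0 r :: 'a set)" for r
    by (simp add: emeasure_distr vimage_def orthogonal_transformation_norm[OF f] ball_def)
  have sf: "sigma_finite_measure ?N"
  proof
    show "\<exists>A. countable A \<and> A \<subseteq> sets ?N \<and> \<Union> A = space ?N \<and> (\<forall>a\<in>A. emeasure ?N a \<noteq> \<infinity>)"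
    proof (intro exI[of _ "range (\<lambda>n. ball 0 (real n))"] conjI)
      show "\<Union> (range (\<lambda>n. ball 0 (real n))) = space ?N"
        using reals_Archimedean2 by auto
      show "\<forall>a\<in>range (\<lambda>n. ball 0 (real n)). emeasure ?N a \<noteq> \<infinity>"
      proof clarify
        fix n :: nat
        assume "emeasure ?N (ball 0 (real n)) = \<infinity>"
        then show False using emeasure_bounded_finite[of "ball 0 (real n) :: 'a set"] by (simp add: ball)
      qed
    qed auto
  qed
  have inv: "distr ?N borel ((+) c) = ?N" for c
  proof -
    obtain c' where c': "c = f c'" using orthogonal_transformation_surj[OF f] by blast
    have "distr ?N borel ((+) c) = distr lborel borel (f \<circ> (+) c')"
      by (subst distr_distr)
        (auto simp: comp_def c' linear_add[OF orthogonal_transformation_linear[OF f]])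
    also have "\<dots> = distr (distr lborel borel ((+) c')) borel f"
      by (subst distr_distr) auto
    finally show ?thesis by (simp add: lborel_distr_plus)
  qed
  show ?thesis
  proof (rule measure_eqI)
    fix A assume "A \<in> sets ?N"
    then have A: "A \<in> sets borel" by simp
    have "emeasure ?N A * emeasure lborel (ball 0 1 :: 'a set) = emeasure lborel A * emeasure lborel (ball 0 1 :: 'a set)"
      using translation_invariant_lborel[OF sf _ inv A, of "ball 0 1"] by (simp add: ball)
    moreover have "emeasure lborel (ball 0 1 :: 'a set) \<noteq> \<top>"
      using emeasure_bounded_finite[of "ball 0 1 :: 'a set"] by simp
    moreover have "emeasure lborel (ball 0 1 :: 'a set) \<noteq> 0"
    proof
      assume "emeasure lborel (ball 0 1 :: 'a set) = 0"
      then have "ball 0 1 \<in> null_sets (lborel :: 'a measure)" by auto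
      then have "negligible (ball 0 1 :: 'a set)"
        by (simp add: negligible_iff_null_sets null_sets_completionI)
      then show False
        using negligible_imp_measure0 open_not_negligible[of "ball 0 1 :: 'a set"] by simp
    qed
    ultimately show "emeasure ?N A = emeasure lborel A"
      unfolding mult.commute[of _ "emeasure lborel (ball 0 1 :: 'a set)"]
      by (simp add: ennreal_mult_cancel_left)
  qed simp
qed

section \<open>The standard Gaussian law on a Euclidean space: moments and symmetries\<close>

definition std_gauss :: "'a::euclidean_space measure" where
  "std_gauss = density lborel (\<lambda>x. ennreal (\<Prod>b\<in>Basis. std_normal_density (x \<bullet> b)))"

text \<open>Passing to arbitrary Euclidean spaces makes products available: the previous error and
  the noise will be driven by one Gaussian vector on a product space, on which rotations may mix the
  two.\<close>

lemma std_gaussian_eq: "std_gaussian = (std_gauss :: (real^'n) measure)"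
proof -
  have "(\<Prod>b\<in>Basis. std_normal_density (x \<bullet> b)) = (\<Prod>i\<in>UNIV. std_normal_density (x $ i))"
    for x :: "real^'n"
  proof -
    have B: "Basis = range (\<lambda>i::'n. axis i (1::real))" by (auto simp: Basis_vec_def)
    have "inj (\<lambda>i::'n. axis i (1::real))" by (auto simp: inj_on_def axis_eq_axis)
    then show ?thesis unfolding B by (subst prod.reindex) (simp_all add: inner_axis)
  qed
  then show ?thesis by (simp add: std_gaussian_def std_gauss_def)
qed

lemma std_gauss_radial:
  "(\<Prod>b\<in>Basis. std_normal_density (x \<bullet> b))
    = (1 / sqrt (2 * pi)) ^ DIM('a) * exp (- (norm x)\<^sup>2 / 2)" for x :: "'a::euclidean_space"
proof -
  have "(\<Prod>b\<in>Basis. std_normal_density (x \<bullet> b))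
      = (1 / sqrt (2 * pi)) ^ DIM('a) * (\<Prod>b\<in>Basis. exp (- (x \<bullet> b)\<^sup>2 / 2))"
    by (simp add: std_normal_density_def prod.distrib prod_dividef power_divide)
  also have "(\<Prod>b\<in>Basis. exp (- (x \<bullet> b)\<^sup>2 / 2)) = exp (\<Sum>b\<in>Basis. - (x \<bullet> b)\<^sup>2 / 2)"
    by (simp add: exp_sum)
  also have "(\<Sum>b\<in>Basis. - (x \<bullet> b)\<^sup>2 / 2) = - (norm x)\<^sup>2 / 2"
    unfolding power2_norm_eq_inner euclidean_inner[of x x]
    by (simp add: sum_negf sum_divide_distrib power2_eq_square)
  finally show ?thesis .
qed

lemma sets_std_gauss[simp, measurable_cong]: "sets std_gauss = sets borel"
  by (simp add: std_gauss_def)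

lemma space_std_gauss[simp]: "space std_gauss = UNIV"
  by (simp add: std_gauss_def)

lemma nn_integral_std_gauss_prod:
  fixes g :: "'a::euclidean_space \<Rightarrow> real \<Rightarrow> real"
  assumes [measurable]: "\<And>b. b \<in> Basis \<Longrightarrow> g b \<in> borel_measurable borel"
    and nn: "\<And>b x. b \<in> Basis \<Longrightarrow> 0 \<le> g b x"
  shows "(\<integral>\<^sup>+x. ennreal (\<Prod>b\<in>Basis. g b (x \<bullet> b)) \<partial>std_gauss)
    = (\<Prod>b\<in>Basis. \<integral>\<^sup>+x. ennreal (std_normal_density x * g b x) \<partial>lborel)"
proof -
  have "(\<integral>\<^sup>+x. ennreal (\<Prod>b\<in>Basis. g b (x \<bullet> b)) \<partial>std_gauss)
     = (\<integral>\<^sup>+x. (\<Prod>b\<in>Basis. ennreal (std_normal_density (x \<bullet> b) * g b (x \<bullet> b))) \<partial>lborel)"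
    unfolding std_gauss_def
    by (subst nn_integral_density)
      (auto intro!: nn_integral_cong simp: prod_ennreal nn prod.distrib ennreal_mult[symmetric] prod_nonneg)
  also have "\<dots> = (\<Prod>b\<in>Basis. \<integral>\<^sup>+x. ennreal (std_normal_density x * g b x) \<partial>lborel)"
    by (rule nn_integral_lborel_prod) auto
  finally show ?thesis .
qed

lemma nn_integral_std_normal:
  "(\<integral>\<^sup>+x. ennreal (std_normal_density x) \<partial>lborel) = 1"
  "(\<integral>\<^sup>+x. ennreal (std_normal_density x * x\<^sup>2) \<partial>lborel) = 1"
proof -
  have *: "(\<integral>\<^sup>+x. ennreal (f x) \<partial>lborel) = 1" if "has_bochner_integral lborel f 1" "\<And>x. 0 \<le> f x" for f :: "real \<Rightarrow> real"
    using that by (simp add: has_bochner_integral_iff nn_integral_eq_integral)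
  show "(\<integral>\<^sup>+x. ennreal (std_normal_density x) \<partial>lborel) = 1"
    using std_normal_moment_even[of 0] by (intro *) simp_all
  show "(\<integral>\<^sup>+x. ennreal (std_normal_density x * x\<^sup>2) \<partial>lborel) = 1"
    using std_normal_moment_even[of 1] by (intro *) simp_all
qed

lemma prob_space_std_gauss: "prob_space (std_gauss :: 'a::euclidean_space measure)"
proof
  show "emeasure std_gauss (space std_gauss :: 'a set) = 1"
    using nn_integral_std_gauss_prod[of "\<lambda>(_ :: 'a) _. 1"]
    by (simp add: nn_integral_std_normal)
qed

interpretation std_gauss: prob_space std_gauss
  by (rule prob_space_std_gauss)

lemma std_gauss_basis_moment:
  assumes b: "b \<in> Basis"
  shows "(\<integral>\<^sup>+x. ennreal ((x \<bullet> b)\<^sup>2) \<partial>std_gauss) = 1"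
proof -
  have "(\<integral>\<^sup>+x. ennreal ((x \<bullet> b)\<^sup>2) \<partial>std_gauss)
      = (\<integral>\<^sup>+x. ennreal (\<Prod>c\<in>Basis. if c = b then (x \<bullet> c)\<^sup>2 else 1) \<partial>std_gauss)"
    using b by (simp add: prod.delta)
  also have "\<dots> = (\<Prod>c\<in>Basis. \<integral>\<^sup>+x. ennreal (std_normal_density x * (if c = b then x\<^sup>2 else 1)) \<partial>lborel)"
    by (rule nn_integral_std_gauss_prod[of "\<lambda>c x. if c = b then x\<^sup>2 else 1"]) auto
  also have "\<dots> = 1"
  proof (intro prod.neutral ballI)
    fix c :: 'a
    show "(\<integral>\<^sup>+x. ennreal (std_normal_density x * (if c = b then x\<^sup>2 else 1)) \<partial>lborel) = 1"
      by (cases "c = b") (simp_all add: nn_integral_std_normal)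
  qed
  finally show ?thesis .
qed

lemma std_gauss_distr_orthogonal:
  fixes f :: "'a::euclidean_space \<Rightarrow> 'a"
  assumes f: "orthogonal_transformation f"
  shows "distr std_gauss borel f = std_gauss"
proof -
  note [measurable] = borel_measurable_orthogonal[OF f]
  define g :: "'a \<Rightarrow> ennreal" where "g x = ennreal (\<Prod>b\<in>Basis. std_normal_density (x \<bullet> b))" for x
  have [measurable]: "g \<in> borel_measurable borel" by (simp add: g_def[abs_def])
  have gf: "g (f x) = g x" for x
    by (simp add: g_def std_gauss_radial orthogonal_transformation_norm[OF f])
  have "distr (density lborel g) borel f = density (distr lborel borel f) g"
  proof (rule measure_eqI)
    fix A assume "A \<in> sets (distr (density lborel g) borel f)"
    then have [measurable]: "A \<in> sets borel" by simp
    have "emeasure (distr (density lborel g) borel f) A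
        = (\<integral>\<^sup>+x. indicator A x \<partial>distr (density lborel g) borel f)"
      by simp
    also have "\<dots> = (\<integral>\<^sup>+x. indicator A (f x) \<partial>density lborel g)"
      by (rule nn_integral_distr) simp_all
    also have "\<dots> = emeasure (density (distr lborel borel f) g) A"
      by (simp add: emeasure_density nn_integral_density nn_integral_distr gf)
    finally show "emeasure (distr (density lborel g) borel f) A = emeasure (density (distr lborel borel f) g) A" .
  qed simp
  then show ?thesis
    by (simp add: lborel_distr_orthogonal[OF f] std_gauss_def g_def[abs_def])
qed

lemma nn_integral_std_gauss_orthogonal:
  fixes f :: "'a::euclidean_space \<Rightarrow> 'a"
  assumes f: "orthogonal_transformation f" and [measurable]: "g \<in> borel_measurable borel"
  shows "(\<integral>\<^sup>+x. g (f x) \<partial>std_gauss) = (\<integral>\<^sup>+x. g x \<partial>std_gauss)"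
  using borel_measurable_orthogonal[OF f]
  by (subst (2) std_gauss_distr_orthogonal[OF f, symmetric]) (simp add: nn_integral_distr)

text \<open>Reflection in the hyperplane orthogonal to \<open>w = u - b\<close>. Equal norms give
  \<open>2 * (u \<bullet> w) = w \<bullet> w\<close>, which is what sends \<open>u\<close> to
  \<open>u - w\<close>.\<close>

lemma householder:
  fixes u b :: "'a::euclidean_space"
  assumes "norm u = norm b"
  obtains f where "orthogonal_transformation f" "f u = b"
proof (cases "u = b")
  case True
  then show ?thesis using that[of "\<lambda>x. x"] by simp
next
  case False
  define w where "w = u - b"
  define f where "f x = x - (2 * (x \<bullet> w) / (w \<bullet> w)) *\<^sub>R w" for x
  have w: "w \<bullet> w \<noteq> 0" using False by (simp add: w_def)
  have "linear f"
    by (rule linearI) (simp_all add: f_def inner_add_left add_divide_distrib algebra_simps)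
  moreover have "norm (f x) = norm x" for x
  proof -
    have "f x \<bullet> f x = x \<bullet> x"
      using w by (simp add: f_def inner_diff_left inner_diff_right inner_commute[of w x] power2_eq_square field_simps)
    then show ?thesis by (simp add: norm_eq_sqrt_inner)
  qed
  ultimately have "orthogonal_transformation f" by (simp add: orthogonal_transformation)
  moreover have "f u = b"
  proof -
    have "u \<bullet> u = b \<bullet> b" using assms by (simp add: norm_eq)
    then have "2 * (u \<bullet> w) = w \<bullet> w"
      by (simp add: w_def inner_diff_left inner_diff_right inner_commute[of b u])
    then have "f u = u - w" using w by (simp add: f_def)
    then show ?thesis by (simp add: w_def)
  qed
  ultimately show ?thesis by (rule that)
qed

text \<open>A rotation carries \<open>a\<close> to a multiple of a basis vector, where the product
  form of the density leaves a one-dimensional integral.\<close>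

lemma std_gauss_second_moment:
  fixes a :: "'a::euclidean_space"
  shows "(\<integral>\<^sup>+x. ennreal ((x \<bullet> a)\<^sup>2) \<partial>std_gauss) = ennreal ((norm a)\<^sup>2)"
proof -
  obtain b :: 'a where b: "b \<in> Basis" using nonempty_Basis by blast
  obtain f where f: "orthogonal_transformation f" "f a = norm a *\<^sub>R b"
    using householder[of a "norm a *\<^sub>R b"] b by auto
  have "x \<bullet> a = norm a * (f x \<bullet> b)" for x
    using f unfolding orthogonal_transformation_def by (metis inner_scaleR_right)
  then have "(\<integral>\<^sup>+x. ennreal ((x \<bullet> a)\<^sup>2) \<partial>std_gauss) = (\<integral>\<^sup>+x. ennreal ((norm a * (f x \<bullet> b))\<^sup>2) \<partial>std_gauss)"
    by simp
  also have "\<dots> = (\<integral>\<^sup>+x. ennreal ((norm a * (x \<bullet> b))\<^sup>2) \<partial>std_gauss)"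
    by (rule nn_integral_std_gauss_orthogonal[OF f(1), of "\<lambda>y. ennreal ((norm a * (y \<bullet> b))\<^sup>2)"]) simp
  also have "\<dots> = (\<integral>\<^sup>+x. ennreal ((norm a)\<^sup>2) * ennreal ((x \<bullet> b)\<^sup>2) \<partial>std_gauss)"
    by (simp add: power_mult_distrib ennreal_mult)
  also have "\<dots> = ennreal ((norm a)\<^sup>2)"
    using std_gauss_basis_moment[OF b] by (simp add: nn_integral_cmult)
  finally show ?thesis .
qed

lemma std_gauss_pair:
  "std_gauss \<Otimes>\<^sub>M std_gauss = (std_gauss :: ('a::euclidean_space \<times> 'b::euclidean_space) measure)"
proof -
  have "std_gauss \<Otimes>\<^sub>M std_gauss = density (lborel \<Otimes>\<^sub>M lborel)
      (\<lambda>(x::'a, y::'b). ennreal (\<Prod>b\<in>Basis. std_normal_density (x \<bullet> b)) * ennreal (\<Prod>b\<in>Basis. std_normal_density (y \<bullet> b)))"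
    unfolding std_gauss_def
    by (rule pair_measure_density)
      (auto simp: std_gauss_def[symmetric] sigma_finite_lborel std_gauss.sigma_finite_measure_axioms)
  also have "\<dots> = (std_gauss :: ('a \<times> 'b) measure)"
  proof -
    have "(1 / sqrt (2 * pi)) ^ DIM('a) * exp (- (norm x)\<^sup>2 / 2) * ((1 / sqrt (2 * pi)) ^ DIM('b) * exp (- (norm y)\<^sup>2 / 2))
      = (1 / sqrt (2 * pi)) ^ DIM('a \<times> 'b) * exp (- (norm (x, y))\<^sup>2 / 2)" for x :: 'a and y :: 'b
      by (simp add: norm_Pair power_add mult_exp_exp add_divide_distrib)
    then show ?thesis
      unfolding std_gauss_def lborel_prod std_gauss_radial
      by (simp add: split_beta' ennreal_mult[symmetric])
  qed
  finally show ?thesis .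
qed

lemma std_gauss_distr_fst: "distr std_gauss borel (fst :: 'a::euclidean_space \<times> 'b::euclidean_space \<Rightarrow> 'a) = std_gauss"
  using std_gauss.distr_pair_fst[where 'a='b and N="std_gauss :: 'a measure"]
  by (simp add: std_gauss_pair cong: distr_cong)

lemma std_gauss_distr_snd: "distr std_gauss borel (snd :: 'a::euclidean_space \<times> 'b::euclidean_space \<Rightarrow> 'b) = std_gauss"
proof -
  interpret pair_sigma_finite "std_gauss :: 'a measure" "std_gauss :: 'b measure" ..
  have "distr std_gauss borel (snd :: 'a \<times> 'b \<Rightarrow> 'b)
      = distr (distr (std_gauss \<Otimes>\<^sub>M std_gauss) (std_gauss \<Otimes>\<^sub>M std_gauss) (\<lambda>(x, y). (y, x))) borel (snd :: 'a \<times> 'b \<Rightarrow> 'b)"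
    unfolding std_gauss_pair[symmetric]
    by (rule arg_cong[where f="\<lambda>M. distr M borel snd"], rule distr_pair_swap)
  also have "\<dots> = distr (std_gauss \<Otimes>\<^sub>M std_gauss) borel (fst :: 'b \<times> 'a \<Rightarrow> 'b)"
    by (subst distr_distr) (auto simp: comp_def split_beta)
  also have "\<dots> = std_gauss"
    by (simp add: std_gauss_pair std_gauss_distr_fst)
  finally show ?thesis .
qed

text \<open>A coisometry \<open>V\<close> is the second component of an orthogonal transformation of the product space.\<close>

lemma std_gauss_distr_coisometry:
  fixes V :: "'a::euclidean_space \<Rightarrow> 'b::euclidean_space"
  assumes V: "linear V" and Vt: "linear Vt" and adj: "\<And>z y. V z \<bullet> y = z \<bullet> Vt y" and co: "\<And>y. V (Vt y) = y"
  shows "distr std_gauss borel V = std_gauss"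
proof -
  \<comment> \<open>The component of the first entry in the range of \<open>Vt\<close> is replaced
    by \<open>Vt\<close> of the second entry, and its coordinates are stored as the new second
    entry. This exchange preserves norms.\<close>
  define f where "f p = (fst p - Vt (V (fst p)) + Vt (snd p), V (fst p))" for p :: "'a \<times> 'b"
  have [measurable]: "V \<in> borel_measurable borel" "Vt \<in> borel_measurable borel"
    using V Vt by (auto intro!: borel_measurable_continuous_onI linear_continuous_on
        simp: linear_conv_bounded_linear)
  have "linear f"
    by (rule linearI) (simp_all add: f_def linear_add[OF V] linear_add[OF Vt] linear_scale[OF V]
        linear_scale[OF Vt] algebra_simps)
  moreover have "norm (f p) = norm p" for p
  proof -
    obtain x y where p: "p = (x, y)" by (cases p)
    define u w where "u = Vt (V x)" and "w = Vt y"
    have "u \<bullet> u = x \<bullet> u" "u \<bullet> w = x \<bullet> w" "w \<bullet> w = y \<bullet> y" "V x \<bullet> V x = x \<bullet> u"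
      by (simp_all add: u_def w_def co flip: adj)
    moreover have "(x - u + w) \<bullet> (x - u + w) = x \<bullet> x - 2 * (x \<bullet> u) + u \<bullet> u + 2 * (x \<bullet> w) - 2 * (u \<bullet> w) + w \<bullet> w"
      by (simp add: inner_add_left inner_add_right inner_diff_left inner_diff_right inner_commute)
    ultimately have "f p \<bullet> f p = p \<bullet> p"
      by (simp add: f_def p u_def[symmetric] w_def[symmetric])
    then show ?thesis by (simp add: norm_eq_sqrt_inner)
  qed
  ultimately have f: "orthogonal_transformation f" by (simp add: orthogonal_transformation)
  note [measurable] = borel_measurable_orthogonal[OF f]
  have "distr std_gauss borel V = distr (distr std_gauss borel (fst :: 'a \<times> 'b \<Rightarrow> 'a)) borel V"
    by (simp add: std_gauss_distr_fst)
  also have "\<dots> = distr (distr std_gauss borel f) borel snd"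
  proof -
    have "V \<circ> (fst :: 'a \<times> 'b \<Rightarrow> 'a) = snd \<circ> f" by (simp add: f_def fun_eq_iff)
    moreover have [measurable]: "(fst :: 'a \<times> 'b \<Rightarrow> 'a) \<in> borel_measurable borel"
        "(snd :: 'a \<times> 'b \<Rightarrow> 'b) \<in> borel_measurable borel"
      by (auto intro!: borel_measurable_continuous_onI continuous_intros)
    have "distr (distr std_gauss borel (fst :: 'a \<times> 'b \<Rightarrow> 'a)) borel V = distr std_gauss borel (V \<circ> (fst :: 'a \<times> 'b \<Rightarrow> 'a))"
      by (rule distr_distr) measurable
    moreover have "distr (distr std_gauss borel f) borel (snd :: 'a \<times> 'b \<Rightarrow> 'b) = distr std_gauss borel ((snd :: 'a \<times> 'b \<Rightarrow> 'b) \<circ> f)"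
      by (rule distr_distr) measurable
    ultimately show ?thesis by simp
  qed
  also have "\<dots> = std_gauss"
    by (simp add: std_gauss_distr_orthogonal[OF f] std_gauss_distr_snd)
  finally show ?thesis .
qed

text \<open>The hypotheses say that \<open>H\<close> is a symmetry of the Gaussian law which flips the residual \<open>r\<close> and
  fixes the observation \<open>n\<close>; averaging over it replaces the independence of \<open>r\<close> and \<open>n\<close>.\<close>

lemma std_gauss_residual_le:
  fixes r :: "'a::euclidean_space \<Rightarrow> 'b::euclidean_space" and n :: "'a \<Rightarrow> 'c::euclidean_space"
  assumes [measurable]: "r \<in> borel_measurable borel" "n \<in> borel_measurable borel" "\<psi> \<in> borel_measurable borel"
    and H: "orthogonal_transformation H" and rH: "\<And>z. r (H z) = - r z" and nH: "\<And>z. n (H z) = n z"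
  shows "(\<integral>\<^sup>+z. ennreal ((norm (r z))\<^sup>2) \<partial>std_gauss) \<le> (\<integral>\<^sup>+z. ennreal ((norm (r z + \<psi> (n z)))\<^sup>2) \<partial>std_gauss)"
proof -
  let ?I = "\<integral>\<^sup>+z. ennreal ((norm (r z + \<psi> (n z)))\<^sup>2) \<partial>std_gauss"
  have "?I = (\<integral>\<^sup>+z. ennreal ((norm (r (H z) + \<psi> (n (H z))))\<^sup>2) \<partial>std_gauss)"
    by (rule nn_integral_std_gauss_orthogonal[OF H, symmetric]) measurable
  also have "\<dots> = (\<integral>\<^sup>+z. ennreal ((norm (- r z + \<psi> (n z)))\<^sup>2) \<partial>std_gauss)"
    by (simp only: rH nH)
  finally have I: "?I = (\<integral>\<^sup>+z. ennreal ((norm (- r z + \<psi> (n z)))\<^sup>2) \<partial>std_gauss)" .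
  \<comment> \<open>By the parallelogram law the two signs together give twice the squares of
    residual and correction; the latter is dropped. All values lie in
    \<open>[0,\<infinity>]\<close>, so the correction may have infinite second moment.\<close>
  have "2 * (\<integral>\<^sup>+z. ennreal ((norm (r z))\<^sup>2) \<partial>std_gauss) = (\<integral>\<^sup>+z. ennreal (2 * (norm (r z))\<^sup>2) \<partial>std_gauss)"
    by (subst nn_integral_cmult[symmetric]) (simp_all add: ennreal_mult)
  also have "\<dots> \<le> (\<integral>\<^sup>+z. ennreal ((norm (r z + \<psi> (n z)))\<^sup>2) + ennreal ((norm (- r z + \<psi> (n z)))\<^sup>2) \<partial>std_gauss)"
  proof (intro nn_integral_mono)
    fix z
    have "2 * (norm (r z))\<^sup>2 \<le> (norm (r z + \<psi> (n z)))\<^sup>2 + (norm (- r z + \<psi> (n z)))\<^sup>2"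
      by (simp add: power2_norm_eq_inner inner_add_left inner_add_right inner_diff_left inner_diff_right inner_commute)
    then show "ennreal (2 * (norm (r z))\<^sup>2) \<le> ennreal ((norm (r z + \<psi> (n z)))\<^sup>2) + ennreal ((norm (- r z + \<psi> (n z)))\<^sup>2)"
      by (simp add: ennreal_plus[symmetric] del: ennreal_plus)
  qed
  also have "\<dots> = ?I + (\<integral>\<^sup>+z. ennreal ((norm (- r z + \<psi> (n z)))\<^sup>2) \<partial>std_gauss)"
    by (rule nn_integral_add) measurable
  also have "\<dots> = 2 * ?I" by (simp only: I[symmetric] mult_2)
  finally show ?thesis
    by (subst (asm) ennreal_mult_le_mult_iff) auto
qed

lemma std_gauss_sq_moment:
  fixes f :: "'a::euclidean_space \<Rightarrow> 'b::euclidean_space"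
  assumes [measurable]: "f \<in> borel_measurable borel" and adj: "\<And>z y. f z \<bullet> y = z \<bullet> ft y"
  shows "(\<integral>\<^sup>+z. ennreal ((norm (f z))\<^sup>2) \<partial>std_gauss) = ennreal (\<Sum>c\<in>Basis. (norm (ft c))\<^sup>2)"
proof -
  have "(norm (f z))\<^sup>2 = (\<Sum>c\<in>Basis. (z \<bullet> ft c)\<^sup>2)" for z
    unfolding power2_norm_eq_inner by (subst euclidean_inner) (simp add: adj power2_eq_square)
  then have "(\<integral>\<^sup>+z. ennreal ((norm (f z))\<^sup>2) \<partial>std_gauss) = (\<integral>\<^sup>+z. (\<Sum>c\<in>Basis. ennreal ((z \<bullet> ft c)\<^sup>2)) \<partial>std_gauss)"
    by (simp add: sum_ennreal)
  also have "\<dots> = (\<Sum>c\<in>Basis. \<integral>\<^sup>+z. ennreal ((z \<bullet> ft c)\<^sup>2) \<partial>std_gauss)"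
    by (rule nn_integral_sum) simp
  also have "\<dots> = ennreal (\<Sum>c\<in>Basis. (norm (ft c))\<^sup>2)"
    by (simp add: std_gauss_second_moment sum_ennreal)
  finally show ?thesis .
qed

text \<open>The cross term vanishes by the symmetry \<open>z \<mapsto> - z\<close>. Adding the two
  signs turns this into the parallelogram law, which keeps all integrands nonnegative.\<close>

lemma std_gauss_sq_moment_shift:
  fixes f :: "'a::euclidean_space \<Rightarrow> 'b::euclidean_space"
  assumes f: "linear f"
  shows "(\<integral>\<^sup>+z. ennreal ((norm (a + f z))\<^sup>2) \<partial>std_gauss)
    = ennreal ((norm a)\<^sup>2) + (\<integral>\<^sup>+z. ennreal ((norm (f z))\<^sup>2) \<partial>std_gauss)"
proof -
  have [measurable]: "f \<in> borel_measurable borel"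
    using f by (auto intro!: borel_measurable_continuous_onI linear_continuous_on
        simp: linear_conv_bounded_linear)
  let ?I = "\<integral>\<^sup>+z. ennreal ((norm (a + f z))\<^sup>2) \<partial>std_gauss"
  have "orthogonal_transformation (\<lambda>z::'a. - z)"
    by (simp add: orthogonal_transformation_def linear_uminus)
  from nn_integral_std_gauss_orthogonal[OF this, of "\<lambda>z. ennreal ((norm (a + f z))\<^sup>2)"]
  have I: "?I = (\<integral>\<^sup>+z. ennreal ((norm (a - f z))\<^sup>2) \<partial>std_gauss)"
    by (simp add: linear_neg[OF f])
  have "2 * ?I = ?I + (\<integral>\<^sup>+z. ennreal ((norm (a - f z))\<^sup>2) \<partial>std_gauss)"
    by (simp only: I[symmetric] mult_2)
  also have "\<dots> = (\<integral>\<^sup>+z. ennreal ((norm (a + f z))\<^sup>2) + ennreal ((norm (a - f z))\<^sup>2) \<partial>std_gauss)"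
    by (rule nn_integral_add[symmetric]) measurable
  also have "\<dots> = (\<integral>\<^sup>+z. 2 * (ennreal ((norm a)\<^sup>2) + ennreal ((norm (f z))\<^sup>2)) \<partial>std_gauss)"
  proof (intro nn_integral_cong)
    fix z
    have "(norm (a + f z))\<^sup>2 + (norm (a - f z))\<^sup>2 = 2 * ((norm a)\<^sup>2 + (norm (f z))\<^sup>2)"
      by (simp add: power2_norm_eq_inner inner_add_left inner_add_right inner_diff_left inner_diff_right inner_commute)
    then show "ennreal ((norm (a + f z))\<^sup>2) + ennreal ((norm (a - f z))\<^sup>2)
        = 2 * (ennreal ((norm a)\<^sup>2) + ennreal ((norm (f z))\<^sup>2))"
      by (metis ennreal_plus ennreal_mult ennreal_numeral zero_le_numeral zero_le_power2 add_nonneg_nonneg)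
  qed
  also have "\<dots> = 2 * (ennreal ((norm a)\<^sup>2) + (\<integral>\<^sup>+z. ennreal ((norm (f z))\<^sup>2) \<partial>std_gauss))"
    using std_gauss.emeasure_space_1[where 'a='a] by (simp add: nn_integral_cmult nn_integral_add)
  finally show ?thesis
    unfolding ennreal_mult_cancel_left by simp
qed


lemma borel_measurable_matrix_vector [measurable (raw)]:
  fixes A :: "real^'n^'m"
  assumes [measurable]: "f \<in> borel_measurable M" shows "(\<lambda>x. A *v f x) \<in> borel_measurable M"
  by (rule measurable_compose[OF assms])
    (intro borel_measurable_continuous_onI matrix_vector_mult_linear_continuous_on)

section \<open>Gaussian laws in the Wasserstein ball\<close>

lemma gaussian_eq: "gaussian m S = distr std_gauss borel (\<lambda>z. m + psd_sqrt S *v z)"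
  by (simp add: gaussian_def std_gaussian_eq)

lemma sets_gaussian [simp, measurable_cong]: "sets (gaussian m S) = sets borel"
  by (simp add: gaussian_eq)

lemma prob_space_gaussian: "prob_space (gaussian m S)"
  unfolding gaussian_eq by (rule std_gauss.prob_space_distr) measurable

lemma nn_integral_gaussian:
  assumes [measurable]: "g \<in> borel_measurable borel"
  shows "(\<integral>\<^sup>+x. g x \<partial>gaussian m S) = (\<integral>\<^sup>+z. g (m + psd_sqrt S *v z) \<partial>std_gauss)"
  unfolding gaussian_eq by (simp add: nn_integral_distr)

text \<open>The bridge between Gaussian moments, which come as sums over \<open>Basis\<close>, and
  matrix traces; estimates are made summand by summand on the left side.\<close>

lemma trace_congruence: "(\<Sum>c\<in>Basis. (transpose G *v c) \<bullet> (\<Omega> *v (transpose G *v c))) = trace (G ** \<Omega> ** transpose G)"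
  for G :: "real^'n^'m"
proof -
  have B: "Basis = range (\<lambda>i::'m. axis i (1::real))" by (auto simp: Basis_vec_def)
  have "inj (\<lambda>i::'m. axis i (1::real))" by (auto simp: inj_on_def axis_eq_axis)
  then show ?thesis
    unfolding B trace_quadratic
    by (subst sum.reindex) (simp_all add: inner_matrix_vector[of _ G] flip: matrix_vector_mul_assoc)
qed

lemma std_gauss_matrix_moment:
  fixes G :: "real^'k^'m" and \<Omega> :: "real^'k^'k"
  assumes W: "linear W" and adj: "\<And>z y. W z \<bullet> y = z \<bullet> Wt y" and cov: "\<And>y. W (Wt y) = \<Omega> *v y"
  shows "(\<integral>\<^sup>+z. ennreal ((norm (G *v W z))\<^sup>2) \<partial>std_gauss) = ennreal (trace (G ** \<Omega> ** transpose G))"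
proof -
  have [measurable]: "W \<in> borel_measurable borel"
    using W by (auto intro!: borel_measurable_continuous_onI linear_continuous_on
        simp: linear_conv_bounded_linear)
  have "(\<integral>\<^sup>+z. ennreal ((norm (G *v W z))\<^sup>2) \<partial>std_gauss)
      = ennreal (\<Sum>c\<in>Basis. (norm (Wt (transpose G *v c)))\<^sup>2)"
    by (rule std_gauss_sq_moment)
      (simp_all add: adj[symmetric] inner_matrix_vector inner_commute)
  moreover have "(norm (Wt y))\<^sup>2 = y \<bullet> (\<Omega> *v y)" for y
    by (simp add: power2_norm_eq_inner cov[symmetric] inner_commute flip: adj)
  ultimately show ?thesis by (simp flip: trace_congruence)
qed

lemma gaussian_matrix_moment:
  fixes G :: "real^'k^'m"
  assumes S: "psd S"
  shows "(\<integral>\<^sup>+x. ennreal ((norm (G *v (x - m)))\<^sup>2) \<partial>gaussian m S) = ennreal (trace (G ** S ** transpose G))"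
proof -
  have "(\<integral>\<^sup>+x. ennreal ((norm (G *v (x - m)))\<^sup>2) \<partial>gaussian m S)
      = (\<integral>\<^sup>+z. ennreal ((norm (G *v (psd_sqrt S *v z)))\<^sup>2) \<partial>std_gauss)"
    by (subst nn_integral_gaussian) simp_all
  also have "\<dots> = ennreal (trace (G ** S ** transpose G))"
    by (rule std_gauss_matrix_moment[where Wt="\<lambda>y. psd_sqrt S *v y"])
      (simp_all add: inner_matrix_vector[of _ "psd_sqrt S"] matrix_vector_mul_assoc psd_sqrt[OF S]
        psd_sym[OF psd_sqrt(1)[OF S]] inner_matrix_vector)
  finally show ?thesis .
qed

lemma gaussian_shift_moment:
  fixes G :: "real^'k^'m"
  assumes S: "psd S"
  shows "(\<integral>\<^sup>+x. ennreal ((norm (a + G *v x))\<^sup>2) \<partial>gaussian 0 S)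
    = ennreal ((norm a)\<^sup>2) + ennreal (trace (G ** S ** transpose G))"
proof -
  have "(\<integral>\<^sup>+x. ennreal ((norm (a + G *v x))\<^sup>2) \<partial>gaussian 0 S)
      = (\<integral>\<^sup>+z. ennreal ((norm (a + (G ** psd_sqrt S) *v z))\<^sup>2) \<partial>std_gauss)"
    by (subst nn_integral_gaussian) (simp_all add: matrix_vector_mul_assoc)
  also have "\<dots> = ennreal ((norm a)\<^sup>2) + (\<integral>\<^sup>+z. ennreal ((norm ((G ** psd_sqrt S) *v z))\<^sup>2) \<partial>std_gauss)"
    by (rule std_gauss_sq_moment_shift) simp
  also have "(\<integral>\<^sup>+z. ennreal ((norm ((G ** psd_sqrt S) *v z))\<^sup>2) \<partial>std_gauss)
      = (\<integral>\<^sup>+x. ennreal ((norm (G *v (x - 0)))\<^sup>2) \<partial>gaussian 0 S)"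
    by (subst nn_integral_gaussian) (simp_all add: matrix_vector_mul_assoc)
  also have "\<dots> = ennreal (trace (G ** S ** transpose G))"
    by (rule gaussian_matrix_moment[OF S])
  finally show ?thesis .
qed

lemma gaussian_in_P2:
  assumes S: "psd S" shows "gaussian m S \<in> P2"
proof -
  have "(\<integral>\<^sup>+x. ennreal ((norm x)\<^sup>2) \<partial>gaussian m S)
      = (\<integral>\<^sup>+z. ennreal ((norm (m + psd_sqrt S *v z))\<^sup>2) \<partial>std_gauss)"
    by (rule nn_integral_gaussian) simp
  also have "\<dots> = (\<integral>\<^sup>+z. ennreal ((norm (m + mat 1 *v (0 + psd_sqrt S *v z)))\<^sup>2) \<partial>std_gauss)"
    by simp
  also have "\<dots> = (\<integral>\<^sup>+x. ennreal ((norm (m + mat 1 *v x))\<^sup>2) \<partial>gaussian 0 S)"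
    by (rule nn_integral_gaussian[symmetric]) measurable
  also have "\<dots> < \<infinity>"
    by (subst gaussian_shift_moment[OF S]) (simp add: ennreal_plus[symmetric] del: ennreal_plus)
  finally show ?thesis
    by (simp add: P2_def prob_space_gaussian)
qed

text \<open>\<open>gaussian\<close> is built from the symmetric square root, while couplings supply
  other factors \<open>L\<close>. By polar decomposition \<open>L\<close> is
  \<open>psd_sqrt S\<close> times a coisometry, and a coisometry carries the standard law to the
  standard law.\<close>

lemma gaussian_linear_image:
  fixes L :: "real^'k^'n"
  assumes S: "posdef S" and L: "L ** transpose L = S"
  shows "distr std_gauss borel (\<lambda>z. m + L *v z) = gaussian m S"
proof -
  let ?R = "psd_sqrt S"
  note R = psd_sqrt[OF posdef_psd[OF S]]
  have "invertible ?R"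
  proof -
    obtain B where "S ** B = mat 1"
      using posdef_invertible[OF S] by (auto simp: invertible_def)
    then have "?R ** (?R ** B) = mat 1" by (simp add: matrix_mul_assoc R)
    then show ?thesis by (metis invertible_right_inverse)
  qed
  define Q where "Q = matrix_inv ?R"
  have Q: "?R ** Q = mat 1" "Q ** ?R = mat 1"
    using matrix_inv_inverse[OF \<open>invertible ?R\<close>] by (simp_all add: Q_def)
  have Qt: "?R ** transpose Q = mat 1"
    using arg_cong[OF Q(2), of transpose] by (simp add: matrix_transpose_mul psd_sym[OF R(1)] transpose_mat)
  define V where "V = Q ** L"
  have VV: "V ** transpose V = mat 1"
  proof -
    have "V ** transpose V = Q ** (L ** transpose L) ** transpose Q"
      by (simp add: V_def matrix_transpose_mul matrix_mul_assoc)
    also have "\<dots> = Q ** (?R ** ?R) ** transpose Q"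
      by (simp only: L R(2))
    also have "\<dots> = (Q ** ?R) ** (?R ** transpose Q)"
      by (simp only: matrix_mul_assoc)
    finally show ?thesis by (simp add: Q Qt)
  qed
  have "distr std_gauss borel ((*v) V) = std_gauss"
    by (rule std_gauss_distr_coisometry[where Vt="(*v) (transpose V)"])
      (simp_all add: inner_matrix_vector[of _ "transpose V"] matrix_vector_mul_assoc VV
        del: transpose_matrix_vector)
  then have "gaussian m S = distr (distr std_gauss borel ((*v) V)) borel (\<lambda>z. m + ?R *v z)"
    by (simp add: gaussian_eq)
  also have "\<dots> = distr std_gauss borel ((\<lambda>z. m + ?R *v z) \<circ> (*v) V)"
    by (rule distr_distr) measurable
  also have "(\<lambda>z. m + ?R *v z) \<circ> (*v) V = (\<lambda>z. m + L *v z)"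
    by (simp add: comp_def matrix_vector_mul_assoc V_def matrix_mul_assoc Q)
  finally show ?thesis by simp
qed

section \<open>Couplings and the Wasserstein distance\<close>

lemma W2_ball_coupling:
  fixes P Q :: "'a::euclidean_space measure"
  assumes P: "P \<in> W2_ball Q \<theta>" and Q: "Q \<in> P2" and \<delta>: "0 < \<delta>" and \<theta>: "0 \<le> \<theta>"
  obtains M where "M \<in> couplings P Q" "(\<integral>\<^sup>+ z. ennreal ((dist (fst z) (snd z))\<^sup>2) \<partial>M) < ennreal (\<theta>\<^sup>2 + \<delta>)"
proof -
  let ?c = "\<lambda>M. \<integral>\<^sup>+ z. ennreal ((dist (fst z :: 'a) (snd z))\<^sup>2) \<partial>M"
  let ?I = "INF M\<in>couplings P Q. ?c M"
  have P2: "P \<in> P2" and W: "W2 P Q \<le> \<theta>" using P by (auto simp: W2_ball_def)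
  interpret P: prob_space P using P2 by (simp add: P2_def)
  interpret Q: prob_space Q using Q by (simp add: P2_def)
  have s[measurable_cong]: "sets P = sets borel" "sets Q = sets borel" using P2 Q by (auto simp: P2_def)
  interpret PQ: pair_prob_space P Q ..
  have sp: "sets (P \<Otimes>\<^sub>M Q) = sets (borel \<Otimes>\<^sub>M borel)" by (intro sets_pair_measure_cong s)
  have spc: "space P = UNIV" "space Q = UNIV" using s[THEN sets_eq_imp_space_eq] by simp_all
  have coup: "P \<Otimes>\<^sub>M Q \<in> couplings P Q"
  proof -
    have "distr (P \<Otimes>\<^sub>M Q) borel fst = P"
      using Q.distr_pair_fst[of P] distr_cong[of "P \<Otimes>\<^sub>M Q" "P \<Otimes>\<^sub>M Q" borel P fst fst]
      by (simp add: s)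
    moreover have "distr (P \<Otimes>\<^sub>M Q) borel snd = Q"
    proof (rule measure_eqI)
      fix A assume "A \<in> sets (distr (P \<Otimes>\<^sub>M Q) borel snd)"
      then have A: "A \<in> sets borel" by simp
      have "emeasure (distr (P \<Otimes>\<^sub>M Q) borel snd) A = emeasure (P \<Otimes>\<^sub>M Q) (UNIV \<times> A)"
        using A by (subst emeasure_distr) (auto simp: space_pair_measure spc intro!: arg_cong[where f="emeasure _"])
      also have "\<dots> = emeasure Q A"
        using A P.emeasure_space_1 by (subst Q.emeasure_pair_measure_Times) (simp_all add: spc)
      finally show "emeasure (distr (P \<Otimes>\<^sub>M Q) borel snd) A = emeasure Q A" .
    qed (simp add: s)
    ultimately show ?thesis
      using sp PQ.prob_space_axioms by (simp add: couplings_def)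
  qed
  \<comment> \<open>Finiteness of the infimum has to be shown: \<open>enn2real\<close> sends
    \<open>\<infinity>\<close> to 0, and the bound on \<open>W2\<close> would then say nothing. The
    product coupling has finite cost because both second moments are finite.\<close>
  have "?c (P \<Otimes>\<^sub>M Q) \<le> (\<integral>\<^sup>+ z. 2 * ennreal ((norm (fst z))\<^sup>2) + 2 * ennreal ((norm (snd z))\<^sup>2) \<partial>(P \<Otimes>\<^sub>M Q))"
  proof (rule nn_integral_mono)
    fix z :: "'a \<times> 'a"
    have "2 * (norm (fst z))\<^sup>2 + 2 * (norm (snd z))\<^sup>2 - (norm (fst z - snd z))\<^sup>2 = (norm (fst z + snd z))\<^sup>2"
      by (simp add: power2_norm_eq_inner inner_add_left inner_add_right inner_diff_left inner_diff_right inner_commute)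
    then have "(dist (fst z) (snd z))\<^sup>2 \<le> 2 * (norm (fst z))\<^sup>2 + 2 * (norm (snd z))\<^sup>2"
      unfolding dist_norm using zero_le_power2[of "norm (fst z + snd z)"] by linarith
    then have "ennreal ((dist (fst z) (snd z))\<^sup>2) \<le> ennreal (2 * (norm (fst z))\<^sup>2 + 2 * (norm (snd z))\<^sup>2)"
      by (rule ennreal_leI)
    then show "ennreal ((dist (fst z) (snd z))\<^sup>2) \<le> 2 * ennreal ((norm (fst z))\<^sup>2) + 2 * ennreal ((norm (snd z))\<^sup>2)"
      by (simp add: ennreal_mult)
  qed
  also have "\<dots> = 2 * (\<integral>\<^sup>+ z. ennreal ((norm (fst z))\<^sup>2) \<partial>(P \<Otimes>\<^sub>M Q)) + 2 * (\<integral>\<^sup>+ z. ennreal ((norm (snd z))\<^sup>2) \<partial>(P \<Otimes>\<^sub>M Q))"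
    by (simp add: nn_integral_add nn_integral_cmult)
  also have "(\<integral>\<^sup>+ z. ennreal ((norm (fst z))\<^sup>2) \<partial>(P \<Otimes>\<^sub>M Q)) = (\<integral>\<^sup>+ x. ennreal ((norm x)\<^sup>2) \<partial>distr (P \<Otimes>\<^sub>M Q) borel fst)"
    by (rule nn_integral_distr[symmetric]) measurable
  also have "\<dots> = (\<integral>\<^sup>+ x. ennreal ((norm x)\<^sup>2) \<partial>P)" using coup by (simp add: couplings_def)
  also have "(\<integral>\<^sup>+ z. ennreal ((norm (snd z))\<^sup>2) \<partial>(P \<Otimes>\<^sub>M Q)) = (\<integral>\<^sup>+ x. ennreal ((norm x)\<^sup>2) \<partial>distr (P \<Otimes>\<^sub>M Q) borel snd)"
    by (rule nn_integral_distr[symmetric]) measurable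
  also have "\<dots> = (\<integral>\<^sup>+ x. ennreal ((norm x)\<^sup>2) \<partial>Q)" using coup by (simp add: couplings_def)
  also have "2 * (\<integral>\<^sup>+ x. ennreal ((norm x)\<^sup>2) \<partial>P) + 2 * (\<integral>\<^sup>+ x. ennreal ((norm x)\<^sup>2) \<partial>Q) < \<infinity>"
    using P2 Q by (simp add: P2_def ennreal_mult_less_top)
  finally have "?c (P \<Otimes>\<^sub>M Q) < \<infinity>" .
  with coup have fin: "?I < \<infinity>" by (metis (no_types, lifting) INF_lower le_less_trans)
  have "enn2real ?I \<le> \<theta>\<^sup>2"
    using W real_sqrt_le_iff[of "enn2real ?I" "\<theta>\<^sup>2"] \<theta> by (simp add: W2_def)
  then have "ennreal (enn2real ?I) < ennreal (\<theta>\<^sup>2 + \<delta>)"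
    using \<delta> by (intro ennreal_lessI) (auto intro: add_nonneg_pos)
  with fin have "?I < ennreal (\<theta>\<^sup>2 + \<delta>)" by (simp add: less_top[symmetric])
  then show ?thesis using that by (auto simp: INF_less_iff)
qed

lemma W2_le_coupling:
  assumes M: "M \<in> couplings P Q" and c: "(\<integral>\<^sup>+ z. ennreal ((dist (fst z) (snd z))\<^sup>2) \<partial>M) \<le> ennreal (\<theta>\<^sup>2)" and \<theta>: "0 \<le> \<theta>"
  shows "W2 P Q \<le> \<theta>"
proof -
  have "(INF M\<in>couplings P Q. \<integral>\<^sup>+ z. ennreal ((dist (fst z) (snd z))\<^sup>2) \<partial>M) \<le> ennreal (\<theta>\<^sup>2)"
    using M c by (rule INF_lower2)
  from enn2real_mono[OF this] show ?thesis
    using \<theta> by (simp add: W2_def real_le_lsqrt)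
qed

text \<open>The block matrix is a joint covariance. The two row blocks of its square root, applied
  to the same standard vector, couple the two laws at cost
  \<open>trace (S + Sh - 2 *\<^sub>R Z)\<close>.\<close>

lemma gaussian_in_W2_ball:
  fixes S Sh Z :: "real^'n^'n"
  assumes Sh: "posdef Sh" and S: "posdef S" and blk: "psd (block Sh Z (transpose Z) S)"
    and tr: "trace (S + Sh - 2 *\<^sub>R Z) \<le> \<theta>\<^sup>2" and \<theta>: "0 \<le> \<theta>"
  shows "gaussian m S \<in> W2_ball (gaussian m Sh) \<theta>"
proof -
  define B where "B = psd_sqrt (block Sh Z (transpose Z) S)"
  have BB: "B ** transpose B = block Sh Z (transpose Z) S"
    using psd_sqrt[OF blk] by (simp add: B_def psd_sym)
  define L1 L2 :: "real^('n + 'n)^'n" where "L1 = (\<chi> i. B $ Inr i)" and "L2 = (\<chi> i. B $ Inl i)"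
  have ent: "(\<Sum>k\<in>UNIV. B $ a $ k * B $ b $ k) = block Sh Z (transpose Z) S $ a $ b" for a b
    using arg_cong[OF BB, of "\<lambda>M. M $ a $ b"] by (simp add: matrix_matrix_mult_def transpose_def)
  have L1: "L1 ** transpose L1 = S" and L2: "L2 ** transpose L2 = Sh"
    and L12: "L1 ** transpose L2 = transpose Z" and L21: "L2 ** transpose L1 = Z"
    by (simp_all add: L1_def L2_def vec_eq_iff matrix_matrix_mult_def transpose_def ent)
      (simp_all add: block_def transpose_def)
  let ?M = "distr std_gauss (borel \<Otimes>\<^sub>M borel) (\<lambda>z. (m + L1 *v z, m + L2 *v z))"
  have "distr ?M borel fst = gaussian m S"
    by (subst distr_distr) (simp_all add: comp_def gaussian_linear_image[OF S L1])
  moreover have "distr ?M borel snd = gaussian m Sh"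
    by (subst distr_distr) (simp_all add: comp_def gaussian_linear_image[OF Sh L2])
  moreover have "prob_space ?M" by (rule std_gauss.prob_space_distr) measurable
  ultimately have coup: "?M \<in> couplings (gaussian m S) (gaussian m Sh)"
    by (simp add: couplings_def)
  have "(\<integral>\<^sup>+ z. ennreal ((dist (fst z) (snd z))\<^sup>2) \<partial>?M) = (\<integral>\<^sup>+ z. ennreal ((norm ((L1 - L2) *v z))\<^sup>2) \<partial>std_gauss)"
    by (subst nn_integral_distr) (simp_all add: dist_norm matrix_vector_mult_diff_rdistrib)
  also have "\<dots> = ennreal (trace ((L1 - L2) ** mat 1 ** transpose (L1 - L2)))"
    by (rule std_gauss_matrix_moment[where W="\<lambda>z. z" and Wt="\<lambda>z. z"]) (simp_all add: linear_id[unfolded id_def])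
  also have "(L1 - L2) ** mat 1 ** transpose (L1 - L2) = S + Sh - Z - transpose Z"
    by (simp add: transpose_diff matrix_diff_ldistrib matrix_diff_rdistrib L1 L2 L12 L21)
  also have "ennreal (trace (S + Sh - Z - transpose Z)) \<le> ennreal (\<theta>\<^sup>2)"
    using tr by (intro ennreal_leI) (simp add: trace_sub trace_add trace_transpose trace_scaleR)
  finally have "W2 (gaussian m S) (gaussian m Sh) \<le> \<theta>"
    using coup \<theta> by (intro W2_le_coupling)
  then show ?thesis
    using gaussian_in_P2[OF posdef_psd[OF S]] by (simp add: W2_ball_def)
qed


section \<open>The worst case of a quadratic form\<close>

lemma sum_UNIV_sum: "sum f (UNIV :: ('a::finite + 'b::finite) set) = (\<Sum>i\<in>UNIV. f (Inl i)) + (\<Sum>i\<in>UNIV. f (Inr i))"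
  unfolding UNIV_sum by (subst sum.union_disjoint) (auto simp: sum.reindex)

lemma upper_stack [simp]: "upper (stack a b) = a" and lower_stack [simp]: "lower (stack a b) = b"
  by (simp_all add: upper_def lower_def stack_def vec_eq_iff)

lemma stack_upper_lower [simp]: "stack (upper z) (lower z) = z"
  by (simp add: upper_def lower_def stack_def vec_eq_iff split: sum.split)

lemma vec_sum_eq_iff: "z = w \<longleftrightarrow> upper z = upper w \<and> lower z = lower w"
  by (metis stack_upper_lower)

lemma upper_add: "upper (z + w) = upper z + upper w" and lower_add: "lower (z + w) = lower z + lower w"
  and upper_diff: "upper (z - w) = upper z - upper w" and lower_diff: "lower (z - w) = lower z - lower w"
  and upper_zero [simp]: "upper 0 = 0" and lower_zero [simp]: "lower 0 = 0"
  by (simp_all add: upper_def lower_def vec_eq_iff)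

lemma inner_upper_lower: "z \<bullet> w = upper z \<bullet> upper w + lower z \<bullet> lower w"
  by (simp add: inner_vec_def upper_def lower_def sum_UNIV_sum)

lemma upper_block_vec: "upper (block A B C D *v z) = A *v upper z + B *v lower z"
  and lower_block_vec: "lower (block A B C D *v z) = C *v upper z + D *v lower z"
  by (simp_all add: block_def upper_def lower_def matrix_vector_mult_def sum_UNIV_sum vec_eq_iff)

lemma transpose_block: "transpose (block A B C D) = block (transpose A) (transpose C) (transpose B) (transpose D)"
  by (simp add: block_def transpose_def vec_eq_iff split: sum.split)

lemma block_eq_iff: "block A B C D = block A' B' C' D' \<longleftrightarrow> A = A' \<and> B = B' \<and> C = C' \<and> D = D'"
proof
  assume eq: "block A B C D = block A' B' C' D'"
  have "block A B C D $ i $ j = block A' B' C' D' $ i $ j" for i j by (simp add: eq)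
  from this[of "Inl _" "Inl _"] this[of "Inl _" "Inr _"] this[of "Inr _" "Inl _"] this[of "Inr _" "Inr _"]
  show "A = A' \<and> B = B' \<and> C = C' \<and> D = D'" by (simp add: block_def vec_eq_iff)
qed simp

lemma block_add: "block A B C D + block A' B' C' D' = block (A + A') (B + B') (C + C') (D + D')"
  by (simp add: block_def vec_eq_iff split: sum.split)

lemma block_scaleR: "c *\<^sub>R block A B C D = block (c *\<^sub>R A) (c *\<^sub>R B) (c *\<^sub>R C) (c *\<^sub>R D)"
  by (simp add: block_def vec_eq_iff split: sum.split)

lemma block_quadratic:
  "stack a b \<bullet> (block A B (transpose B) D *v stack a b) = a \<bullet> (A *v a) + 2 * (a \<bullet> (B *v b)) + b \<bullet> (D *v b)"
  using inner_matrix_vector[of b "transpose B" a]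
  by (simp add: inner_upper_lower upper_block_vec lower_block_vec inner_add_right inner_commute
      transpose_transpose del: transpose_matrix_vector)

text \<open>Both block inequalities of the program are exploited in this scalar form, by choosing
  \<open>a\<close> and \<open>b\<close>.\<close>

lemma psd_block_iff:
  "psd (block A B (transpose B) D) \<longleftrightarrow> transpose A = A \<and> transpose D = D \<and>
    (\<forall>a b. 0 \<le> a \<bullet> (A *v a) + 2 * (a \<bullet> (B *v b)) + b \<bullet> (D *v b))"
  unfolding psd_def transpose_block block_eq_iff
  by (metis block_quadratic stack_upper_lower transpose_transpose)

text \<open>The constraints on the noise covariance with \<open>Z\<close> eliminated. The least
  trace over all admissible \<open>Z\<close> is the squared Bures-Wasserstein distance of
  \<open>S\<close> and \<open>Sh\<close>, so this is a ball for that distance, cut by the eigenvalue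
  bound.\<close>

definition ambiguity_cov :: "real^'n^'n \<Rightarrow> real \<Rightarrow> (real^'n^'n) set" where
  "ambiguity_cov Sh \<theta> = {S. \<exists>Z. psd (block Sh Z (transpose Z) S) \<and> trace (S + Sh - 2 *\<^sub>R Z) \<le> \<theta>\<^sup>2
      \<and> loewner_ge S (lambda_min Sh *\<^sub>R mat 1)}"

lemma loewner_ge_scaled_id: "loewner_ge S (c *\<^sub>R mat 1) \<longleftrightarrow> transpose S = S \<and> (\<forall>x. c * (x \<bullet> x) \<le> x \<bullet> (S *v x))"
  by (auto simp: loewner_ge_def psd_def transpose_diff transpose_scalar transpose_mat
      matrix_vector_mult_diff_rdistrib inner_diff_right scaleR_matrix_vector_assoc[symmetric])

lemma ambiguity_cov_lower:
  assumes "S \<in> ambiguity_cov Sh \<theta>" shows "transpose S = S" "lambda_min Sh * (x \<bullet> x) \<le> x \<bullet> (S *v x)"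
  using assms by (auto simp: ambiguity_cov_def loewner_ge_scaled_id)

lemma ambiguity_cov_posdef:
  assumes "posdef Sh" "S \<in> ambiguity_cov Sh \<theta>" shows "posdef S"
proof -
  have "0 < x \<bullet> (S *v x)" if "x \<noteq> 0" for x
    using ambiguity_cov_lower(2)[OF assms(2), of x] lambda_min_pos[OF assms(1)] that
    by (meson inner_gt_zero_iff less_le_trans mult_pos_pos)
  then show ?thesis using ambiguity_cov_lower(1)[OF assms(2)] by (simp add: posdef_def)
qed

text \<open>The constraints are convex in the pair \<open>(S, Z)\<close>, so the witnesses
  \<open>Z\<close> are combined with the same weights as the covariances.\<close>

lemma ambiguity_cov_convex:
  fixes S :: "real^'n^'n"
  assumes S: "S \<in> ambiguity_cov Sh \<theta>" and S': "S' \<in> ambiguity_cov Sh \<theta>" and s: "0 \<le> s" "s \<le> 1"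
  shows "(1 - s) *\<^sub>R S + s *\<^sub>R S' \<in> ambiguity_cov Sh \<theta>"
proof -
  obtain Z Z' where Z: "psd (block Sh Z (transpose Z) S)" "trace (S + Sh - 2 *\<^sub>R Z) \<le> \<theta>\<^sup>2"
    and Z': "psd (block Sh Z' (transpose Z') S')" "trace (S' + Sh - 2 *\<^sub>R Z') \<le> \<theta>\<^sup>2"
    using S S' by (auto simp: ambiguity_cov_def)
  let ?S = "(1 - s) *\<^sub>R S + s *\<^sub>R S'" and ?Z = "(1 - s) *\<^sub>R Z + s *\<^sub>R Z'"
  have "psd ((1 - s) *\<^sub>R block Sh Z (transpose Z) S + s *\<^sub>R block Sh Z' (transpose Z') S')"
    using Z Z' s by (intro psd_add psd_scaleR) auto
  moreover have "(1 - s) *\<^sub>R block Sh Z (transpose Z) S + s *\<^sub>R block Sh Z' (transpose Z') S'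
      = block Sh ?Z (transpose ?Z) ?S"
    by (simp add: block_add block_scaleR transpose_add transpose_scalar flip: scaleR_left_distrib)
  moreover have "trace (?S + Sh - 2 *\<^sub>R ?Z) = (1 - s) * trace (S + Sh - 2 *\<^sub>R Z) + s * trace (S' + Sh - 2 *\<^sub>R Z')"
    by (simp add: trace_add trace_sub trace_scaleR algebra_simps)
  moreover have "\<dots> \<le> (1 - s) * \<theta>\<^sup>2 + s * \<theta>\<^sup>2"
    using Z Z' s by (intro add_mono mult_left_mono) auto
  moreover have "\<dots> = \<theta>\<^sup>2" by (simp add: algebra_simps)
  moreover have "loewner_ge ?S (lambda_min Sh *\<^sub>R mat 1)"
    unfolding loewner_ge_scaled_id
  proof (intro conjI allI)
    show "transpose ?S = ?S"
      using ambiguity_cov_lower(1)[OF S] ambiguity_cov_lower(1)[OF S'] by (simp add: transpose_add transpose_scalar)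
    fix x :: "real^'n"
    have "lambda_min Sh * (x \<bullet> x) = (1 - s) * (lambda_min Sh * (x \<bullet> x)) + s * (lambda_min Sh * (x \<bullet> x))"
      by (simp add: algebra_simps)
    also have "\<dots> \<le> (1 - s) * (x \<bullet> (S *v x)) + s * (x \<bullet> (S' *v x))"
      using ambiguity_cov_lower(2)[OF S, of x] ambiguity_cov_lower(2)[OF S', of x] s
      by (intro add_mono mult_left_mono) auto
    finally show "lambda_min Sh * (x \<bullet> x) \<le> x \<bullet> (?S *v x)"
      by (simp add: matrix_vector_mult_add_rdistrib inner_add_right scaleR_matrix_vector_assoc[symmetric])
  qed
  ultimately show ?thesis unfolding ambiguity_cov_def by (intro CollectI exI[of _ ?Z]) simp
qed

text \<open>Moving a nominal vector \<open>y\<close> to \<open>M y\<close> has cross covariance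
  \<open>Sh ** M\<close> and costs the sum in the hypothesis. Factors at least 1 do not shorten
  vectors, so the form stays above the smallest eigenvalue of \<open>Sh\<close>.\<close>

lemma ambiguity_cov_stretch:
  fixes Sh :: "real^'n^'n"
  assumes Sh: "posdef Sh" and on: "orthonormal_family v" and a: "\<And>i. 1 \<le> a i"
    and tr: "(\<Sum>i\<in>UNIV. (a i - 1)\<^sup>2 * (v i \<bullet> (Sh *v v i))) \<le> \<theta>\<^sup>2"
  shows "eig_mat v a ** Sh ** eig_mat v a \<in> ambiguity_cov Sh \<theta>"
proof -
  define M where "M = eig_mat v a"
  have Mt: "transpose M = M" by (simp add: M_def transpose_eig_mat)
  have Sht: "transpose Sh = Sh" using Sh by (simp add: posdef_def)
  have q: "x \<bullet> (M ** Sh ** M *v x) = (M *v x) \<bullet> (Sh *v (M *v x))" for x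
    using inner_matrix_vector[of x M] by (simp add: Mt flip: matrix_vector_mul_assoc)
  have "psd (block Sh (Sh ** M) (transpose (Sh ** M)) (M ** Sh ** M))"
    unfolding psd_block_iff
  proof (intro conjI allI)
    show "transpose (M ** Sh ** M) = M ** Sh ** M"
      by (simp add: matrix_transpose_mul Mt Sht matrix_mul_assoc)
    fix x y
    have "0 \<le> (x + M *v y) \<bullet> (Sh *v (x + M *v y))"
      by (rule psd_nonneg[OF posdef_psd[OF Sh]])
    also have "\<dots> = x \<bullet> (Sh *v x) + 2 * (x \<bullet> (Sh ** M *v y)) + y \<bullet> (M ** Sh ** M *v y)"
      unfolding q matrix_vector_mul_assoc[of Sh M y, symmetric]
      using inner_matrix_vector[of "M *v y" Sh x]
      by (simp add: Sht algebra_simps inner_add_left inner_add_right inner_commute)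
    finally show "0 \<le> x \<bullet> (Sh *v x) + 2 * (x \<bullet> (Sh ** M *v y)) + y \<bullet> (M ** Sh ** M *v y)" .
  qed (rule Sht)
  moreover have "trace (M ** Sh ** M + Sh - 2 *\<^sub>R (Sh ** M)) \<le> \<theta>\<^sup>2"
  proof -
    have "trace (M ** Sh ** M) = (\<Sum>i\<in>UNIV. a i * a i * (v i \<bullet> (Sh *v v i)))"
      by (subst trace_mul_sym) (simp add: M_def matrix_mul_assoc eig_mat_mult[OF on] trace_eig_mat_mul)
    moreover have "trace Sh = (\<Sum>i\<in>UNIV. v i \<bullet> (Sh *v v i))"
      using trace_eig_mat_mul[of v "\<lambda>_. 1" Sh] by (simp add: eig_mat_one[OF on])
    moreover have "trace (Sh ** M) = (\<Sum>i\<in>UNIV. a i * (v i \<bullet> (Sh *v v i)))"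
      by (subst trace_mul_sym) (simp add: M_def trace_eig_mat_mul)
    moreover have "(\<Sum>i\<in>UNIV. (a i - 1)\<^sup>2 * (v i \<bullet> (Sh *v v i))) = (\<Sum>i\<in>UNIV. a i * a i * (v i \<bullet> (Sh *v v i)))
        + (\<Sum>i\<in>UNIV. v i \<bullet> (Sh *v v i)) - 2 * (\<Sum>i\<in>UNIV. a i * (v i \<bullet> (Sh *v v i)))"
      unfolding sum_distrib_left sum.distrib[symmetric] sum_subtractf[symmetric]
      by (intro sum.cong refl) (simp add: power2_eq_square algebra_simps)
    ultimately show ?thesis using tr by (simp add: trace_sub trace_add trace_scaleR)
  qed
  moreover have "loewner_ge (M ** Sh ** M) (lambda_min Sh *\<^sub>R mat 1)"
    unfolding loewner_ge_scaled_id
  proof (intro conjI allI)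
    show "transpose (M ** Sh ** M) = M ** Sh ** M"
      by (simp add: matrix_transpose_mul Mt Sht matrix_mul_assoc)
    fix x
    have "x \<bullet> x \<le> (M *v x) \<bullet> (M *v x)"
      unfolding orthonormal_norm[OF on, of x] orthonormal_norm[OF on, of "M *v x"]
    proof (rule sum_mono)
      fix i
      have "\<bar>v i \<bullet> x\<bar> \<le> \<bar>v i \<bullet> (M *v x)\<bar>"
        using mult_right_mono[OF a[of i], of "\<bar>v i \<bullet> x\<bar>"] a[of i]
        by (simp add: M_def eig_mat_coord[OF on] abs_mult)
      then show "(v i \<bullet> x)\<^sup>2 \<le> (v i \<bullet> (M *v x))\<^sup>2" by (rule abs_le_square_iff[THEN iffD1])
    qed
    then have "lambda_min Sh * (x \<bullet> x) \<le> lambda_min Sh * ((M *v x) \<bullet> (M *v x))"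
      using lambda_min_pos[OF Sh] by (intro mult_left_mono) auto
    also have "\<dots> \<le> x \<bullet> (M ** Sh ** M *v x)"
      unfolding q by (rule lambda_min_rayleigh(2)[OF Sht])
    finally show "lambda_min Sh * (x \<bullet> x) \<le> x \<bullet> (M ** Sh ** M *v x)" .
  qed
  ultimately show ?thesis unfolding ambiguity_cov_def M_def by blast
qed

section \<open>Wasserstein duality for quadratic forms\<close>

text \<open>The Lagrangian bound behind Wasserstein duality: transporting \<open>y\<close> to \<open>x\<close> at price \<open>\<gamma>\<close> gains at
  most the value of a quadratic form at \<open>y\<close>.\<close>

lemma dual_bound:
  fixes G :: "real^'n^'m"
  assumes Sh: "psd Sh" and on: "orthonormal_family v" and Q: "transpose G ** G = eig_mat v l"
    and l: "\<And>i. 0 \<le> l i" "\<And>i. l i < \<gamma>" and \<theta>: "0 \<le> \<theta>"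
    and P: "P \<in> W2_ball (gaussian m Sh) \<theta>"
  shows "(\<integral>\<^sup>+x. ennreal ((norm (G *v (x - m)))\<^sup>2) \<partial>P)
    \<le> ennreal (\<gamma> * \<theta>\<^sup>2 + (\<Sum>i\<in>UNIV. \<gamma> * l i / (\<gamma> - l i) * (v i \<bullet> (Sh *v v i))))"
proof (rule ennreal_le_epsilon)
  fix e :: real assume e: "0 < e"
  have \<gamma>: "0 < \<gamma>" using l by (metis le_less_trans)
  \<comment> \<open>In an eigendirection the supremum over \<open>p\<close> of
    \<open>l p\<^sup>2 - \<gamma> (p - q)\<^sup>2\<close> is
    \<open>\<gamma> l / (\<gamma> - l) q\<^sup>2\<close>, attained at
    \<open>p = \<gamma> / (\<gamma> - l) q\<close>; these coefficients are the eigenvalues of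
    \<open>N\<close>.\<close>
  define N where "N = eig_mat v (\<lambda>i. \<gamma> * l i / (\<gamma> - l i))"
  have N: "psd N" unfolding N_def using l \<gamma> by (intro psd_eig_mat) (simp add: less_imp_le)
  define B where "B = (\<Sum>i\<in>UNIV. \<gamma> * l i / (\<gamma> - l i) * (v i \<bullet> (Sh *v v i)))"
  have B: "trace (psd_sqrt N ** Sh ** transpose (psd_sqrt N)) = B"
  proof -
    have "trace (psd_sqrt N ** Sh ** transpose (psd_sqrt N)) = trace (N ** Sh)"
      using trace_mul_sym[of "psd_sqrt N ** Sh" "psd_sqrt N"]
      by (simp add: psd_sym[OF psd_sqrt(1)[OF N]] matrix_mul_assoc psd_sqrt(2)[OF N])
    then show ?thesis unfolding B_def by (simp add: N_def trace_eig_mat_mul)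
  qed
  have B0: "0 \<le> B" unfolding B_def
    using l \<gamma> psd_nonneg[OF Sh] by (intro sum_nonneg mult_nonneg_nonneg) (simp_all add: less_imp_le)
  have Nsq: "(norm (psd_sqrt N *v x))\<^sup>2 = (\<Sum>i\<in>UNIV. \<gamma> * l i / (\<gamma> - l i) * (v i \<bullet> x)\<^sup>2)" for x
  proof -
    have "(norm (psd_sqrt N *v x))\<^sup>2 = x \<bullet> (N *v x)"
      using inner_matrix_vector[of x "psd_sqrt N" "psd_sqrt N *v x"]
      by (simp add: power2_norm_eq_inner psd_sym[OF psd_sqrt(1)[OF N]] matrix_vector_mul_assoc psd_sqrt(2)[OF N])
    then show ?thesis by (simp add: N_def eig_mat_quadratic)
  qed
  have Gsq: "(norm (G *v x))\<^sup>2 = (\<Sum>i\<in>UNIV. l i * (v i \<bullet> x)\<^sup>2)" for x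
  proof -
    have "(norm (G *v x))\<^sup>2 = x \<bullet> (transpose G ** G *v x)"
      using inner_matrix_vector[of x "transpose G" "G *v x"]
      by (simp add: power2_norm_eq_inner flip: matrix_vector_mul_assoc)
    then show ?thesis by (simp add: Q eig_mat_quadratic)
  qed
  have pointwise: "(norm (G *v x))\<^sup>2 \<le> \<gamma> * (norm (x - y))\<^sup>2 + (norm (psd_sqrt N *v y))\<^sup>2" for x y
  proof -
    have "l i * (v i \<bullet> x)\<^sup>2 \<le> \<gamma> * (v i \<bullet> (x - y))\<^sup>2 + \<gamma> * l i / (\<gamma> - l i) * (v i \<bullet> y)\<^sup>2" for i
    proof -
      define p q d where "p = v i \<bullet> x" and "q = v i \<bullet> y" and "d = \<gamma> - l i"
      have d: "0 < d" using l by (simp add: d_def)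
      have "\<gamma> * (p - q)\<^sup>2 + \<gamma> * l i / d * q\<^sup>2 - l i * p\<^sup>2 = (d * p - \<gamma> * q)\<^sup>2 / d"
        using d by (simp add: field_simps power2_eq_square) (simp add: d_def algebra_simps)
      also have "\<dots> \<ge> 0" using d by simp
      finally show ?thesis by (simp add: p_def q_def d_def inner_diff_right)
    qed
    then have "(\<Sum>i\<in>UNIV. l i * (v i \<bullet> x)\<^sup>2)
      \<le> (\<Sum>i\<in>UNIV. \<gamma> * (v i \<bullet> (x - y))\<^sup>2 + \<gamma> * l i / (\<gamma> - l i) * (v i \<bullet> y)\<^sup>2)" by (rule sum_mono)
    then show ?thesis
      unfolding Gsq Nsq power2_norm_eq_inner[of "x - y"] orthonormal_norm[OF on, of "x - y"]
      by (simp add: sum.distrib sum_distrib_left)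
  qed
  obtain M where M: "M \<in> couplings P (gaussian m Sh)"
    and cost: "(\<integral>\<^sup>+ z. ennreal ((dist (fst z) (snd z))\<^sup>2) \<partial>M) < ennreal (\<theta>\<^sup>2 + e / \<gamma>)"
    using W2_ball_coupling[OF P gaussian_in_P2[OF Sh] _ \<theta>, of "e / \<gamma>"] e \<gamma> by auto
  have [measurable_cong]: "sets M = sets (borel \<Otimes>\<^sub>M borel)"
    and fst: "distr M borel fst = P" and snd: "distr M borel snd = gaussian m Sh"
    using M by (auto simp: couplings_def)
  have "(\<integral>\<^sup>+x. ennreal ((norm (G *v (x - m)))\<^sup>2) \<partial>P) = (\<integral>\<^sup>+z. ennreal ((norm (G *v (fst z - m)))\<^sup>2) \<partial>M)"
    unfolding fst[symmetric] by (rule nn_integral_distr) measurable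
  also have "\<dots> \<le> (\<integral>\<^sup>+z. ennreal \<gamma> * ennreal ((dist (fst z) (snd z))\<^sup>2)
      + ennreal ((norm (psd_sqrt N *v (snd z - m)))\<^sup>2) \<partial>M)"
  proof (rule nn_integral_mono)
    fix z
    show "ennreal ((norm (G *v (fst z - m)))\<^sup>2)
      \<le> ennreal \<gamma> * ennreal ((dist (fst z) (snd z))\<^sup>2) + ennreal ((norm (psd_sqrt N *v (snd z - m)))\<^sup>2)"
      using pointwise[of "fst z - m" "snd z - m"] \<gamma>
      by (simp add: dist_norm ennreal_mult[symmetric] ennreal_plus[symmetric] ennreal_leI del: ennreal_plus)
  qed
  also have "\<dots> = ennreal \<gamma> * (\<integral>\<^sup>+ z. ennreal ((dist (fst z) (snd z))\<^sup>2) \<partial>M)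
      + (\<integral>\<^sup>+z. ennreal ((norm (psd_sqrt N *v (snd z - m)))\<^sup>2) \<partial>M)"
    by (simp add: nn_integral_add nn_integral_cmult)
  also have "(\<integral>\<^sup>+z. ennreal ((norm (psd_sqrt N *v (snd z - m)))\<^sup>2) \<partial>M)
      = (\<integral>\<^sup>+x. ennreal ((norm (psd_sqrt N *v (x - m)))\<^sup>2) \<partial>gaussian m Sh)"
    unfolding snd[symmetric] by (rule nn_integral_distr[symmetric]) measurable
  also have "\<dots> = ennreal B" by (simp add: gaussian_matrix_moment[OF Sh] B)
  also have "ennreal \<gamma> * (\<integral>\<^sup>+ z. ennreal ((dist (fst z) (snd z))\<^sup>2) \<partial>M) + ennreal B
      \<le> ennreal \<gamma> * ennreal (\<theta>\<^sup>2 + e / \<gamma>) + ennreal B"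
    using cost by (intro add_right_mono mult_left_mono) auto
  also have "\<dots> = ennreal (\<gamma> * \<theta>\<^sup>2 + B) + ennreal e"
    using \<gamma> e B0 by (simp add: ennreal_mult[symmetric] ennreal_plus[symmetric] distrib_left del: ennreal_plus)
  finally show "(\<integral>\<^sup>+x. ennreal ((norm (G *v (x - m)))\<^sup>2) \<partial>P)
    \<le> ennreal (\<gamma> * \<theta>\<^sup>2 + (\<Sum>i\<in>UNIV. \<gamma> * l i / (\<gamma> - l i) * (v i \<bullet> (Sh *v v i)))) + ennreal e"
    unfolding B_def .
qed

text \<open>The multiplier is chosen so that stretching by
  \<open>\<gamma> / (\<gamma> - l i)\<close> spends the transport budget exactly; the dual bound
  then coincides with the value of the stretched covariance. Two degenerate cases are reached as
  limits: \<open>\<theta> = 0\<close> with \<open>\<gamma>\<close> tending to infinity, and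
  \<open>G = 0\<close> with \<open>\<gamma>\<close> tending to 0.\<close>

lemma worst_case_covariance:
  fixes G :: "real^'n^'m"
  assumes Sh: "posdef Sh" and \<theta>: "0 \<le> \<theta>"
  obtains S where "S \<in> ambiguity_cov Sh \<theta>"
    "\<And>P. P \<in> W2_ball (gaussian m Sh) \<theta> \<Longrightarrow>
      (\<integral>\<^sup>+x. ennreal ((norm (G *v (x - m)))\<^sup>2) \<partial>P) \<le> ennreal (trace (G ** S ** transpose G))"
proof -
  note result = that
  have "psd (transpose G ** G)"
    using psd_congruence[of "mat 1" "transpose G"] by (simp add: psd_def transpose_mat transpose_transpose)
  then obtain v l where on: "orthonormal_family v" and Q: "transpose G ** G = eig_mat v l" and l: "\<And>i. 0 \<le> l i"
    using psd_diagonalizable by metis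
  define c where "c i = v i \<bullet> (Sh *v v i)" for i
  have c: "0 < c i" for i
  proof -
    have "v i \<noteq> 0" using orthonormal_inner[OF on, of i i] by auto
    then show ?thesis using Sh unfolding posdef_def c_def by blast
  qed
  define I where "I P = (\<integral>\<^sup>+x. ennreal ((norm (G *v (x - m)))\<^sup>2) \<partial>P)" for P
  have dual: "I P \<le> ennreal (\<gamma> * \<theta>\<^sup>2 + (\<Sum>i\<in>UNIV. \<gamma> * l i / (\<gamma> - l i) * c i))"
    if "P \<in> W2_ball (gaussian m Sh) \<theta>" "\<And>i. l i < \<gamma>" for P \<gamma>
    unfolding I_def c_def by (rule dual_bound[OF posdef_psd[OF Sh] on Q l that(2) \<theta> that(1)])
  \<comment> \<open>Cyclicity leaves only \<open>transpose G ** G\<close>, which commutes with the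
    stretching, being diagonal in the same family.\<close>
  have tr: "trace (G ** (eig_mat v a ** Sh ** eig_mat v a) ** transpose G) = (\<Sum>i\<in>UNIV. a i * l i * a i * c i)" for a
  proof -
    let ?M = "eig_mat v a"
    have "trace (G ** (?M ** Sh ** ?M) ** transpose G) = trace (transpose G ** (G ** (?M ** Sh ** ?M)))"
      by (rule trace_mul_sym)
    also have "\<dots> = trace ((eig_mat v l ** ?M ** Sh) ** ?M)"
      by (simp only: matrix_mul_assoc Q)
    also have "\<dots> = trace (?M ** (eig_mat v l ** ?M ** Sh))"
      by (rule trace_mul_sym)
    also have "\<dots> = trace (eig_mat v (\<lambda>i. a i * l i * a i) ** Sh)"
      by (simp add: matrix_mul_assoc eig_mat_mult[OF on] mult.assoc)
    finally show ?thesis by (simp add: trace_eig_mat_mul c_def)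
  qed
  have concl: thesis
    if "\<And>i. 1 \<le> a i" "(\<Sum>i\<in>UNIV. (a i - 1)\<^sup>2 * c i) \<le> \<theta>\<^sup>2"
      "\<And>P. P \<in> W2_ball (gaussian m Sh) \<theta> \<Longrightarrow> I P \<le> ennreal (\<Sum>i\<in>UNIV. a i * l i * a i * c i)" for a
    using that(1,2) that(3)[unfolded I_def] ambiguity_cov_stretch[OF Sh on, of a \<theta>]
    by (intro result[of "eig_mat v a ** Sh ** eig_mat v a"]) (simp_all add: tr c_def)
  consider (zero) "\<theta> = 0" | (trivial) "\<theta> > 0" "\<And>i. l i = 0" | (main) k where "\<theta> > 0" "l k > 0"
    using \<theta> l by (metis less_eq_real_def)
  then show thesis
  proof cases
    case zero
    show thesis
    proof (rule concl[of "\<lambda>_. 1"])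
      fix P assume P: "P \<in> W2_ball (gaussian m Sh) \<theta>"
      have "((\<lambda>\<gamma>. \<gamma> * l i / (\<gamma> - l i)) \<longlongrightarrow> l i) at_top" for i by real_asymp
      then have "((\<lambda>\<gamma>. \<Sum>i\<in>UNIV. \<gamma> * l i / (\<gamma> - l i) * c i) \<longlongrightarrow> (\<Sum>i\<in>UNIV. l i * c i)) at_top"
        by (intro tendsto_sum tendsto_mult tendsto_const)
      then have "((\<lambda>\<gamma>. ennreal (\<gamma> * \<theta>\<^sup>2 + (\<Sum>i\<in>UNIV. \<gamma> * l i / (\<gamma> - l i) * c i))) \<longlongrightarrow> ennreal (\<Sum>i\<in>UNIV. l i * c i)) at_top"
        unfolding zero by (intro tendsto_ennrealI) simp
      moreover have "eventually (\<lambda>\<gamma>. \<forall>i. l i < \<gamma>) at_top"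
        by (simp add: eventually_all_finite eventually_gt_at_top)
      then have "eventually (\<lambda>\<gamma>. I P \<le> ennreal (\<gamma> * \<theta>\<^sup>2 + (\<Sum>i\<in>UNIV. \<gamma> * l i / (\<gamma> - l i) * c i))) at_top"
        by eventually_elim (intro dual P, simp)
      ultimately show "I P \<le> ennreal (\<Sum>i\<in>UNIV. 1 * l i * 1 * c i)"
        by (auto intro: tendsto_lowerbound)
    qed simp_all
  next
    case trivial
    show thesis
    proof (rule concl[of "\<lambda>_. 1"])
      fix P assume P: "P \<in> W2_ball (gaussian m Sh) \<theta>"
      \<comment> \<open>With all \<open>l i = 0\<close> the dual bound is
        \<open>\<gamma> * \<theta>\<^sup>2\<close>, which the multiplier
        \<open>e / \<theta>\<^sup>2\<close> turns into \<open>e\<close>.\<close>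
      have "I P \<le> 0 + ennreal e" if "0 < e" for e
        using dual[OF P, of "e / \<theta>\<^sup>2"] trivial that by simp
      then have "I P \<le> 0" by (rule ennreal_le_epsilon)
      then show "I P \<le> ennreal (\<Sum>i\<in>UNIV. 1 * l i * 1 * c i)" by simp
    qed simp_all
  next
    case main
    define L where "L = Max (range l)"
    have L: "l i \<le> L" for i by (simp add: L_def)
    have "L \<in> range l" unfolding L_def by (intro Max_in) auto
    then obtain k where k: "l k = L" by (metis rangeE)
    have L0: "0 < L" using main L by (meson less_le_trans)
    \<comment> \<open>The transport cost of the stretching with multiplier \<open>\<gamma>\<close>,
      since its factors exceed 1 by \<open>l i / (\<gamma> - l i)\<close>.\<close>
    define h where "h \<gamma> = (\<Sum>i\<in>UNIV. (l i / (\<gamma> - l i))\<^sup>2 * c i)" for \<gamma>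
    \<comment> \<open>Here the summand at \<open>k\<close> alone equals
      \<open>\<theta>\<^sup>2\<close>, so \<open>h\<close> is at least
      \<open>\<theta>\<^sup>2\<close>; as \<open>h\<close> tends to 0 at infinity, some multiplier
      from here on gives equality.\<close>
    define \<gamma>1 where "\<gamma>1 = L + L * sqrt (c k) / \<theta>"
    have \<gamma>1: "L < \<gamma>1" using L0 main c[of k] by (simp add: \<gamma>1_def)
    have "(l k / (\<gamma>1 - l k))\<^sup>2 * c k = \<theta>\<^sup>2"
      using L0 main c[of k] by (simp add: \<gamma>1_def k power_divide power_mult_distrib)
    moreover have "(l k / (\<gamma>1 - l k))\<^sup>2 * c k \<le> h \<gamma>1"
      unfolding h_def using c by (intro member_le_sum) (auto simp: less_imp_le)
    ultimately have h1: "\<theta>\<^sup>2 \<le> h \<gamma>1" by simp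
    have "((\<lambda>\<gamma>. (l i / (\<gamma> - l i))\<^sup>2 * c i) \<longlongrightarrow> 0) at_top" for i
    proof -
      have "((\<lambda>\<gamma>. 1 / (\<gamma> - l i)) \<longlongrightarrow> 0) at_top" by real_asymp
      then have "((\<lambda>\<gamma>. (l i * (1 / (\<gamma> - l i)))\<^sup>2 * c i) \<longlongrightarrow> (l i * 0)\<^sup>2 * c i) at_top"
        by (intro tendsto_intros)
      then show ?thesis by simp
    qed
    then have "(h \<longlongrightarrow> (\<Sum>i\<in>(UNIV :: 'n set). 0)) at_top" unfolding h_def by (rule tendsto_sum)
    then have "eventually (\<lambda>\<gamma>. h \<gamma> < \<theta>\<^sup>2) at_top"
      using main by (intro order_tendstoD(2)[where y=0]) auto
    then have "eventually (\<lambda>\<gamma>. h \<gamma> < \<theta>\<^sup>2 \<and> \<gamma>1 \<le> \<gamma>) at_top"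
      using eventually_ge_at_top by (rule eventually_conj)
    then obtain \<gamma>2 where \<gamma>2: "h \<gamma>2 < \<theta>\<^sup>2" "\<gamma>1 \<le> \<gamma>2"
      using eventually_happens'[OF trivial_limit_at_top_linorder] by blast
    have "\<exists>\<gamma>\<ge>\<gamma>1. \<gamma> \<le> \<gamma>2 \<and> h \<gamma> = \<theta>\<^sup>2"
    proof (rule IVT2)
      show "\<forall>x. \<gamma>1 \<le> x \<and> x \<le> \<gamma>2 \<longrightarrow> isCont h x"
      proof safe
        fix x assume "\<gamma>1 \<le> x"
        then have "x - l i \<noteq> 0" for i using \<gamma>1 L[of i] by linarith
        then show "isCont h x" unfolding h_def by (intro continuous_intros) auto
      qed
    qed (use h1 \<gamma>2 in auto)
    then obtain \<gamma> where \<gamma>: "\<gamma>1 \<le> \<gamma>" "h \<gamma> = \<theta>\<^sup>2" by blast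
    have lt: "l i < \<gamma>" for i using L[of i] \<gamma>1 \<gamma>(1) by linarith
    define a where "a i = \<gamma> / (\<gamma> - l i)" for i
    have a1: "a i - 1 = l i / (\<gamma> - l i)" for i using lt[of i] by (simp add: a_def field_simps)
    show thesis
    proof (rule concl[of a])
      show "1 \<le> a i" for i using lt[of i] l[of i] by (simp add: a_def)
      show "(\<Sum>i\<in>UNIV. (a i - 1)\<^sup>2 * c i) \<le> \<theta>\<^sup>2" using \<gamma>(2) by (simp add: a1 h_def)
      fix P assume P: "P \<in> W2_ball (gaussian m Sh) \<theta>"
      \<comment> \<open>Absence of a duality gap: since
        \<open>h \<gamma> = \<theta>\<^sup>2\<close>, the price of the budget and the form at the
        nominal law add up to the stretched value.\<close>
      have "\<gamma> * \<theta>\<^sup>2 + (\<Sum>i\<in>UNIV. \<gamma> * l i / (\<gamma> - l i) * c i) = (\<Sum>i\<in>UNIV. a i * l i * a i * c i)"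
        unfolding \<gamma>(2)[symmetric] h_def sum_distrib_left sum.distrib[symmetric]
      proof (intro sum.cong refl)
        fix i
        have "\<gamma> - l i \<noteq> 0" using lt[of i] by simp
        then have "\<gamma> * (l i / (\<gamma> - l i))\<^sup>2 + \<gamma> * l i / (\<gamma> - l i) = a i * l i * a i"
          by (simp add: a_def divide_simps power2_eq_square) (simp add: algebra_simps)
        then show "\<gamma> * ((l i / (\<gamma> - l i))\<^sup>2 * c i) + \<gamma> * l i / (\<gamma> - l i) * c i = a i * l i * a i * c i"
          by (metis distrib_right mult.assoc)
      qed
      with dual[OF P lt] show "I P \<le> ennreal (\<Sum>i\<in>UNIV. a i * l i * a i * c i)" by simp
    qed
  qed
qed


declare transpose_matrix_vector [simp del]

section \<open>Linear estimators and the saddle point\<close>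

definition top_mat :: "real^('nx::finite + 'ny::finite)^'nx" where
  "top_mat = (\<chi> i. stack (axis i 1) 0)"

definition obs_mat :: "real^'nx^'ny \<Rightarrow> real^('nx::finite + 'ny::finite)^'ny" where
  "obs_mat C = (\<chi> i. stack (C $ i) (axis i 1))"

text \<open>The block row \<open>[I - K C, - K]\<close>: it maps the prior error stacked over the
  centred measurement noise to the estimation error of the gain \<open>K\<close>.\<close>

definition err_mat :: "real^'nx^'ny \<Rightarrow> real^'ny^'nx \<Rightarrow> real^('nx::finite + 'ny::finite)^'nx" where
  "err_mat C K = top_mat - K ** obs_mat C"

text \<open>Covariance of the prior error stacked over the centred measurement noise.\<close>

definition joint_cov :: "real^'nx^'nx \<Rightarrow> real^'nx^'nx \<Rightarrow> real^('nx::finite + 'ny::finite)^('nx + 'ny) \<Rightarrow> real^('nx + 'ny)^('nx + 'ny)" where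
  "joint_cov A Sx S = (transpose top_mat ** A) ** Sx ** transpose (transpose top_mat ** A) + S"

text \<open>Together with \<open>cross_mat\<close>, these are the blocks \<open>S_block\<close> and
  \<open>T_block\<close> of the program as functions of the noise covariance.\<close>

definition inn_cov where
  "inn_cov A C Sx S = obs_mat C ** joint_cov A Sx S ** transpose (obs_mat C)"

definition cross_mat where
  "cross_mat A C Sx S = top_mat ** joint_cov A Sx S ** transpose (obs_mat C)"

definition gain where
  "gain A C Sx S = cross_mat A C Sx S ** matrix_inv (inn_cov A C Sx S)"

definition mse where
  "mse A C Sx S K = trace (err_mat C K ** joint_cov A Sx S ** transpose (err_mat C K))"

lemma top_mat_vec: "top_mat *v z = upper z"
  by (simp add: top_mat_def vec_eq_iff matrix_vector_mul_component inner_upper_lower inner_axis')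

lemma obs_mat_vec: "obs_mat C *v z = C *v upper z + lower z"
  by (simp add: obs_mat_def vec_eq_iff matrix_vector_mul_component inner_upper_lower inner_axis')

lemma transpose_top_mat_vec: "transpose top_mat *v x = stack x 0"
proof -
  have "z \<bullet> (transpose top_mat *v x) = z \<bullet> stack x 0" for z
    using inner_matrix_vector[of z "transpose top_mat" x]
    by (simp add: top_mat_vec inner_upper_lower[of z "stack x 0"])
  then show ?thesis by (metis inner_commute vector_eq_rdot)
qed

lemma transpose_obs_mat_vec: "transpose (obs_mat C) *v y = stack (transpose C *v y) y"
proof -
  have "z \<bullet> (transpose (obs_mat C) *v y) = z \<bullet> stack (transpose C *v y) y" for z
    using inner_matrix_vector[of z "transpose (obs_mat C)" y] inner_matrix_vector[of "upper z" "transpose C" y]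
    by (simp add: obs_mat_vec inner_upper_lower[of z "stack _ _"] inner_add_left)
  then show ?thesis by (metis inner_commute vector_eq_rdot)
qed

lemma joint_cov_vec: "joint_cov A Sx S *v z = stack (A *v (Sx *v (transpose A *v upper z))) 0 + S *v z"
  by (simp add: joint_cov_def matrix_vector_mult_add_rdistrib matrix_transpose_mul transpose_top_mat_vec
      top_mat_vec flip: matrix_vector_mul_assoc)

lemma joint_cov_sym: "psd Sx \<Longrightarrow> transpose S = S \<Longrightarrow> transpose (joint_cov A Sx S) = joint_cov A Sx S"
  using psd_sym[OF psd_congruence, of Sx "transpose top_mat ** A"]
  by (simp add: joint_cov_def transpose_add)

lemma joint_cov_ge: "psd Sx \<Longrightarrow> z \<bullet> (S *v z) \<le> z \<bullet> (joint_cov A Sx S *v z)"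
  using psd_nonneg[OF psd_congruence, of Sx z "transpose top_mat ** A"]
  by (simp add: joint_cov_def matrix_vector_mult_add_rdistrib inner_add_right)

lemma joint_cov_convex:
  "joint_cov A Sx ((1 - s) *\<^sub>R S + s *\<^sub>R S') = (1 - s) *\<^sub>R joint_cov A Sx S + s *\<^sub>R joint_cov A Sx S'"
  by (simp add: joint_cov_def scaleR_add_right)

lemma quadratic_congruence: "x \<bullet> (G ** M ** transpose G *v x) = (transpose G *v x) \<bullet> (M *v (transpose G *v x))"
  for G :: "real^'k^'m"
  by (simp add: inner_matrix_vector[of x G] flip: matrix_vector_mul_assoc)

lemma mse_convex:
  "mse A C Sx ((1 - s) *\<^sub>R S + s *\<^sub>R S') K = (1 - s) * mse A C Sx S K + s * mse A C Sx S' K"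
  unfolding mse_def trace_congruence[symmetric] joint_cov_convex sum_distrib_left sum.distrib[symmetric]
  by (simp add: matrix_vector_mult_add_rdistrib inner_add_right scaleR_matrix_vector_assoc[symmetric])

section \<open>Optimal gains and the saddle inequality\<close>

locale surrogate =
  fixes A :: "real^'nx^'nx" and C :: "real^'nx^'ny" and Sx :: "real^'nx^'nx"
    and Sh :: "real^('nx + 'ny)^('nx + 'ny)" and \<theta> :: real
  assumes Sx: "psd Sx" and Sh: "posdef Sh" and \<theta>: "0 \<le> \<theta>"
begin

text \<open>\<open>transpose (obs_mat C) *v y\<close> contains \<open>y\<close> as a component and
  so is no shorter. The eigenvalue bound on \<open>S\<close> thus passes to the innovation
  covariance, with one constant for all feasible \<open>S\<close>.\<close>

lemma inn_cov_ge:
  assumes S: "S \<in> ambiguity_cov Sh \<theta>"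
  shows "lambda_min Sh * (y \<bullet> y) \<le> y \<bullet> (inn_cov A C Sx S *v y)"
proof -
  let ?z = "transpose (obs_mat C) *v y"
  have "lambda_min Sh * (y \<bullet> y) \<le> lambda_min Sh * (?z \<bullet> ?z)"
    using lambda_min_pos[OF Sh] by (intro mult_left_mono)
      (simp_all add: transpose_obs_mat_vec inner_upper_lower[of "stack _ _"])
  also have "\<dots> \<le> ?z \<bullet> (S *v ?z)" by (rule ambiguity_cov_lower(2)[OF S])
  also have "\<dots> \<le> ?z \<bullet> (joint_cov A Sx S *v ?z)" by (rule joint_cov_ge[OF Sx])
  finally show ?thesis by (simp add: inn_cov_def quadratic_congruence)
qed

lemma inn_cov_posdef:
  assumes S: "S \<in> ambiguity_cov Sh \<theta>"
  shows "posdef (inn_cov A C Sx S)"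
proof -
  have "transpose (inn_cov A C Sx S) = inn_cov A C Sx S"
    using joint_cov_sym[OF Sx ambiguity_cov_lower(1)[OF S], of A]
    by (simp add: inn_cov_def matrix_transpose_mul matrix_mul_assoc)
  moreover have "0 < y \<bullet> (inn_cov A C Sx S *v y)" if "y \<noteq> 0" for y
    using inn_cov_ge[OF S, of y] lambda_min_pos[OF Sh] that
    by (meson inner_gt_zero_iff less_le_trans mult_pos_pos)
  ultimately show ?thesis by (simp add: posdef_def)
qed

lemma gain_inn:
  assumes S: "S \<in> ambiguity_cov Sh \<theta>"
  shows "gain A C Sx S ** inn_cov A C Sx S = cross_mat A C Sx S"
  by (simp add: gain_def matrix_inv_inverse[OF posdef_invertible[OF inn_cov_posdef[OF S]]]
      flip: matrix_mul_assoc)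

text \<open>The normal equations, read as the orthogonality principle: the error of the optimal gain
  is uncorrelated with the innovation.\<close>

lemma gain_orthogonal:
  assumes S: "S \<in> ambiguity_cov Sh \<theta>"
  shows "err_mat C (gain A C Sx S) ** joint_cov A Sx S ** transpose (obs_mat C) = 0"
  using gain_inn[OF S]
  by (simp add: err_mat_def matrix_diff_rdistrib cross_mat_def inn_cov_def matrix_mul_assoc)

text \<open>Completing the square in \<open>K\<close>; both cross terms vanish by the orthogonality
  principle.\<close>

lemma mse_gain:
  assumes S: "S \<in> ambiguity_cov Sh \<theta>"
  shows "mse A C Sx S K = mse A C Sx S (gain A C Sx S)
    + trace ((K - gain A C Sx S) ** inn_cov A C Sx S ** transpose (K - gain A C Sx S))"
proof -
  define E D B \<Omega> where "E = err_mat C (gain A C Sx S)" and "D = K - gain A C Sx S"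
    and "B = obs_mat C" and "\<Omega> = joint_cov A Sx S"
  have \<Omega>: "transpose \<Omega> = \<Omega>" unfolding \<Omega>_def by (rule joint_cov_sym[OF Sx ambiguity_cov_lower(1)[OF S]])
  have err: "err_mat C K = E - D ** B"
    by (simp add: err_mat_def E_def D_def B_def matrix_diff_rdistrib)
  have EB: "E ** \<Omega> ** transpose B = 0"
    using gain_orthogonal[OF S] by (simp add: E_def \<Omega>_def B_def)
  have BE: "B ** \<Omega> ** transpose E = 0"
  proof -
    have "transpose (E ** \<Omega> ** transpose B) = B ** \<Omega> ** transpose E"
      by (simp add: matrix_transpose_mul \<Omega> matrix_mul_assoc)
    then show ?thesis unfolding EB by (simp add: transpose_def zero_vec_def)
  qed
  have "err_mat C K ** \<Omega> ** transpose (err_mat C K) = E ** \<Omega> ** transpose E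
      - (E ** \<Omega> ** transpose B) ** transpose D - D ** (B ** \<Omega> ** transpose E)
      + D ** (B ** \<Omega> ** transpose B) ** transpose D"
    unfolding err by (simp add: transpose_diff matrix_transpose_mul matrix_diff_ldistrib matrix_diff_rdistrib
        matrix_mul_assoc)
  then have "err_mat C K ** \<Omega> ** transpose (err_mat C K)
      = E ** \<Omega> ** transpose E + D ** (B ** \<Omega> ** transpose B) ** transpose D"
    unfolding EB BE by simp
  then show ?thesis
    unfolding mse_def inn_cov_def \<Omega>_def[symmetric] E_def[symmetric] D_def[symmetric] B_def[symmetric]
    by (simp add: trace_add)
qed

lemma mse_gain_le:
  assumes S: "S \<in> ambiguity_cov Sh \<theta>"
  shows "mse A C Sx S (gain A C Sx S) \<le> mse A C Sx S K"
  using mse_gain[OF S, of K] trace_nonneg[OF psd_congruence[OF posdef_psd[OF inn_cov_posdef[OF S]]]]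
  by simp

text \<open>Moving from a maximiser \<open>S\<^sub>0\<close> towards \<open>S\<close>, the optimal gain changes by \<open>O(s)\<close> and hence the optimal
  error differs from that of the old gain by only \<open>O(s\<^sup>2)\<close>.\<close>

theorem mse_saddle:
  assumes S0: "S0 \<in> ambiguity_cov Sh \<theta>"
    and max: "\<And>S. S \<in> ambiguity_cov Sh \<theta> \<Longrightarrow> mse A C Sx S (gain A C Sx S) \<le> mse A C Sx S0 (gain A C Sx S0)"
    and S: "S \<in> ambiguity_cov Sh \<theta>"
  shows "mse A C Sx S (gain A C Sx S0) \<le> mse A C Sx S0 (gain A C Sx S0)"
proof -
  define K0 g \<mu> where "K0 = gain A C Sx S0" and "g = mse A C Sx S0 K0" and "\<mu> = lambda_min Sh"
  \<comment> \<open>The correlation under \<open>S\<close> between the innovation and the error of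
    the gain optimal for \<open>S0\<close>. Under \<open>S0\<close> this correlation vanishes, so by
    affinity it is \<open>s *\<^sub>R Y\<close> along the segment.\<close>
  define Y where "Y = err_mat C K0 ** joint_cov A Sx S ** transpose (obs_mat C)"
  define \<kappa> where "\<kappa> = (\<Sum>c\<in>Basis. (norm (transpose Y *v c))\<^sup>2 / \<mu>)"
  have \<mu>: "0 < \<mu>" using lambda_min_pos[OF Sh] by (simp add: \<mu>_def)
  have step: "mse A C Sx S K0 - g \<le> s * \<kappa>" if s: "0 < s" "s \<le> 1" for s
  proof -
    define Ss where "Ss = (1 - s) *\<^sub>R S0 + s *\<^sub>R S"
    have Ss: "Ss \<in> ambiguity_cov Sh \<theta>"
      unfolding Ss_def using s by (intro ambiguity_cov_convex[OF S0 S]) auto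
    define N where "N = inn_cov A C Sx Ss"
    define D where "D = K0 - gain A C Sx Ss"
    have Nt: "transpose N = N" using inn_cov_posdef[OF Ss] by (simp add: N_def posdef_def)
    have "D ** N = K0 ** N - cross_mat A C Sx Ss"
      by (simp add: D_def N_def matrix_diff_rdistrib gain_inn[OF Ss])
    also have "\<dots> = - (err_mat C K0 ** joint_cov A Sx Ss ** transpose (obs_mat C))"
      by (simp add: N_def inn_cov_def cross_mat_def err_mat_def matrix_diff_rdistrib matrix_mul_assoc)
    also have "\<dots> = - (s *\<^sub>R Y)"
      using gain_orthogonal[OF S0]
      by (simp add: Ss_def joint_cov_convex Y_def K0_def matrix_add_ldistrib matrix_add_rdistrib
          scalar_matrix_assoc[symmetric] matrix_scalar_ac)
    finally have DN: "D ** N = - (s *\<^sub>R Y)" .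
    have "trace (D ** N ** transpose D) = (\<Sum>c\<in>Basis. (transpose D *v c) \<bullet> (N *v (transpose D *v c)))"
      by (simp add: trace_congruence)
    also have "\<dots> \<le> (\<Sum>c\<in>Basis. s\<^sup>2 * ((norm (transpose Y *v c))\<^sup>2 / \<mu>))"
    proof (rule sum_mono)
      fix c :: "real^'nx"
      define d y where "d = transpose D *v c" and "y = transpose Y *v c"
      have "N *v d = transpose (D ** N) *v c"
        by (simp add: d_def matrix_transpose_mul Nt matrix_vector_mul_assoc)
      also have "\<dots> = - (s *\<^sub>R y)"
        by (simp add: DN y_def vec_eq_iff transpose_def matrix_vector_mult_def sum_negf sum_distrib_left mult_ac)
      finally have Nd: "N *v d = - (s *\<^sub>R y)" .
      have ge: "\<mu> * (norm d)\<^sup>2 \<le> d \<bullet> (N *v d)"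
        using inn_cov_ge[OF Ss, of d] by (simp add: N_def \<mu>_def power2_norm_eq_inner)
      have le: "d \<bullet> (N *v d) \<le> s * (norm d * norm y)"
        using mult_left_mono[OF norm_cauchy_schwarz[of "- d" y], of s] s by (simp add: Nd)
      \<comment> \<open>Cancelling one factor \<open>norm d\<close> between the two estimates shows
        that the gain changes by order \<open>s\<close>; inserting this once more gives order
        \<open>s\<^sup>2\<close> for the form.\<close>
      have nd: "\<mu> * norm d \<le> s * norm y"
      proof (cases "norm d = 0")
        case False
        then have "0 < norm d" by simp
        moreover have "\<mu> * norm d * norm d \<le> s * norm y * norm d"
          using order.trans[OF ge le] by (simp add: power2_eq_square mult_ac)
        ultimately show ?thesis by (meson mult_le_cancel_right_pos)
      qed (use s in simp)
      have "d \<bullet> (N *v d) \<le> s * norm y * (norm d)" using le by (simp add: mult_ac)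
      also have "\<dots> \<le> s * norm y * (s * norm y / \<mu>)"
        using nd \<mu> s by (intro mult_left_mono) (simp_all add: field_simps)
      finally show "(transpose D *v c) \<bullet> (N *v (transpose D *v c)) \<le> s\<^sup>2 * ((norm (transpose Y *v c))\<^sup>2 / \<mu>)"
        by (simp add: d_def y_def power2_eq_square mult_ac)
    qed
    also have "\<dots> = s\<^sup>2 * \<kappa>" by (simp add: \<kappa>_def sum_distrib_left)
    finally have tr: "trace (D ** N ** transpose D) \<le> s\<^sup>2 * \<kappa>" .
    \<comment> \<open>The left side is affine in \<open>s\<close>. Comparison with the maximum
      \<open>g\<close> and division by \<open>s\<close> leave the error \<open>s * \<kappa>\<close>,
      which vanishes with \<open>s\<close>.\<close>
    have "(1 - s) * g + s * mse A C Sx S K0 = mse A C Sx Ss K0"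
      by (simp add: Ss_def mse_convex g_def)
    also have "\<dots> = mse A C Sx Ss (gain A C Sx Ss) + trace (D ** N ** transpose D)"
      using mse_gain[OF Ss, of K0] by (simp add: D_def N_def)
    also have "\<dots> \<le> g + s\<^sup>2 * \<kappa>"
      using max[OF Ss] tr by (simp add: g_def K0_def add_mono)
    finally have "s * (mse A C Sx S K0 - g) \<le> s * (s * \<kappa>)"
      by (simp add: algebra_simps power2_eq_square)
    then show ?thesis using s by simp
  qed
  have \<kappa>: "0 \<le> \<kappa>" using \<mu> by (simp add: \<kappa>_def sum_nonneg)
  have "mse A C Sx S K0 - g \<le> 0"
  proof (rule field_le_epsilon)
    fix e :: real assume e: "0 < e"
    define s where "s = min 1 (e / (\<kappa> + 1))"
    have s: "0 < s" "s \<le> 1" using e \<kappa> by (simp_all add: s_def)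
    have "s * \<kappa> \<le> (e / (\<kappa> + 1)) * \<kappa>" using \<kappa> by (intro mult_right_mono) (simp_all add: s_def)
    also have "\<dots> \<le> e" using e \<kappa> by (simp add: field_simps)
    finally show "mse A C Sx S K0 - g \<le> 0 + e" using step[OF s] by simp
  qed
  then show ?thesis by (simp add: g_def K0_def)
qed

end


section \<open>The semidefinite program\<close>

lemma continuous_on_matrix_form:
  fixes f :: "'p::topological_space \<Rightarrow> real^'m^'n"
  assumes "continuous_on X f"
  shows "continuous_on X (\<lambda>p. a \<bullet> (f p *v b))"
  unfolding inner_vec_def matrix_vector_mult_def using assms by (simp, intro continuous_intros)

text \<open>Testing with the sum and the difference of two basis vectors bounds an entry by the mean
  of two diagonal entries, each at most the trace.\<close>

lemma psd_entry_bound: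
  assumes M: "psd (M :: real^'n^'n)" shows "\<bar>M $ i $ j\<bar> \<le> trace M"
proof -
  have ax: "axis a 1 \<bullet> (M *v axis b 1) = M $ a $ b" for a b
    by (simp add: inner_axis' matrix_vector_mul_component inner_axis)
  have sym: "M $ j $ i = M $ i $ j" using arg_cong[OF psd_sym[OF M], of "\<lambda>M. M $ i $ j"] by (simp add: transpose_def)
  have nn: "0 \<le> M $ k $ k" for k using psd_nonneg[OF M, of "axis k 1"] by (simp add: ax)
  have le: "M $ k $ k \<le> trace M" for k
    unfolding trace_def using nn by (intro member_le_sum) auto
  have "0 \<le> (axis i 1 + axis j 1) \<bullet> (M *v (axis i 1 + axis j 1))"
    "0 \<le> (axis i 1 - axis j 1) \<bullet> (M *v (axis i 1 - axis j 1))"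
    by (rule psd_nonneg[OF M])+
  then have "0 \<le> M $ i $ i + 2 * M $ i $ j + M $ j $ j" "0 \<le> M $ i $ i - 2 * M $ i $ j + M $ j $ j"
    by (simp_all add: matrix_vector_right_distrib matrix_vector_mult_diff_distrib inner_add_left inner_add_right
        inner_diff_left inner_diff_right ax sym)
  then show ?thesis using le[of i] le[of j] by linarith
qed

lemma matrix_norm_le: "norm M \<le> (\<Sum>i\<in>UNIV. \<Sum>j\<in>UNIV. \<bar>M $ i $ j\<bar>)" for M :: "real^'m^'n"
proof -
  have "norm M \<le> (\<Sum>i\<in>UNIV. norm (M $ i))"
    unfolding norm_vec_def by (rule L2_set_le_sum) simp
  also have "\<dots> \<le> (\<Sum>i\<in>UNIV. \<Sum>j\<in>UNIV. \<bar>M $ i $ j\<bar>)"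
    by (intro sum_mono norm_le_l1_cart)
  finally show ?thesis .
qed

lemma trace_block: "trace (block A B C D) = trace A + trace D"
  by (simp add: trace_def sum_UNIV_sum block_def)

text \<open>Compactness is proved for the pairs \<open>(S, Z)\<close>, where the constraints are
  closed and a bound on the trace of the block matrix bounds all entries; the set is the image under
  projection.\<close>

lemma compact_ambiguity_cov:
  fixes Sh :: "real^'n^'n"
  assumes Sh: "transpose Sh = Sh"
  shows "compact (ambiguity_cov Sh \<theta>)"
proof -
  define T where "T = {p. psd (block Sh (snd p) (transpose (snd p)) (fst p)) \<and>
      trace (fst p + Sh - 2 *\<^sub>R snd p) \<le> \<theta>\<^sup>2 \<and> loewner_ge (fst p) (lambda_min Sh *\<^sub>R mat 1)}"
  have T: "ambiguity_cov Sh \<theta> = fst ` T"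
  proof -
    have "S \<in> ambiguity_cov Sh \<theta> \<longleftrightarrow> (\<exists>Z. (S, Z) \<in> T)" for S
      by (simp add: ambiguity_cov_def T_def)
    then show ?thesis by force
  qed
  have "closed T"
  proof -
    have "T = {p. (\<forall>i j. fst p $ i $ j = fst p $ j $ i) \<and>
        (\<forall>a b. 0 \<le> a \<bullet> (Sh *v a) + 2 * (a \<bullet> (snd p *v b)) + b \<bullet> (fst p *v b)) \<and>
        (\<Sum>i\<in>UNIV. (fst p + Sh - 2 *\<^sub>R snd p) $ i $ i) \<le> \<theta>\<^sup>2 \<and> (\<forall>x. lambda_min Sh * (x \<bullet> x) \<le> x \<bullet> (fst p *v x))}"
      unfolding T_def psd_block_iff loewner_ge_scaled_id trace_def
      using arg_cong[OF Sh, of "\<lambda>M. M $ i $ j" for i j] by (auto simp: transpose_def vec_eq_iff)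
    also have "closed \<dots>"
      by (intro closed_Collect_conj closed_Collect_all closed_Collect_eq closed_Collect_le
          continuous_intros continuous_on_matrix_form)
    finally show ?thesis .
  qed
  moreover have "bounded T"
  proof -
    \<comment> \<open>From \<open>trace S \<le> \<theta>\<^sup>2 - trace Sh + 2 * trace Z\<close>
      and \<open>2 * trace Z \<le> 2 * trace Sh + trace S / 2\<close> follows
      \<open>trace S \<le> 2 * (\<theta>\<^sup>2 + trace Sh)\<close>; \<open>B\<close> adds the
      trace of the other diagonal block.\<close>
    define B where "B = trace Sh + 2 * (\<theta>\<^sup>2 + trace Sh)"
    define R where "R = (\<Sum>i\<in>(UNIV::'n set). \<Sum>j\<in>(UNIV::'n set). B)"
    have "norm p \<le> R + R" if "p \<in> T" for p
    proof -
      obtain S Z where p: "p = (S, Z)" by (cases p)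
      have blk: "psd (block Sh Z (transpose Z) S)" and tr: "trace (S + Sh - 2 *\<^sub>R Z) \<le> \<theta>\<^sup>2"
        using that by (auto simp: T_def p)
      have "2 * Z $ i $ i \<le> 2 * Sh $ i $ i + S $ i $ i / 2" for i
      proof -
        \<comment> \<open>The weights 2 and -1 leave only half of \<open>S\<close> in the bound on
          \<open>2 * Z\<close>, so that it can be absorbed.\<close>
        have "0 \<le> (2 *\<^sub>R axis i 1) \<bullet> (Sh *v (2 *\<^sub>R axis i 1)) + 2 * ((2 *\<^sub>R axis i 1) \<bullet> (Z *v (- axis i 1)))
          + (- axis i 1) \<bullet> (S *v (- axis i 1))"
          using blk unfolding psd_block_iff by blast
        then show ?thesis
          by (simp add: inner_axis' matrix_vector_mul_component inner_axis)
      qed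
      then have "(\<Sum>i\<in>UNIV. 2 * Z $ i $ i) \<le> (\<Sum>i\<in>UNIV. 2 * Sh $ i $ i + S $ i $ i / 2)" by (rule sum_mono)
      then have "2 * trace Z \<le> 2 * trace Sh + trace S / 2"
        by (simp add: trace_def sum.distrib sum_distrib_left sum_divide_distrib)
      then have "trace (block Sh Z (transpose Z) S) \<le> B"
        using tr by (simp add: trace_block trace_add trace_sub trace_scaleR B_def)
      then have ent: "\<bar>block Sh Z (transpose Z) S $ i $ j\<bar> \<le> B" for i j
        using psd_entry_bound[OF blk] order.trans by blast
      have "\<bar>S $ i $ j\<bar> \<le> B" "\<bar>Z $ i $ j\<bar> \<le> B" for i j
        using ent[of "Inr i" "Inr j"] ent[of "Inl i" "Inr j"] by (simp_all add: block_def)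
      then have "norm S \<le> R" "norm Z \<le> R"
        unfolding R_def by (intro order.trans[OF matrix_norm_le] sum_mono; simp)+
      then show ?thesis using norm_Pair_le[of S Z] by (simp add: p)
    qed
    then show ?thesis unfolding bounded_iff by blast
  qed
  ultimately have "compact T" by (simp add: compact_eq_bounded_closed)
  then show ?thesis
    unfolding T by (intro compact_continuous_image continuous_intros)
qed

lemma ambiguity_cov_nonempty:
  assumes Sh: "posdef Sh" shows "ambiguity_cov Sh \<theta> \<noteq> {}"
proof -
  obtain v d where "orthonormal_family v" "Sh = eig_mat v d"
    using symmetric_diagonalizable Sh unfolding posdef_def by metis
  then show ?thesis using ambiguity_cov_stretch[OF Sh, of v "\<lambda>_. 1" \<theta>] by auto
qed

section \<open>Feasible points of the program and feasible covariances\<close>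

lemma err_quadratic:
  fixes C :: "real^'nx^'ny" and S :: "real^('nx + 'ny)^('nx + 'ny)"
  assumes "psd Sx" "transpose S = S"
  shows "x \<bullet> (err_mat C K ** joint_cov A Sx S ** transpose (err_mat C K) *v x)
    = x \<bullet> (top_mat ** joint_cov A Sx S ** transpose top_mat *v x)
      - 2 * (x \<bullet> (cross_mat A C Sx S *v (transpose K *v x)))
      + (transpose K *v x) \<bullet> (inn_cov A C Sx S *v (transpose K *v x))"
proof -
  define \<Omega> where "\<Omega> = joint_cov A Sx S"
  have \<Omega>: "transpose \<Omega> = \<Omega>" unfolding \<Omega>_def by (rule joint_cov_sym[OF assms])
  define p q :: "real^('nx + 'ny)" where "p = transpose top_mat *v x" and "q = transpose (obs_mat C) *v (transpose K *v x)"
  have e: "transpose (err_mat C K) *v x = p - q"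
    by (simp add: err_mat_def transpose_diff matrix_transpose_mul matrix_vector_mult_diff_rdistrib p_def q_def
        flip: matrix_vector_mul_assoc)
  have "x \<bullet> (cross_mat A C Sx S *v (transpose K *v x)) = p \<bullet> (\<Omega> *v q)"
    by (simp add: cross_mat_def \<Omega>_def p_def q_def inner_matrix_vector[of x top_mat] flip: matrix_vector_mul_assoc)
  moreover have "q \<bullet> (\<Omega> *v p) = p \<bullet> (\<Omega> *v q)"
    using inner_matrix_vector[of q \<Omega> p] by (simp add: \<Omega> inner_commute)
  ultimately show ?thesis
    unfolding inn_cov_def quadratic_congruence \<Omega>_def[symmetric] e p_def[symmetric] q_def[symmetric]
    by (simp add: matrix_vector_mult_diff_distrib inner_diff_left inner_diff_right)
qed

lemma prior_cov_eq: "top_mat ** joint_cov A Sx S ** transpose top_mat = A ** Sx ** transpose A + W"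
  if "S = block W X Y V"
  unfolding matrix_eq that
  by (simp add: matrix_vector_mult_add_rdistrib joint_cov_vec top_mat_vec transpose_top_mat_vec upper_add
      upper_block_vec flip: matrix_vector_mul_assoc)

text \<open>The equality constraint on the prior covariance identifies the blocks of the program
  with covariances of the joint vector.\<close>

lemma cov_blocks:
  assumes prior: "prior_cov s = A ** Sx ** transpose A + w_cov s"
  shows "T_block C s = cross_mat A C Sx (noise_cov s)"
    and "S_block C s = inn_cov A C Sx (noise_cov s)"
    and "top_mat ** joint_cov A Sx (noise_cov s) ** transpose top_mat = prior_cov s"
proof -
  show "T_block C s = cross_mat A C Sx (noise_cov s)"
    unfolding matrix_eq
    by (simp add: T_block_def cross_mat_def noise_cov_def prior matrix_vector_mult_add_rdistrib joint_cov_vec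
        top_mat_vec transpose_obs_mat_vec upper_add upper_block_vec matrix_vector_right_distrib algebra_simps
        flip: matrix_vector_mul_assoc)
  show "S_block C s = inn_cov A C Sx (noise_cov s)"
    unfolding matrix_eq
    by (simp add: S_block_def inn_cov_def noise_cov_def prior matrix_vector_mult_add_rdistrib joint_cov_vec
        obs_mat_vec transpose_obs_mat_vec upper_add lower_add upper_block_vec lower_block_vec
        matrix_vector_right_distrib algebra_simps flip: matrix_vector_mul_assoc)
  show "top_mat ** joint_cov A Sx (noise_cov s) ** transpose top_mat = prior_cov s"
    unfolding prior by (rule prior_cov_eq) (simp add: noise_cov_def)
qed

context surrogate
begin

lemma continuous_on_mse: "continuous_on X (\<lambda>S. mse A C Sx S K)"
  unfolding mse_def trace_congruence[symmetric] joint_cov_def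
  by (simp add: matrix_vector_mult_add_rdistrib inner_add_right)
    (intro continuous_intros continuous_on_matrix_form)

text \<open>As an infimum of continuous functions, the optimal error is upper semicontinuous.\<close>

lemma least_favorable_cov_exists:
  "\<exists>S0\<in>ambiguity_cov Sh \<theta>. \<forall>S\<in>ambiguity_cov Sh \<theta>.
    mse A C Sx S (gain A C Sx S) \<le> mse A C Sx S0 (gain A C Sx S0)"
proof -
  let ?D = "ambiguity_cov Sh \<theta>"
  define g where "g S = mse A C Sx S (gain A C Sx S)" for S
  have cpt: "compact ?D" using Sh by (intro compact_ambiguity_cov) (simp add: posdef_def)
  have ne: "?D \<noteq> {}" by (rule ambiguity_cov_nonempty[OF Sh])
  \<comment> \<open>The fixed gain 0 bounds the optimal error by a continuous function on a compact
    set, so the supremum \<open>m\<close> is finite.\<close>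
  have "\<exists>S1\<in>?D. \<forall>S\<in>?D. mse A C Sx S 0 \<le> mse A C Sx S1 0"
    by (rule continuous_attains_sup[OF cpt ne continuous_on_mse])
  then obtain S1 where S1: "\<And>S. S \<in> ?D \<Longrightarrow> g S \<le> mse A C Sx S1 0"
    using mse_gain_le order.trans unfolding g_def by blast
  then have bdd: "bdd_above (g ` ?D)" by (auto intro!: bdd_aboveI2)
  define m where "m = (SUP S\<in>?D. g S)"
  have m: "g S \<le> m" if "S \<in> ?D" for S unfolding m_def using bdd that by (rule cSUP_upper2) simp
  have "\<exists>S\<in>?D. m - 1 / real (Suc n) < g S" for n
    using ne bdd unfolding m_def by (subst less_cSUP_iff[symmetric]) auto
  then obtain X where X: "\<And>n. X n \<in> ?D" "\<And>n. m - 1 / real (Suc n) < g (X n)" by metis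
  obtain S0 r where S0: "S0 \<in> ?D" and r: "strict_mono r" "(X \<circ> r) \<longlonglongrightarrow> S0"
    using cpt X(1) unfolding compact_def by metis
  \<comment> \<open>The gain is frozen at that of the limit point: along the sequence it gives only
    an upper bound, but one that is continuous in the covariance and exact in the limit.\<close>
  let ?K = "gain A C Sx S0"
  have "m \<le> g S0"
  proof (rule LIMSEQ_le)
    have "(\<lambda>n. m - 1 / real (Suc n)) \<longlonglongrightarrow> m - 0"
      by (intro tendsto_diff tendsto_const lim_1_over_n[THEN LIMSEQ_Suc])
    then show "((\<lambda>n. m - 1 / real (Suc n)) \<circ> r) \<longlonglongrightarrow> m"
      using LIMSEQ_subseq_LIMSEQ[OF _ r(1)] by simp
    show "(\<lambda>n. mse A C Sx ((X \<circ> r) n) ?K) \<longlonglongrightarrow> g S0"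
      unfolding g_def by (rule continuous_on_tendsto_compose[OF continuous_on_mse r(2), of UNIV]) auto
    show "\<exists>N. \<forall>n\<ge>N. ((\<lambda>n. m - 1 / real (Suc n)) \<circ> r) n \<le> mse A C Sx ((X \<circ> r) n) ?K"
    proof (intro exI allI impI)
      fix n
      show "((\<lambda>n. m - 1 / real (Suc n)) \<circ> r) n \<le> mse A C Sx ((X \<circ> r) n) ?K"
        using X(2)[of "r n"] mse_gain_le[OF X(1)[of "r n"], of ?K] by (simp add: g_def)
    qed
  qed
  with m S0 show ?thesis unfolding g_def by (meson order.trans)
qed

lemma feasible_noise_cov: "sdp_feasible A C Sx Sh \<theta> s \<Longrightarrow> noise_cov s \<in> ambiguity_cov Sh \<theta>"
  by (auto simp: sdp_feasible_def ambiguity_cov_def)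

text \<open>The block inequality tested at \<open>x\<close> and \<open>- (transpose K *v x)\<close>
  bounds the form of \<open>post_cov s\<close> by that of the error covariance of an arbitrary
  gain.\<close>

lemma feasible_trace_le:
  assumes f: "sdp_feasible A C Sx Sh \<theta> s"
  shows "trace (post_cov s) \<le> mse A C Sx (noise_cov s) K"
proof -
  have blk: "psd (block (prior_cov s - post_cov s) (T_block C s) (transpose (T_block C s)) (S_block C s))"
    using f unfolding sdp_feasible_def by blast
  have prior: "prior_cov s = A ** Sx ** transpose A + w_cov s" using f by (simp add: sdp_feasible_def)
  have sym: "transpose (noise_cov s) = noise_cov s"
    by (rule ambiguity_cov_lower(1)[OF feasible_noise_cov[OF f]])
  have "x \<bullet> (post_cov s *v x)
      \<le> x \<bullet> (err_mat C K ** joint_cov A Sx (noise_cov s) ** transpose (err_mat C K) *v x)" for x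
  proof -
    let ?y = "transpose K *v x"
    have "0 \<le> x \<bullet> ((prior_cov s - post_cov s) *v x) + 2 * (x \<bullet> (T_block C s *v (- ?y))) + (- ?y) \<bullet> (S_block C s *v (- ?y))"
      using blk unfolding psd_block_iff by blast
    then show ?thesis
      unfolding err_quadratic[OF Sx sym] cov_blocks[OF prior]
      by (simp add: matrix_vector_mult_diff_rdistrib inner_diff_right matrix_vector_mult_minus)
  qed
  then show ?thesis unfolding mse_def trace_quadratic by (intro sum_mono)
qed

text \<open>\<open>post_cov\<close> is taken to be the error covariance of the optimal gain. The
  block inequality then reduces to nonnegativity of the innovation form at
  \<open>transpose K *v a + b\<close>.\<close>

lemma feasible_from_cov:
  assumes S: "S \<in> ambiguity_cov Sh \<theta>"
  obtains s where "sdp_feasible A C Sx Sh \<theta> s" "noise_cov s = S" "trace (post_cov s) = mse A C Sx S (gain A C Sx S)"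
proof -
  obtain Z where Z: "psd (block Sh Z (transpose Z) S)" "trace (S + Sh - 2 *\<^sub>R Z) \<le> \<theta>\<^sup>2"
    "loewner_ge S (lambda_min Sh *\<^sub>R mat 1)"
    using S by (auto simp: ambiguity_cov_def)
  have sym: "transpose S = S" and psdS: "psd S"
    using ambiguity_cov_lower(1)[OF S] posdef_psd[OF ambiguity_cov_posdef[OF Sh S]] by auto
  define W X V where "W = (\<chi> i j. S $ Inl i $ Inl j)" and "X = (\<chi> i j. S $ Inl i $ Inr j)"
    and "V = (\<chi> i j. S $ Inr i $ Inr j)"
  have symc: "S $ i $ j = S $ j $ i" for i j using arg_cong[OF sym, of "\<lambda>M. M $ j $ i"] by (simp add: transpose_def)
  have SB: "S = block W X (transpose X) V"
    by (simp add: vec_eq_iff block_def W_def X_def V_def transpose_def symc split: sum.split)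
  define K where "K = gain A C Sx S"
  define P where "P = err_mat C K ** joint_cov A Sx S ** transpose (err_mat C K)"
  define s where "s = \<lparr>prior_cov = A ** Sx ** transpose A + W, post_cov = P, w_cov = W, v_cov = V, wv_cov = X, cross_cov = Z\<rparr>"
  have nc: "noise_cov s = S" by (simp add: noise_cov_def s_def SB)
  have psdJ: "psd (joint_cov A Sx S)"
    unfolding joint_cov_def by (intro psd_add psd_congruence Sx psdS)
  have psdP: "psd P" unfolding P_def by (rule psd_congruence[OF psdJ])
  have W: "psd W" and V: "psd V"
  proof -
    have q: "stack a b \<bullet> (S *v stack a b) = a \<bullet> (W *v a) + 2 * (a \<bullet> (X *v b)) + b \<bullet> (V *v b)" for a b
      unfolding SB by (rule block_quadratic)
    have "0 \<le> a \<bullet> (W *v a)" "0 \<le> b \<bullet> (V *v b)" for a b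
      using psd_nonneg[OF psdS, of "stack a 0"] psd_nonneg[OF psdS, of "stack 0 b"] by (simp_all add: q)
    moreover have "transpose W = W" "transpose V = V"
      by (simp_all add: W_def V_def transpose_def vec_eq_iff symc)
    ultimately show "psd W" "psd V" by (simp_all add: psd_def)
  qed
  have prior: "psd (A ** Sx ** transpose A + W)" by (intro psd_add psd_congruence Sx W)
  have prior_s: "prior_cov s = A ** Sx ** transpose A + w_cov s" by (simp add: s_def)
  note T = cov_blocks(1)[OF prior_s, of C, unfolded nc] and I = cov_blocks(2)[OF prior_s, of C, unfolded nc]
    and top = cov_blocks(3)[OF prior_s, unfolded nc]
  have KI: "cross_mat A C Sx S = K ** inn_cov A C Sx S"
    by (simp add: K_def gain_inn[OF S])
  have It: "transpose (inn_cov A C Sx S) = inn_cov A C Sx S"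
    using inn_cov_posdef[OF S] by (simp add: posdef_def)
  have blk: "psd (block (prior_cov s - P) (T_block C s) (transpose (T_block C s)) (S_block C s))"
    unfolding psd_block_iff T I
  proof (intro conjI allI It)
    show "transpose (prior_cov s - P) = prior_cov s - P"
      using psd_sym[OF prior] psd_sym[OF psdP] by (simp add: transpose_diff s_def)
    fix a b
    let ?u = "transpose K *v a" and ?N = "inn_cov A C Sx S"
    have c: "a \<bullet> (cross_mat A C Sx S *v y) = ?u \<bullet> (?N *v y)" for y
      by (simp add: KI inner_matrix_vector[of a K] flip: matrix_vector_mul_assoc)
    have "a \<bullet> (P *v a) = a \<bullet> (prior_cov s *v a) - ?u \<bullet> (?N *v ?u)"
      unfolding P_def err_quadratic[OF Sx sym] top c by simp
    moreover have "b \<bullet> (?N *v ?u) = ?u \<bullet> (?N *v b)"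
      using inner_matrix_vector[of b ?N ?u] by (simp add: It inner_commute)
    moreover have "0 \<le> (?u + b) \<bullet> (?N *v (?u + b))"
      by (rule psd_nonneg[OF posdef_psd[OF inn_cov_posdef[OF S]]])
    ultimately show "0 \<le> a \<bullet> ((prior_cov s - P) *v a) + 2 * (a \<bullet> (cross_mat A C Sx S *v b)) + b \<bullet> (?N *v b)"
      by (simp add: c matrix_vector_mult_diff_rdistrib inner_diff_right matrix_vector_right_distrib
          inner_add_left inner_add_right)
  qed
  have "sdp_feasible A C Sx Sh \<theta> s"
    unfolding sdp_feasible_def nc using blk prior psdP W V Z psdS by (simp add: s_def)
  then show ?thesis using nc by (rule that) (simp add: s_def mse_def P_def K_def)
qed

end


section \<open>Risks\<close>

lemma prior_error_eq: "prior_error A (upper m) e \<epsilon> = top_mat *v ((transpose top_mat ** A) *v e + (\<epsilon> - m))"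
  by (simp add: prior_error_def top_mat_vec transpose_top_mat_vec upper_add upper_diff flip: matrix_vector_mul_assoc)

lemma surrogate_innovation_eq:
  "surrogate_innovation A C (upper m) (lower m) e \<epsilon> = obs_mat C *v ((transpose top_mat ** A) *v e + (\<epsilon> - m))"
  by (simp add: surrogate_innovation_def prior_error_eq obs_mat_vec top_mat_vec transpose_top_mat_vec
      lower_add lower_diff flip: matrix_vector_mul_assoc)

text \<open>Integrating over the centred Gaussian error with the noise held fixed removes the cross
  term. Hence the formula holds for every noise law, whatever its mean.\<close>

lemma surrogate_risk_linear:
  fixes A :: "real^'nx^'nx" and C :: "real^'nx^'ny" and m :: "real^('nx + 'ny)"
  assumes Sx: "psd Sx" and "prob_space P" and [measurable_cong]: "sets P = sets borel"
  defines "\<Gamma> \<equiv> transpose top_mat ** A :: real^'nx^('nx + 'ny)"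
  shows "surrogate_risk A C Sx (upper m) (lower m) P (\<lambda>\<nu>. K *v \<nu>)
    = (\<integral>\<^sup>+\<epsilon>. ennreal ((norm (err_mat C K *v (\<epsilon> - m)))\<^sup>2) \<partial>P)
      + ennreal (trace (err_mat C K ** (\<Gamma> ** Sx ** transpose \<Gamma>) ** transpose (err_mat C K)))"
proof -
  interpret P: prob_space P by fact
  interpret N: prob_space "gaussian 0 Sx" by (rule prob_space_gaussian)
  interpret NP: pair_sigma_finite "gaussian 0 Sx" P ..
  let ?E = "err_mat C K"
  have err: "prior_error A (upper m) e \<epsilon> - K *v surrogate_innovation A C (upper m) (lower m) e \<epsilon>
      = ?E *v (\<epsilon> - m) + (?E ** \<Gamma>) *v e" for e \<epsilon>
    by (simp add: prior_error_eq surrogate_innovation_eq err_mat_def \<Gamma>_def matrix_vector_mult_diff_rdistrib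
        matrix_vector_right_distrib matrix_diff_rdistrib flip: matrix_vector_mul_assoc)
  have "surrogate_risk A C Sx (upper m) (lower m) P (\<lambda>\<nu>. K *v \<nu>)
      = (\<integral>\<^sup>+z. ennreal ((norm (?E *v (snd z - m) + (?E ** \<Gamma>) *v fst z))\<^sup>2) \<partial>(gaussian 0 Sx \<Otimes>\<^sub>M P))"
    unfolding surrogate_risk_def err by (simp add: split_beta')
  also have "\<dots> = (\<integral>\<^sup>+\<epsilon>. \<integral>\<^sup>+e. ennreal ((norm (?E *v (\<epsilon> - m) + (?E ** \<Gamma>) *v e))\<^sup>2) \<partial>gaussian 0 Sx \<partial>P)"
    by (subst NP.nn_integral_snd[symmetric]) simp_all
  also have "\<dots> = (\<integral>\<^sup>+\<epsilon>. ennreal ((norm (?E *v (\<epsilon> - m)))\<^sup>2)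
      + ennreal (trace ((?E ** \<Gamma>) ** Sx ** transpose (?E ** \<Gamma>))) \<partial>P)"
    by (simp only: gaussian_shift_moment[OF Sx])
  also have "\<dots> = (\<integral>\<^sup>+\<epsilon>. ennreal ((norm (?E *v (\<epsilon> - m)))\<^sup>2) \<partial>P)
      + ennreal (trace ((?E ** \<Gamma>) ** Sx ** transpose (?E ** \<Gamma>)))"
    by (simp add: nn_integral_add P.emeasure_space_1)
  finally show ?thesis by (simp add: matrix_transpose_mul matrix_mul_assoc)
qed

lemma borel_measurable_prior_error [measurable]:
  "(\<lambda>z. prior_error A w (fst z) (snd z)) \<in> borel_measurable (borel \<Otimes>\<^sub>M borel)"
proof -
  have u: "upper z = top_mat *v z" for z :: "real^('a + 'b)" by (simp add: top_mat_vec)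
  show ?thesis unfolding prior_error_def u by measurable
qed

lemma borel_measurable_surrogate_innovation [measurable]:
  "(\<lambda>z. surrogate_innovation A C w v (fst z) (snd z)) \<in> borel_measurable (borel \<Otimes>\<^sub>M borel)"
proof -
  have l: "lower z = obs_mat 0 *v z" for z :: "real^('a + 'b)" by (simp add: obs_mat_vec)
  show ?thesis unfolding surrogate_innovation_def l by measurable
qed

context surrogate
begin

text \<open>Any estimator differs from the optimal gain by a function of the innovation, so its
  error is the residual plus such a correction. What remains is to exhibit the symmetry for the
  joint law of error and noise.\<close>

lemma surrogate_risk_gaussian_ge:
  fixes m :: "real^('nx + 'ny)"
  assumes S: "S \<in> ambiguity_cov Sh \<theta>" and [measurable]: "\<phi> \<in> borel_measurable borel"
  shows "ennreal (mse A C Sx S (gain A C Sx S)) \<le> surrogate_risk A C Sx (upper m) (lower m) (gaussian m S) \<phi>"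
proof -
  define R1 R2 where "R1 = psd_sqrt Sx" and "R2 = psd_sqrt S"
  have psdS: "psd S" by (rule posdef_psd[OF ambiguity_cov_posdef[OF Sh S]])
  have R: "R1 ** R1 = Sx" "transpose R1 = R1" "R2 ** R2 = S" "transpose R2 = R2"
    using psd_sqrt[OF Sx] psd_sqrt[OF psdS] by (auto simp: R1_def R2_def psd_sym)
  define \<Gamma> :: "real^'nx^('nx + 'ny)" where "\<Gamma> = transpose top_mat ** A"
  define W where "W z = \<Gamma> *v (R1 *v fst z) + R2 *v snd z" for z :: "(real^'nx) \<times> (real^('nx + 'ny))"
  define Wt where "Wt y = (R1 *v (transpose \<Gamma> *v y), R2 *v y)" for y
  define \<Omega> N K E B where "\<Omega> = joint_cov A Sx S" and "N = inn_cov A C Sx S" and "K = gain A C Sx S"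
    and "E = err_mat C K" and "B = obs_mat C"
  have linW: "linear W"
    by (rule linearI) (simp_all add: W_def matrix_vector_right_distrib matrix_vector_mult_scaleR algebra_simps)
  have linWt: "linear Wt"
    by (rule linearI) (simp_all add: Wt_def matrix_vector_right_distrib matrix_vector_mult_scaleR)
  have [measurable]: "W \<in> borel_measurable borel"
    using linW by (auto intro!: borel_measurable_continuous_onI linear_continuous_on simp: linear_conv_bounded_linear)
  have adj: "W z \<bullet> y = z \<bullet> Wt y" for z y
    by (cases z) (simp add: W_def Wt_def inner_add_left matrix_vector_inner R)
  have cov: "W (Wt y) = \<Omega> *v y" for y
    by (simp add: W_def Wt_def \<Omega>_def joint_cov_def \<Gamma>_def[symmetric] matrix_vector_mult_add_rdistrib
        matrix_vector_mul_assoc matrix_mul_assoc R)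
  have N: "N ** matrix_inv N = mat 1"
    using matrix_inv_inverse(1)[OF posdef_invertible[OF inn_cov_posdef[OF S]]] by (simp add: N_def)
  have BN: "B *v (\<Omega> *v (transpose B *v y)) = N *v y" for y
    by (simp add: N_def inn_cov_def B_def \<Omega>_def matrix_vector_mul_assoc matrix_mul_assoc)
  have EB: "E *v (\<Omega> *v (transpose B *v y)) = 0" for y
    using gain_orthogonal[OF S]
    by (simp add: E_def K_def \<Omega>_def B_def matrix_vector_mul_assoc matrix_mul_assoc)
  have inv: "N *v (matrix_inv N *v y) = y" for y by (simp add: matrix_vector_mul_assoc N)
  \<comment> \<open>\<open>Wt (q z)\<close> is the orthogonal projection of \<open>z\<close> onto
    the range of the adjoint of the innovation map \<open>B W\<close>, and \<open>H\<close> is the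
    reflection about that range. It fixes the innovation, and it flips the residual because
    \<open>E \<Omega> B\<^sup>T = 0\<close>.\<close>
  define q where "q z = transpose B *v (matrix_inv N *v (B *v W z))" for z
  define H where "H z = 2 *\<^sub>R Wt (q z) - z" for z
  have q_add: "q (x + y) = q x + q y" and q_scale: "q (c *\<^sub>R x) = c *\<^sub>R q x" for x y c
    by (simp_all add: q_def linear_add[OF linW] linear_scale[OF linW] matrix_vector_right_distrib matrix_vector_mult_scaleR)
  have "linear H"
    by (rule linearI) (simp_all add: H_def q_add q_scale linear_add[OF linWt] linear_scale[OF linWt] algebra_simps)
  moreover have "norm (H z) = norm z" for z
  proof -
    have "Wt (q z) \<bullet> Wt (q z) = q z \<bullet> (\<Omega> *v q z)"
      by (simp add: cov inner_commute flip: adj)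
    also have "\<dots> = q z \<bullet> W z"
    proof -
      define u where "u = matrix_inv N *v (B *v W z)"
      have "q z = transpose B *v u" "N *v u = B *v W z" by (simp_all add: q_def u_def inv)
      then show ?thesis by (simp add: matrix_vector_inner BN)
    qed
    also have "\<dots> = Wt (q z) \<bullet> z"
      by (simp add: adj inner_commute[of "q z"] inner_commute[of z])
    finally have "H z \<bullet> H z = z \<bullet> z"
      by (simp add: H_def inner_diff_left inner_diff_right inner_commute)
    then show ?thesis by (simp add: norm_eq_sqrt_inner)
  qed
  ultimately have H: "orthogonal_transformation H" by (simp add: orthogonal_transformation)
  have WH: "W (H z) = 2 *\<^sub>R (\<Omega> *v q z) - W z" for z
    by (simp add: H_def linear_diff[OF linW] linear_scale[OF linW] cov)
  have rH: "E *v W (H z) = - (E *v W z)" for z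
    by (simp add: WH matrix_vector_mult_diff_distrib matrix_vector_mult_scaleR q_def EB)
  have nH: "B *v W (H z) = B *v W z" for z
  proof -
    have "B *v W (H z) = 2 *\<^sub>R (B *v (\<Omega> *v q z)) - B *v W z"
      unfolding WH by (simp only: matrix_vector_mult_diff_distrib matrix_vector_mult_scaleR)
    then show ?thesis by (simp add: q_def BN inv scaleR_2)
  qed
  have "ennreal (mse A C Sx S K) = (\<integral>\<^sup>+z. ennreal ((norm (E *v W z))\<^sup>2) \<partial>std_gauss)"
    using std_gauss_matrix_moment[OF linW adj cov, of E] by (simp add: mse_def E_def \<Omega>_def)
  also have "\<dots> \<le> (\<integral>\<^sup>+z. ennreal ((norm (E *v W z + (K *v (B *v W z) - \<phi> (B *v W z))))\<^sup>2) \<partial>std_gauss)"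
    by (rule std_gauss_residual_le[where r="\<lambda>z. E *v W z" and n="\<lambda>z. B *v W z" and H=H
          and \<psi>="\<lambda>\<nu>. K *v \<nu> - \<phi> \<nu>"])
      (simp_all add: H rH nH)
  also have "\<dots> = (\<integral>\<^sup>+z. ennreal ((norm (top_mat *v W z - \<phi> (B *v W z)))\<^sup>2) \<partial>std_gauss)"
    by (simp add: E_def err_mat_def B_def matrix_vector_mult_diff_rdistrib flip: matrix_vector_mul_assoc)
  also have "\<dots> = (\<integral>\<^sup>+z. ennreal ((norm (top_mat *v W z - \<phi> (B *v W z)))\<^sup>2) \<partial>(std_gauss \<Otimes>\<^sub>M std_gauss))"
    by (simp only: std_gauss_pair)
  also have "\<dots> = surrogate_risk A C Sx (upper m) (lower m) (gaussian m S) \<phi>"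
  proof -
    have "gaussian 0 Sx \<Otimes>\<^sub>M gaussian m S = distr (std_gauss \<Otimes>\<^sub>M std_gauss) (borel \<Otimes>\<^sub>M borel)
        (\<lambda>(x, y). (0 + R1 *v x, m + R2 *v y))"
      unfolding gaussian_eq R1_def R2_def
      by (rule pair_measure_distr)
        (simp_all flip: gaussian_eq add: prob_space_imp_sigma_finite[OF prob_space_gaussian])
    then show ?thesis
      unfolding surrogate_risk_def split_beta'
      by (simp add: nn_integral_distr split_beta')
        (simp add: prior_error_eq surrogate_innovation_eq W_def \<Gamma>_def B_def)
  qed
  finally show ?thesis by (simp add: K_def)
qed

text \<open>The gain of \<open>S0\<close> keeps the risk below the saddle value for all laws of the
  ball, and the Gaussian law keeps it above for all estimators; the three claims are read off from
  this chain.\<close>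

theorem minimax_saddle:
  fixes m :: "real^('nx + 'ny)"
  assumes S0: "S0 \<in> ambiguity_cov Sh \<theta>"
    and max: "\<And>S. S \<in> ambiguity_cov Sh \<theta> \<Longrightarrow> mse A C Sx S (gain A C Sx S) \<le> mse A C Sx S0 (gain A C Sx S0)"
  defines "R \<equiv> surrogate_risk A C Sx (upper m) (lower m)" and "D \<equiv> W2_ball (gaussian m Sh) \<theta>"
  shows "minimax_value R D = ennreal (mse A C Sx S0 (gain A C Sx S0))"
    and "least_favorable R D (gaussian m S0)"
    and "minimax_optimal R D (\<lambda>\<nu>. gain A C Sx S0 *v \<nu>)"
proof -
  let ?K = "gain A C Sx S0" and ?g = "ennreal (mse A C Sx S0 (gain A C Sx S0))"
  let ?E = "err_mat C ?K"
  have Km: "(\<lambda>\<nu>. ?K *v \<nu>) \<in> borel_measurable borel" by measurable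
  have P0: "gaussian m S0 \<in> D"
    using S0 gaussian_in_W2_ball[OF Sh ambiguity_cov_posdef[OF Sh S0] _ _ \<theta>]
    by (auto simp: ambiguity_cov_def D_def)
  have upper: "R P (\<lambda>\<nu>. ?K *v \<nu>) \<le> ?g" if P: "P \<in> D" for P
  proof -
    \<comment> \<open>This covariance depends on the fixed gain only and serves all laws of the ball
      at once; the saddle inequality compares it with \<open>S0\<close>.\<close>
    obtain S where S: "S \<in> ambiguity_cov Sh \<theta>"
      and wc: "\<And>P. P \<in> W2_ball (gaussian m Sh) \<theta> \<Longrightarrow>
        (\<integral>\<^sup>+x. ennreal ((norm (?E *v (x - m)))\<^sup>2) \<partial>P) \<le> ennreal (trace (?E ** S ** transpose ?E))"
      using worst_case_covariance[OF Sh \<theta>, where G="?E"] by blast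
    define \<Gamma> :: "real^'nx^('nx + 'ny)" where "\<Gamma> = transpose top_mat ** A"
    define M where "M = \<Gamma> ** Sx ** transpose \<Gamma>"
    have psdM: "psd M" unfolding M_def by (rule psd_congruence[OF Sx])
    have psdS: "psd S" by (rule posdef_psd[OF ambiguity_cov_posdef[OF Sh S]])
    have "R P (\<lambda>\<nu>. ?K *v \<nu>) = (\<integral>\<^sup>+x. ennreal ((norm (?E *v (x - m)))\<^sup>2) \<partial>P) + ennreal (trace (?E ** M ** transpose ?E))"
      unfolding R_def M_def \<Gamma>_def using P by (intro surrogate_risk_linear Sx) (auto simp: D_def W2_ball_def P2_def)
    also have "\<dots> \<le> ennreal (trace (?E ** S ** transpose ?E)) + ennreal (trace (?E ** M ** transpose ?E))"
      using wc P by (intro add_right_mono) (simp add: D_def)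
    also have "\<dots> = ennreal (trace (?E ** S ** transpose ?E) + trace (?E ** M ** transpose ?E))"
      by (intro ennreal_plus[symmetric] trace_nonneg psd_congruence psdS psdM)
    also have "trace (?E ** S ** transpose ?E) + trace (?E ** M ** transpose ?E) = mse A C Sx S ?K"
      by (simp add: mse_def joint_cov_def \<Gamma>_def[symmetric] M_def[symmetric] matrix_add_ldistrib matrix_add_rdistrib trace_add)
    also have "ennreal (mse A C Sx S ?K) \<le> ?g"
      by (intro ennreal_leI mse_saddle[OF S0 max S])
    finally show ?thesis .
  qed
  have lower: "?g \<le> R (gaussian m S0) \<phi>" if "\<phi> \<in> borel_measurable borel" for \<phi>
    unfolding R_def by (rule surrogate_risk_gaussian_ge[OF S0 that])
  have wK: "worst_risk R D (\<lambda>\<nu>. ?K *v \<nu>) \<le> ?g"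
    unfolding worst_risk_def by (intro SUP_least upper)
  have ge: "?g \<le> minimax_value R D"
    unfolding minimax_value_def worst_risk_def using lower P0 by (intro INF_greatest SUP_upper2)
  have le: "minimax_value R D \<le> worst_risk R D (\<lambda>\<nu>. ?K *v \<nu>)"
    unfolding minimax_value_def using Km by (rule INF_lower)
  show "minimax_value R D = ?g" using ge le wK by (meson antisym order.trans)
  then show "minimax_optimal R D (\<lambda>\<nu>. ?K *v \<nu>)"
    using Km le wK by (auto simp: minimax_optimal_def)
  have "bayes_risk R Q \<le> bayes_risk R (gaussian m S0)" if "Q \<in> D" for Q
  proof -
    have "bayes_risk R Q \<le> R Q (\<lambda>\<nu>. ?K *v \<nu>)"
      unfolding bayes_risk_def using Km by (rule INF_lower)
    also have "\<dots> \<le> ?g" by (rule upper[OF that])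
    also have "\<dots> \<le> bayes_risk R (gaussian m S0)"
      unfolding bayes_risk_def by (intro INF_greatest lower)
    finally show ?thesis .
  qed
  with P0 show "least_favorable R D (gaussian m S0)" by (simp add: least_favorable_def)
qed

text \<open>The last clause admits any optimal point to the saddle theorem. Its objective is at most
  the optimal error of its noise covariance, which is at most the maximum, and at an optimum the two
  ends agree.\<close>

theorem sdp_solution:
  obtains S0 where "S0 \<in> ambiguity_cov Sh \<theta>"
    "\<And>S. S \<in> ambiguity_cov Sh \<theta> \<Longrightarrow> mse A C Sx S (gain A C Sx S) \<le> mse A C Sx S0 (gain A C Sx S0)"
    "sdp_value A C Sx Sh \<theta> = ennreal (mse A C Sx S0 (gain A C Sx S0))"
    "\<exists>s. sdp_optimal A C Sx Sh \<theta> s"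
    "\<And>s. sdp_optimal A C Sx Sh \<theta> s \<Longrightarrow>
      mse A C Sx (noise_cov s) (gain A C Sx (noise_cov s)) = mse A C Sx S0 (gain A C Sx S0)"
proof -
  obtain S0 where S0: "S0 \<in> ambiguity_cov Sh \<theta>"
    and max: "\<And>S. S \<in> ambiguity_cov Sh \<theta> \<Longrightarrow> mse A C Sx S (gain A C Sx S) \<le> mse A C Sx S0 (gain A C Sx S0)"
    using least_favorable_cov_exists by blast
  define g where "g = mse A C Sx S0 (gain A C Sx S0)"
  obtain s0 where s0: "sdp_feasible A C Sx Sh \<theta> s0" "trace (post_cov s0) = g"
    using feasible_from_cov[OF S0] unfolding g_def by metis
  have le: "trace (post_cov s) \<le> mse A C Sx (noise_cov s) (gain A C Sx (noise_cov s))"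
    "mse A C Sx (noise_cov s) (gain A C Sx (noise_cov s)) \<le> g" if "sdp_feasible A C Sx Sh \<theta> s" for s
    using feasible_trace_le[OF that] max[OF feasible_noise_cov[OF that]] by (auto simp: g_def)
  have "sdp_value A C Sx Sh \<theta> = ennreal g"
    unfolding sdp_value_def
  proof (rule antisym)
    show "(SUP s\<in>{s. sdp_feasible A C Sx Sh \<theta> s}. ennreal (trace (post_cov s))) \<le> ennreal g"
      using le by (intro SUP_least ennreal_leI) (auto intro: order.trans)
    show "ennreal g \<le> (SUP s\<in>{s. sdp_feasible A C Sx Sh \<theta> s}. ennreal (trace (post_cov s)))"
      using s0 by (intro SUP_upper2[of s0]) auto
  qed
  moreover have "sdp_optimal A C Sx Sh \<theta> s0"
    unfolding sdp_optimal_def using s0 le by (metis order.trans)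
  moreover have "mse A C Sx (noise_cov s) (gain A C Sx (noise_cov s)) = g" if "sdp_optimal A C Sx Sh \<theta> s" for s
    using that s0 le[of s] unfolding sdp_optimal_def by (metis antisym order.trans)
  ultimately show ?thesis using that[OF S0 max] unfolding g_def by blast
qed

end

section \<open>From the innovation to the measurement, and the conclusion\<close>

lemma state_risk_eq:
  "state_risk A C Sx wh vh xm ym P \<psi> = surrogate_risk A C Sx wh vh P (\<lambda>\<nu>. \<psi> (ym + \<nu>) - xm)"
  by (simp add: state_risk_def surrogate_risk_def algebra_simps)

text \<open>Translating argument and value turns each estimator based on the measurement into one
  based on the innovation with the same worst risk, so none can beat the innovation value.\<close>

lemma minimax_optimal_state:
  assumes opt: "minimax_optimal (surrogate_risk A C Sx wh vh) D \<phi>"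
  shows "minimax_optimal (state_risk A C Sx wh vh xm ym) D (\<lambda>y. xm + \<phi> (y - ym))"
proof -
  let ?R = "surrogate_risk A C Sx wh vh" and ?Q = "state_risk A C Sx wh vh xm ym"
  have [measurable]: "\<phi> \<in> borel_measurable borel" using opt by (simp add: minimax_optimal_def)
  have m: "(\<lambda>y. xm + \<phi> (y - ym)) \<in> borel_measurable borel" by measurable
  have worst: "worst_risk ?Q D \<psi> = worst_risk ?R D (\<lambda>\<nu>. \<psi> (ym + \<nu>) - xm)" for \<psi>
    by (simp add: worst_risk_def state_risk_eq)
  have "worst_risk ?Q D (\<lambda>y. xm + \<phi> (y - ym)) = minimax_value ?R D"
    using opt by (simp add: worst minimax_optimal_def)
  also have "\<dots> \<le> minimax_value ?Q D"
    unfolding minimax_value_def[of ?Q]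
  proof (rule INF_greatest)
    fix \<psi> :: "real^'b \<Rightarrow> real^'a" assume [measurable]: "\<psi> \<in> borel_measurable borel"
    show "minimax_value ?R D \<le> worst_risk ?Q D \<psi>"
      unfolding worst minimax_value_def by (rule INF_lower) measurable
  qed
  finally have "worst_risk ?Q D (\<lambda>y. xm + \<phi> (y - ym)) \<le> minimax_value ?Q D" .
  moreover have "minimax_value ?Q D \<le> worst_risk ?Q D (\<lambda>y. xm + \<phi> (y - ym))"
    unfolding minimax_value_def using m by (rule INF_lower)
  ultimately show ?thesis using m by (auto simp: minimax_optimal_def)
qed

lemma posdef_block_diag:
  assumes "posdef M" "posdef N" shows "posdef (block M 0 0 N)"
proof -
  have 0: "transpose 0 = (0 :: real^'k^'l)" by (simp add: transpose_def vec_eq_iff)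
  have "0 < z \<bullet> (block M 0 0 N *v z)" if "z \<noteq> 0" for z
  proof -
    have "z \<bullet> (block M 0 0 N *v z) = upper z \<bullet> (M *v upper z) + lower z \<bullet> (N *v lower z)"
      by (simp add: inner_upper_lower upper_block_vec lower_block_vec)
    moreover have "upper z \<noteq> 0 \<or> lower z \<noteq> 0" using that by (simp add: vec_sum_eq_iff)
    ultimately show ?thesis
      using assms psd_nonneg[OF posdef_psd[OF assms(1)], of "upper z"] psd_nonneg[OF posdef_psd[OF assms(2)], of "lower z"]
      unfolding posdef_def by (metis add_pos_nonneg add_nonneg_pos)
  qed
  then show ?thesis using assms by (simp add: posdef_def transpose_block) (simp add: transpose_def zero_vec_def)
qed

theorem proposition1:
  fixes f :: "real^'nx \<Rightarrow> real^'nu \<Rightarrow> real^'nx"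
    and h :: "real^'nx \<Rightarrow> real^'ny"
    and u :: "nat \<Rightarrow> real^'nu"
    and xbar :: "nat \<Rightarrow> real^'nx"
    and what :: "nat \<Rightarrow> real^'nx"
    and vhat :: "nat \<Rightarrow> real^'ny"
    and Sw_hat :: "nat \<Rightarrow> real^'nx^'nx"
    and Sv_hat :: "nat \<Rightarrow> real^'ny^'ny"
    and Sx :: "nat \<Rightarrow> real^'nx^'nx"
    and \<theta> :: "nat \<Rightarrow> real"
    and t :: nat
    and xprior :: "real^'nx"
    and A :: "real^'nx^'nx"
    and C :: "real^'nx^'ny"
    and S_hat :: "real^('nx + 'ny)^('nx + 'ny)"
    and \<epsilon>_hat :: "real^('nx + 'ny)"
    and D :: "(real^('nx + 'ny)) measure set"
    and R :: "((real^('nx + 'ny)) measure, real^'ny, real^'nx) risk"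
  assumes f_C2: "twice_cont_diff (\<lambda>(x, a). f x a)"
    and h_C2: "twice_cont_diff h"
    and t: "t \<ge> 1"
    and Sw_hat: "posdef (Sw_hat (t - 1))"
    and Sv_hat: "posdef (Sv_hat t)"
    and Sx: "psd (Sx (t - 1))"
    and theta: "\<theta> t \<ge> 0"
    and xprior: "xprior = f (xbar (t - 1)) (u (t - 1)) + what (t - 1)"
    and A: "A = jacobian (\<lambda>x. f x (u (t - 1))) (at (xbar (t - 1)))"
    and C: "C = jacobian h (at xprior)"
    and eps_hat: "\<epsilon>_hat = stack (what (t - 1)) (vhat t)"
    and S_hat: "S_hat = block (Sw_hat (t - 1)) 0 0 (Sv_hat t)"
    and D: "D = W2_ball (gaussian \<epsilon>_hat S_hat) (\<theta> t)"
    and R: "R = surrogate_risk A C (Sx (t - 1)) (what (t - 1)) (vhat t)"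
  shows "minimax_value R D = sdp_value A C (Sx (t - 1)) S_hat (\<theta> t)
    \<and> (\<exists>s. sdp_optimal A C (Sx (t - 1)) S_hat (\<theta> t) s)
    \<and> (\<forall>s K. sdp_optimal A C (Sx (t - 1)) S_hat (\<theta> t) s
            \<and> K = T_block C s ** matrix_inv (S_block C s) \<longrightarrow>
          least_favorable R D (gaussian \<epsilon>_hat (noise_cov s))
          \<and> invertible (S_block C s)
          \<and> minimax_optimal R D (\<lambda>\<nu>. K *v \<nu>)
          \<and> minimax_optimal
              (state_risk A C (Sx (t - 1)) (what (t - 1)) (vhat t) xprior (h xprior + vhat t)) D
              (\<lambda>y. xprior + K *v (y - h xprior - vhat t)))"
proof -
  let ?Sx = "Sx (t - 1)" and ?th = "\<theta> t"
  interpret surrogate A C ?Sx S_hat ?th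
    using Sx theta posdef_block_diag[OF Sw_hat Sv_hat] by unfold_locales (simp_all add: S_hat)
  have R: "R = surrogate_risk A C ?Sx (upper \<epsilon>_hat) (lower \<epsilon>_hat)"
    by (simp add: R eps_hat)
  obtain S0 where S0: "S0 \<in> ambiguity_cov S_hat ?th"
    and max: "\<And>S. S \<in> ambiguity_cov S_hat ?th \<Longrightarrow> mse A C ?Sx S (gain A C ?Sx S) \<le> mse A C ?Sx S0 (gain A C ?Sx S0)"
    and val: "sdp_value A C ?Sx S_hat ?th = ennreal (mse A C ?Sx S0 (gain A C ?Sx S0))"
    and ex: "\<exists>s. sdp_optimal A C ?Sx S_hat ?th s"
    and opt: "\<And>s. sdp_optimal A C ?Sx S_hat ?th s \<Longrightarrow>
      mse A C ?Sx (noise_cov s) (gain A C ?Sx (noise_cov s)) = mse A C ?Sx S0 (gain A C ?Sx S0)"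
    using sdp_solution by blast
  have "minimax_value R D = sdp_value A C ?Sx S_hat ?th"
    unfolding val R D by (rule minimax_saddle(1)[OF S0 max])
  moreover have "least_favorable R D (gaussian \<epsilon>_hat (noise_cov s)) \<and> invertible (S_block C s)
      \<and> minimax_optimal R D (\<lambda>\<nu>. K *v \<nu>)
      \<and> minimax_optimal
          (state_risk A C ?Sx (what (t - 1)) (vhat t) xprior (h xprior + vhat t)) D
          (\<lambda>y. xprior + K *v (y - h xprior - vhat t))"
    if s: "sdp_optimal A C ?Sx S_hat ?th s" and K: "K = T_block C s ** matrix_inv (S_block C s)" for s K
  proof -
    have f: "sdp_feasible A C ?Sx S_hat ?th s" using s by (simp add: sdp_optimal_def)
    have prior: "prior_cov s = A ** ?Sx ** transpose A + w_cov s"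
      using f unfolding sdp_feasible_def by blast
    have n: "noise_cov s \<in> ambiguity_cov S_hat ?th" by (rule feasible_noise_cov[OF f])
    have K': "K = gain A C ?Sx (noise_cov s)"
      by (simp add: K gain_def cov_blocks[OF prior])
    have inv: "invertible (S_block C s)"
      unfolding cov_blocks(2)[OF prior] by (rule posdef_invertible[OF inn_cov_posdef[OF n]])
    \<comment> \<open>The noise covariance of an arbitrary optimal point is itself a maximiser, so
      the saddle theorem applies to it directly, with its own gain.\<close>
    have max': "mse A C ?Sx S (gain A C ?Sx S) \<le> mse A C ?Sx (noise_cov s) (gain A C ?Sx (noise_cov s))"
      if "S \<in> ambiguity_cov S_hat ?th" for S
      unfolding opt[OF s] by (rule max[OF that])
    have lf: "least_favorable R D (gaussian \<epsilon>_hat (noise_cov s))"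
      unfolding R D by (rule minimax_saddle(2)[OF n max'])
    have mo: "minimax_optimal R D (\<lambda>\<nu>. K *v \<nu>)"
      unfolding R D K' by (rule minimax_saddle(3)[OF n max'])
    have "minimax_optimal (state_risk A C ?Sx (what (t - 1)) (vhat t) xprior (h xprior + vhat t)) D
        (\<lambda>y. xprior + K *v (y - (h xprior + vhat t)))"
      using mo unfolding R by (intro minimax_optimal_state) (simp add: eps_hat)
    then show ?thesis using lf inv mo by (simp add: diff_diff_eq)
  qed
  ultimately show ?thesis using ex by blast
qed

end
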